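(* Let $G$ be a group and let $S \subseteq G$ be a locally maximal product-free set with $|S| = 3$, such that every two-element subset of $S$ generates $\langle S\rangle$. Then $|G| \leq 24$.
   Context: A non-empty subset $S$ of a group $G$ is product-free if $ab \notin S$ for all $a, b \in S$. It is locally maximal product-free if it is product-free and is not properly contained in any other product-free subset of $G$. $\langle S \rangle$ denotes the subgroup generated by $S$. *)

theory Defs
  imports "HOL-Algebra.Generated_Groups"
begin

definition product_free :: "('a, 'b) monoid_scheme \<Rightarrow> 'a set \<Rightarrow> bool" where
  "product_free G S \<longleftrightarrow> S \<noteq> {} \<and> S \<subseteq> carrier G \<and>
     (\<forall>a\<in>S. \<forall>b\<in>S. a \<otimes>\<^bsub>G\<^esub> b \<notin> S)"

definition locally_maximal_product_free :: "('a, 'b) monoid_scheme \<Rightarrow> 'a set \<Rightarrow> bool" where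
  "locally_maximal_product_free G S \<longleftrightarrow> product_free G S \<and>
     (\<forall>T. product_free G T \<and> S \<subseteq> T \<longrightarrow> T = S)"

end

theory Submission
  imports Defs "HOL-Algebra.Multiplicative_Group"
begin

text \<open>
  If \<open>S\<close> is a locally maximal product-free set, then every \<open>g\<close> lies in
  \<open>S \<union> SS \<union> SS\<^sup>-\<^sup>1 \<union> S\<^sup>-\<^sup>1S\<close> or satisfies \<open>g\<^sup>2 \<in> S\<close>. Applying this to a few well-chosen short words
  \<open>g\<close> in the elements \<open>a, b, c\<close> of \<open>S\<close> forces relations among them. If two elements of \<open>S\<close> commute,
  then \<open>H = \<langle>S\<rangle>\<close> is abelian. Then \<open>H\<close> has at most 24 elements by counting when no \<open>s \<in> S\<close> has its
  inverse in \<open>S\<close>, and is cyclic otherwise, with a generator whose order is bounded by applying the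
  covering property to small powers of it. If no two elements of \<open>S\<close> commute, then \<open>g = s\<^sup>-\<^sup>1\<close> shows
  that either every \<open>s \<in> S\<close> has order 2 or 3, or \<open>abc = 1\<close> up to renaming. In each case branching on
  the values of finitely many words leads either to a relation that is impossible in \<open>H\<close> or to a
  presentation of a group of order at most 24. Finally, elements outside \<open>H\<close> have squares in
  \<open>S \<inter> S\<^sup>-\<^sup>1\<close>, which bounds the index of \<open>H\<close>.
\<close>

section \<open>Certificates for finite presentations\<close>

text \<open>Each use of the covering property is a disjunction of 28 possible values of a word, and
  a few nested uses already produce hundreds of cases, so the nonabelian case is out of reach by
  hand. Yet a single case is settled by a product of conjugates of known relators, which is cheap to
  verify once it has been found: the search stays outside, and only free reduction of explicit words
  takes place in the logic. Soundness then needs nothing but the evaluation of words in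
  \<open>G\<close>; no presented group is ever constructed. The hypothesis on pairs serves several
  purposes: it makes \<open>H\<close> abelian once two elements of \<open>S\<close> commute, it
  makes \<open>H\<close> cyclic once one of two elements is a power of the other, and it lets coset
  tables mention only two of the three elements. The number 24 arises in several ways: as a list of
  24 products and quotients, as 12 elements with index 2, as 6 elements with index 4, and as the
  size of coset tables. Since \<open>G\<close> is not known to be finite in advance, every bound has
  to establish finiteness as well.\<close>

text \<open>
  A word is a string of letters, where changing the case inverts a letter. The letters \<open>a\<close>, \<open>b\<close>, \<open>c\<close>
  stand for the elements of the product-free set; a list of pairs \<open>(x, r)\<close> names known relators \<open>r\<close>
  by further letters \<open>x\<close>.
\<close>

type_synonym word = string

text \<open>Bit 5 (value 32) is where the ASCII codes of a lower and an upper case letter differ, so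
  that toggling it is an involution on all characters.\<close>

primrec flip :: "char \<Rightarrow> char" where
  "flip (Char b0 b1 b2 b3 b4 b5 b6 b7) = Char b0 b1 b2 b3 b4 (\<not> b5) b6 b7"

definition word_inv :: "word \<Rightarrow> word" where
  "word_inv w = rev (map flip w)"

fun push :: "char \<Rightarrow> word \<Rightarrow> word" where
  "push x [] = [x]"
| "push x (y # ys) = (if y = flip x then ys else x # y # ys)"

text \<open>Free reduction. Relators are compared as strings, so every word is first brought to this
  normal form.\<close>

definition reduce :: "word \<Rightarrow> word" where
  "reduce w = foldr push w []"

fun expand :: "(char \<times> word) list \<Rightarrow> word \<Rightarrow> word" where
  "expand D [] = []"
| "expand D (x # w) = (case map_of D x of Some r \<Rightarrow> r
     | None \<Rightarrow> (case map_of D (flip x) of Some r \<Rightarrow> word_inv r | None \<Rightarrow> [x])) @ expand D w"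

fun strip :: "(char \<times> word) list \<Rightarrow> word \<Rightarrow> word" where
  "strip D [] = []"
| "strip D (x # w) = (case map_of D x of Some r \<Rightarrow> []
     | None \<Rightarrow> (case map_of D (flip x) of Some r \<Rightarrow> [] | None \<Rightarrow> [x])) @ strip D w"

text \<open>
  Expanding the names of relators in a word and deleting them gives two words with the same value.
  Every product of conjugates of known relators arises in this way.
\<close>

definition derived_relator :: "(char \<times> word) list \<Rightarrow> word \<Rightarrow> word" where
  "derived_relator D w = reduce (expand D w @ word_inv (strip D w))"

text \<open>New relators go to the front and \<open>map_of\<close> returns the first match, so a
  name may be reused for a later relator. The shadowed one stays in the list and remains available
  to \<open>closed_check\<close>.\<close>

fun add_relators :: "(char \<times> word) list \<Rightarrow> word list \<Rightarrow> (char \<times> word) list" where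
  "add_relators D [] = D"
| "add_relators D (w # ws) = add_relators ((hd w, derived_relator D (tl w)) # D) ws"

text \<open>
  In \<open>Contra ws\<close> and \<open>Closed ws \<dots>\<close> each word of \<open>ws\<close> consists of a name followed by the derivation of
  the relator that gets this name, and the last relator of \<open>Contra ws\<close> has to be one of the forbidden
  words. \<open>Closed ws gens y n rows\<close> asserts \<open>y\<^sup>n = 1\<close> and lists right coset representatives \<open>r\<close> of
  \<open>\<langle>y\<rangle>\<close> together with, for each \<open>g\<close> in \<open>gens\<close>, the pair \<open>(k, r')\<close> such that \<open>r g = y\<^sup>k r'\<close>.
  \<open>Branch x w ts\<close> distinguishes the values that the covering property permits for \<open>w\<close>; the
  resulting relator is called \<open>x\<close>.
\<close>

datatype certificate =
    Contra "word list"
  | Closed "word list" word word nat "(word \<times> (nat \<times> word) list) list"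
  | Branch char word "certificate list"

definition square_targets :: "word list" where
  "square_targets = [''a'', ''b'', ''c'']"

text \<open>All quotients of an element by itself are represented by the empty word, which leaves 25
  words. Together with the three square conditions every \<open>Branch\<close> has 28 cases, and the
  order of the words fixes the order of the subcertificates.\<close>

definition targets :: "word list" where
  "targets = [[], ''a'', ''b'', ''c'', ''aa'', ''ab'', ''ac'', ''ba'', ''bb'', ''bc'', ''ca'', ''cb'', ''cc'',
     ''aB'', ''aC'', ''bA'', ''bC'', ''cA'', ''cB'', ''Ab'', ''Ac'', ''Ba'', ''Bc'', ''Ca'', ''Cb'']"

definition branches :: "word \<Rightarrow> word list" where
  "branches w = map (\<lambda>t. reduce (w @ word_inv t)) targets @
     map (\<lambda>t. reduce (w @ w @ word_inv t)) square_targets"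

fun power_word :: "nat \<Rightarrow> word \<Rightarrow> word" where
  "power_word 0 y = []"
| "power_word (Suc n) y = y @ power_word n y"

text \<open>Two generators suffice because every pair from \<open>S\<close> generates
  \<open>H\<close>. Neither the distinctness of the cosets nor the exact order of \<open>y\<close>
  is checked, since only an upper bound is wanted. Adding \<open>[]\<close> to the relators admits
  table entries that already hold in the free group.\<close>

definition closed_check :: "word list \<Rightarrow> word \<Rightarrow> word \<Rightarrow> nat \<Rightarrow> (word \<times> (nat \<times> word) list) list \<Rightarrow> bool" where
  "closed_check rels gens y n rows \<longleftrightarrow>
     gens \<in> {''ab'', ''ac'', ''bc''} \<and> 0 < n \<and> n * length rows \<le> 24 \<and>
     reduce (power_word n y) \<in> set rels \<and> [] \<in> set (map fst rows) \<and>
     list_all (\<lambda>(r, es). list_all2 (\<lambda>g (k, r'). r' \<in> set (map fst rows) \<and>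
        reduce (r @ [g] @ word_inv (power_word k y @ r')) \<in> set ([] # rels)) gens es) rows"

text \<open>\<open>bad\<close> collects words known to be nontrivial in the case at hand. A list of
  subcertificates that is too short is rejected, so no branch can be skipped.\<close>

fun check :: "word list \<Rightarrow> (char \<times> word) list \<Rightarrow> certificate \<Rightarrow> bool"
and checks :: "word list \<Rightarrow> (char \<times> word) list \<Rightarrow> char \<Rightarrow> word list \<Rightarrow> certificate list \<Rightarrow> bool" where
  "check bad D (Contra ws) = (case add_relators D ws of [] \<Rightarrow> False | (x, r) # D' \<Rightarrow> r \<in> set bad)"
| "check bad D (Closed ws gens y n rows) = closed_check (map snd (add_relators D ws)) gens y n rows"
| "check bad D (Branch x w ts) = checks bad D x (branches w) ts"
| "checks bad D x [] ts = True"
| "checks bad D x (r # rs) [] = False"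
| "checks bad D x (r # rs) (t # ts) = (check bad ((x, r) # D) t \<and> checks bad D x rs ts)"

text \<open>In turn: elements of \<open>S\<close> are not 1, they are distinct, they do not commute,
  and no product \<open>s t\<close> equals some \<open>u\<close> in \<open>S\<close>. Triples with
  \<open>u = t\<close> are absent because their words reduce to a single letter. Membership is
  literal, so the derivations conjugate and invert a relator until it matches one of these
  strings.\<close>

definition forbidden_words :: "word list" where
  "forbidden_words = [''a'', ''b'', ''c'', ''bA'', ''cA'', ''cB'', ''baBA'', ''caCA'',
     ''cbCB'', ''aaB'', ''aaC'', ''abA'', ''abC'', ''acA'', ''acB'', ''baB'', ''baC'', ''bbA'',
     ''bbC'', ''bcA'', ''bcB'', ''caB'', ''caC'', ''cbA'', ''cbC'', ''ccA'', ''ccB'']"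

section \<open>Evaluation of words in a group\<close>

lemma flip_flip [simp]: "flip (flip x) = x"
  by (cases x) simp

text \<open>The default value 1 for other characters makes \<open>flip\<close> correspond to
  inversion without any condition on the character.\<close>

definition (in group) letter :: "'a \<Rightarrow> 'a \<Rightarrow> 'a \<Rightarrow> char \<Rightarrow> 'a" where
  "letter a b c x = (if x = CHR ''a'' then a else if x = CHR ''b'' then b else if x = CHR ''c'' then c
     else if x = CHR ''A'' then inv a else if x = CHR ''B'' then inv b else if x = CHR ''C'' then inv c
     else \<one>)"

definition (in group) eval :: "'a \<Rightarrow> 'a \<Rightarrow> 'a \<Rightarrow> word \<Rightarrow> 'a" where
  "eval a b c w = foldr (\<lambda>x y. letter a b c x \<otimes> y) w \<one>"

locale word_evaluation = group G for G (structure) +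
  fixes a b c
  assumes abc_closed [simp, intro]: "a \<in> carrier G" "b \<in> carrier G" "c \<in> carrier G"
begin

abbreviation "ev \<equiv> eval a b c"

lemma letter_closed [simp, intro]: "letter a b c x \<in> carrier G"
  by (simp add: letter_def)

lemma letter_flip: "letter a b c (flip x) = inv (letter a b c x)"
proof -
  have "flip x = y \<longleftrightarrow> x = flip y" for y by auto
  then show ?thesis by (simp add: letter_def)
qed

lemma ev_Nil [simp]: "ev [] = \<one>"
  and ev_Cons [simp]: "ev (x # w) = letter a b c x \<otimes> ev w"
  by (simp_all add: eval_def)

lemma ev_closed [simp, intro]: "ev w \<in> carrier G"
  by (induction w) auto

lemma ev_append [simp]: "ev (v @ w) = ev v \<otimes> ev w"
  by (induction v) (auto simp: m_assoc)

lemma ev_word_inv [simp]: "ev (word_inv w) = inv (ev w)"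
  by (induction w) (auto simp: word_inv_def letter_flip inv_mult_group)

lemma ev_push: "ev (push x w) = letter a b c x \<otimes> ev w"
  by (induction x w rule: push.induct) (auto simp: letter_flip simp flip: m_assoc)

lemma ev_reduce [simp]: "ev (reduce w) = ev w"
  by (induction w) (auto simp: reduce_def ev_push)

lemma ev_power_word: "ev (power_word n y) = ev y [^] n"
  by (induction n) (simp, metis ev_append ev_closed nat_pow_Suc2 power_word.simps(2))

definition relators_hold :: "(char \<times> word) list \<Rightarrow> bool" where
  "relators_hold D \<longleftrightarrow> (\<forall>r\<in>snd ` set D. ev r = \<one>)"

lemma relators_hold_Cons: "relators_hold ((x, r) # D) \<longleftrightarrow> ev r = \<one> \<and> relators_hold D"
  by (simp add: relators_hold_def)

lemma relators_hold_lookup: "relators_hold D \<Longrightarrow> map_of D x = Some r \<Longrightarrow> ev r = \<one>"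
  unfolding relators_hold_def by (metis imageI map_of_SomeD snd_conv)

text \<open>\<open>expand\<close> and \<open>strip\<close> perform the same lookups, and whatever is
  found has value 1. Names therefore need not be fresh, not even distinct from the letters of the
  generators.\<close>

lemma ev_expand: "relators_hold D \<Longrightarrow> ev (expand D w) = ev (strip D w)"
  by (induction w) (auto split: option.splits dest: relators_hold_lookup)

lemma ev_derived_relator: "relators_hold D \<Longrightarrow> ev (derived_relator D w) = \<one>"
  by (simp add: derived_relator_def ev_expand)

lemma relators_hold_add_relators: "relators_hold D \<Longrightarrow> relators_hold (add_relators D ws)"
  by (induction D ws rule: add_relators.induct) (auto simp: relators_hold_Cons ev_derived_relator)

end

text \<open>Only closure under right multiplication by the generators is assumed: on a finite set these
  multiplications are bijective, so closure under right multiplication by inverses follows.\<close>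

lemma (in group) generate_subset_of_right_closed:
  assumes "finite E" "E \<subseteq> carrier G" "\<one> \<in> E" "X \<subseteq> carrier G"
    and closed: "\<And>e g. e \<in> E \<Longrightarrow> g \<in> X \<Longrightarrow> e \<otimes> g \<in> E"
  shows "generate G X \<subseteq> E"
proof
  have inv_closed: "e \<otimes> inv g \<in> E" if "e \<in> E" "g \<in> X" for e g
  proof -
    have g: "g \<in> carrier G" using that assms by blast
    have "inj_on (\<lambda>e. e \<otimes> g) E"
      using g assms(2) by (meson inj_onI right_cancel subset_eq)
    moreover have "(\<lambda>e. e \<otimes> g) ` E \<subseteq> E" using closed that by blast
    ultimately have "(\<lambda>e. e \<otimes> g) ` E = E" using \<open>finite E\<close> by (simp add: endo_inj_surj)
    then have "e \<in> (\<lambda>e. e \<otimes> g) ` E" using that by simp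
    then obtain f where f: "f \<in> E" "e = f \<otimes> g" by (elim imageE)
    then have "f \<in> carrier G" using assms by blast
    then have "e \<otimes> inv g = f" using f g by (simp add: m_assoc)
    then show ?thesis using f by simp
  qed
  fix h assume "h \<in> generate G X"
  then have "\<forall>e\<in>E. e \<otimes> h \<in> E"
  proof (induction h rule: generate.induct)
    case one
    then show ?case using assms(2) by (auto simp: subset_eq)
  next
    case (eng h1 h2)
    have "h1 \<in> carrier G" "h2 \<in> carrier G"
      using eng generate_in_carrier assms(4) by blast+
    then show ?case using eng assms(2) by (auto simp: subset_eq simp flip: m_assoc)
  qed (use closed inv_closed in auto)
  then have "\<one> \<otimes> h \<in> E" using assms by blast
  then show "h \<in> E" using \<open>h \<in> generate G X\<close> generate_in_carrier[OF assms(4)] by simp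
qed

section \<open>The covering property and the soundness of certificates\<close>

locale product_free_cover = group G for G (structure) +
  fixes S
  assumes S_closed: "S \<subseteq> carrier G"
    and product_free: "\<And>s t. s \<in> S \<Longrightarrow> t \<in> S \<Longrightarrow> s \<otimes> t \<notin> S"
    and cover: "\<And>g. g \<in> carrier G \<Longrightarrow> g \<in> S \<or>
      (\<exists>s\<in>S. \<exists>t\<in>S. g = s \<otimes> t \<or> g = s \<otimes> inv t \<or> g = inv s \<otimes> t) \<or> g \<otimes> g \<in> S"
    and pair_generates: "\<And>s t. s \<in> S \<Longrightarrow> t \<in> S \<Longrightarrow> s \<noteq> t \<Longrightarrow> generate G {s, t} = generate G S"

text \<open>Only this locale depends on an order of the three elements; symmetric cases are obtained
  by interpreting it again with the names permuted.\<close>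

locale product_free_triple = product_free_cover G S + word_evaluation G a b c for G (structure) and S a b c +
  assumes S_eq: "S = {a, b, c}" and distinct: "distinct [a, b, c]"
begin

lemma ev_branch:
  shows "\<exists>r\<in>set (branches w). ev r = \<one>"
proof -
  have T: "\<exists>r\<in>set (branches w). ev r = \<one>" if "t \<in> set targets" "ev w = ev t" for t
    using that by (force simp: branches_def)
  have Q: "\<exists>r\<in>set (branches w). ev r = \<one>" if "t \<in> set square_targets" "ev w \<otimes> ev w = ev t" for t
    using that by (force simp: branches_def simp flip: m_assoc)
  have T': "(\<exists>t\<in>set targets. ev w = ev t) \<or> (\<exists>t\<in>set square_targets. ev w \<otimes> ev w = ev t)"
    using cover[of "ev w"] by (simp add: S_eq targets_def square_targets_def letter_def) (elim disjE; simp)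
  then show ?thesis using T Q by blast
qed

text \<open>The elements \<open>y^k r\<close> with \<open>k < n\<close> and \<open>r\<close> a
  listed representative contain 1 and are closed under right multiplication by two elements of
  \<open>S\<close>, hence they exhaust \<open>H\<close>.\<close>

lemma closed_check_sound:
  assumes "closed_check rels gens y n rows" and rels: "\<And>r. r \<in> set rels \<Longrightarrow> ev r = \<one>"
  shows "finite (generate G S) \<and> card (generate G S) \<le> 24"
proof -
  define R where "R = fst ` set rows"
  define E where "E = (\<lambda>(k, r). ev y [^] k \<otimes> ev r) ` ({..<n} \<times> R)"
  have n: "0 < n" "n * length rows \<le> 24" "ev y [^] n = \<one>" "[] \<in> R"
    and rows: "\<And>r es. (r, es) \<in> set rows \<Longrightarrow> list_all2 (\<lambda>g (k, r'). r' \<in> set (map fst rows) \<and>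
        reduce (r @ [g] @ word_inv (power_word k y @ r')) \<in> set ([] # rels)) gens es"
    and gens: "gens \<in> {''ab'', ''ac'', ''bc''}"
    using assms ev_power_word[of n y] ev_reduce[of "power_word n y"]
    by (auto simp: closed_check_def R_def list_all_iff simp del: ev_reduce)
  have "card R \<le> length rows" unfolding R_def
    by (metis List.finite_set card_image_le card_length le_trans)
  then have "card ({..<n} \<times> R) \<le> 24" using n(2)
    by (simp add: card_cartesian_product) (metis le_trans mult_le_mono2)
  moreover have fin: "finite ({..<n} \<times> R)" by (simp add: R_def)
  ultimately have E: "finite E" "card E \<le> 24"
    unfolding E_def using card_image_le[OF fin] le_trans by blast+
  \<comment> \<open>Multiplying by a generator adds the exponent from the table to the present one,
    so the sum may exceed \<open>n\<close> and is reduced modulo \<open>n\<close>.\<close>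
  have mem: "ev y [^] (k :: nat) \<otimes> ev r \<in> E" if "r \<in> R" for k r
  proof -
    have "ev y [^] k = ev y [^] (n * (k div n) + k mod n)" by simp
    also have "\<dots> = (ev y [^] n) [^] (k div n) \<otimes> ev y [^] (k mod n)"
      by (simp only: nat_pow_mult[symmetric] nat_pow_pow ev_closed)
    finally have "ev y [^] k = ev y [^] (k mod n)" using n by simp
    moreover have "k mod n < n" using n by simp
    ultimately show ?thesis using that by (auto simp: E_def)
  qed
  have closed: "e \<otimes> letter a b c g \<in> E" if e: "e \<in> E" and g: "g \<in> set gens" for e g
  proof -
    obtain k :: nat and r where kr: "e = ev y [^] k \<otimes> ev r" "r \<in> R" using e by (auto simp: E_def)
    then obtain es where "(r, es) \<in> set rows" by (auto simp: R_def)
    from rows[OF this] g obtain l :: nat and r' where r': "r' \<in> R"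
      "reduce (r @ [g] @ word_inv (power_word l y @ r')) \<in> set ([] # rels)"
      by (auto simp: list_all2_conv_all_nth in_set_conv_nth R_def split: prod.splits) (metis surj_pair)
    have "ev (reduce (r @ [g] @ word_inv (power_word l y @ r'))) = \<one>"
      using r'(2) rels by (metis ev_Nil set_ConsD)
    then have "ev r \<otimes> letter a b c g \<otimes> inv (ev y [^] l \<otimes> ev r') = \<one>"
      by (simp add: ev_power_word m_assoc)
    then have "ev r \<otimes> letter a b c g = ev y [^] l \<otimes> ev r'"
      by (metis inv_equality inv_inv ev_closed letter_closed m_closed nat_pow_closed inv_closed)
    then have "e \<otimes> letter a b c g = ev y [^] k \<otimes> (ev y [^] l \<otimes> ev r')" by (simp add: kr m_assoc)
    also have "\<dots> = ev y [^] (k + l) \<otimes> ev r'"  by (simp add: nat_pow_mult[symmetric] m_assoc)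
    finally show ?thesis using mem[OF r'(1)] by simp
  qed
  have "generate G (letter a b c ` set gens) \<subseteq> E"
  proof (rule generate_subset_of_right_closed)
    show "\<one> \<in> E" using mem[OF n(4), of 0] by simp
  qed (use E closed in \<open>auto simp: E_def\<close>)
  moreover have "generate G (letter a b c ` set gens) = generate G S"
    using gens pair_generates distinct by (auto simp: letter_def S_eq)
  ultimately show ?thesis using E by (metis card_mono finite_subset le_trans)
qed

text \<open>The second part assumes only that some listed relator holds: either it is the first one
  and the first subcertificate applies, or it is among the rest. An empty list contradicts this
  assumption.\<close>

lemma check_sound:
  shows "check bad D cert \<Longrightarrow> \<forall>w\<in>set bad. ev w \<noteq> \<one> \<Longrightarrow> relators_hold D \<Longrightarrow> finite (generate G S) \<and> card (generate G S) \<le> 24"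
    and "checks bad D x rs certs \<Longrightarrow> \<forall>w\<in>set bad. ev w \<noteq> \<one> \<Longrightarrow> relators_hold D \<Longrightarrow> \<exists>r\<in>set rs. ev r = \<one> \<Longrightarrow>
      finite (generate G S) \<and> card (generate G S) \<le> 24"
proof (induction bad D cert and bad D x rs certs rule: check_checks.induct)
  case (1 bad D ws)
  then obtain x r D' where "add_relators D ws = (x, r) # D'" "r \<in> set bad" by (auto split: list.splits)
  then show ?case using 1 relators_hold_add_relators[of D ws] by (auto simp: relators_hold_Cons)
next
  case (2 bad D ws gens y n rows)
  then have "ev r = \<one>" if "r \<in> set (map snd (add_relators D ws))" for r
    using that relators_hold_add_relators[of D ws] by (auto simp: relators_hold_def)
  then show ?case using closed_check_sound[of "map snd (add_relators D ws)"] 2 by simp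
next
  case (3 bad D x w ts)
  then show ?case using ev_branch by simp
next
  case (6 bad D x r rs t ts)
  then show ?case by (auto simp: relators_hold_Cons)
qed simp_all

lemma bad_words_nontrivial:
  assumes "\<And>s t. s \<in> S \<Longrightarrow> t \<in> S \<Longrightarrow> s \<noteq> t \<Longrightarrow> s \<otimes> t \<noteq> t \<otimes> s"
  shows "\<forall>w\<in>set forbidden_words. ev w \<noteq> \<one>"
proof -
  have pf: "s \<otimes> t \<noteq> u" if "s \<in> S" "t \<in> S" "u \<in> S" for s t u
    using product_free that by blast
  have 1: "s \<noteq> \<one>" if "s \<in> S" for s
    using pf[of s s s] that S_closed by auto
  have eq: "s \<otimes> t = \<one> \<longleftrightarrow> s = inv t" if "s \<in> carrier G" "t \<in> carrier G" for s t
    using that by (metis inv_equality inv_inv l_inv)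
  have [simp]: "s \<in> carrier G" if "s \<in> S" for s using that S_closed by blast
  have 2: "s \<otimes> inv t \<noteq> \<one>" if "s \<in> S" "t \<in> S" "s \<noteq> t" for s t
    using that by (simp add: eq)
  have 3: "s \<otimes> (t \<otimes> inv u) \<noteq> \<one>" if "s \<in> S" "t \<in> S" "u \<in> S" for s t u
    using that pf[of s t u] eq[of "s \<otimes> t" "inv u"] by (simp add: m_assoc)
  have 4: "s \<otimes> (t \<otimes> (inv s \<otimes> inv t)) \<noteq> \<one>" if "s \<in> S" "t \<in> S" "s \<noteq> t" for s t
    using that assms[of s t] eq[of "s \<otimes> t" "inv (t \<otimes> s)"] by (simp add: m_assoc inv_mult_group)
  show ?thesis
    using 1 2 3 4 distinct unfolding forbidden_words_def
    by (auto simp: letter_def S_eq)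
qed

end

section \<open>Locally maximal product-free sets\<close>

text \<open>Adjoining an uncovered \<open>g\<close> would keep \<open>S\<close> product-free. A
  product \<open>g s = t\<close> or \<open>s g = t\<close> makes \<open>g\<close> a quotient,
  \<open>s t = g\<close> makes it a product, and \<open>g g\<close> in \<open>S\<close> is the last
  alternative.\<close>

lemma (in group) product_free_cover_of_locally_maximal:
  assumes S: "locally_maximal_product_free G S"
    and gen: "\<And>s t. s \<in> S \<Longrightarrow> t \<in> S \<Longrightarrow> s \<noteq> t \<Longrightarrow> generate G {s, t} = generate G S"
  shows "product_free_cover G S"
proof -
  have S_closed: "S \<subseteq> carrier G" and "S \<noteq> {}"
    and pf: "\<And>s t. s \<in> S \<Longrightarrow> t \<in> S \<Longrightarrow> s \<otimes> t \<notin> S"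
    and max: "\<And>T. product_free G T \<Longrightarrow> S \<subseteq> T \<Longrightarrow> T = S"
    using S by (auto simp: locally_maximal_product_free_def product_free_def)
  have no_one: "\<one> \<notin> S" using pf[of \<one> \<one>] by auto
  obtain s0 where s0: "s0 \<in> S" "s0 \<in> carrier G" using \<open>S \<noteq> {}\<close> S_closed by blast
  have "g \<in> S \<or> (\<exists>s\<in>S. \<exists>t\<in>S. g = s \<otimes> t \<or> g = s \<otimes> inv t \<or> g = inv s \<otimes> t) \<or> g \<otimes> g \<in> S"
    if g: "g \<in> carrier G" for g
  proof (rule ccontr)
    assume neg: "\<not> ?thesis"
    then have gS: "g \<notin> S" "g \<otimes> g \<notin> S" by auto
    have [simp]: "s \<in> carrier G" if "s \<in> S" for s using that S_closed by blast
    \<comment> \<open>The identity is a quotient of any element by itself and hence covered; this is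
      where \<open>S \<noteq> {}\<close> enters.\<close>
    have "g \<noteq> s0 \<otimes> inv s0" using neg s0 by blast
    then have g1: "g \<noteq> \<one>" using s0 by simp
    have "g \<otimes> g \<noteq> g" using g g1 by auto
    moreover have "g \<otimes> s \<noteq> t" if "s \<in> S" "t \<in> S" for s t
    proof
      assume "g \<otimes> s = t"
      then have "g = t \<otimes> inv s" using g that by (auto simp: m_assoc)
      then show False using neg that by blast
    qed
    moreover have "s \<otimes> g \<noteq> t" if "s \<in> S" "t \<in> S" for s t
    proof
      assume "s \<otimes> g = t"
      then have "g = inv s \<otimes> t" using g that by (auto simp flip: m_assoc)
      then show False using neg that by blast
    qed
    moreover have "g \<otimes> s \<noteq> g" "s \<otimes> g \<noteq> g" if "s \<in> S" for s
      using that g no_one by auto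
    moreover have "s \<otimes> t \<noteq> g" if "s \<in> S" "t \<in> S" for s t
      using neg that by blast
    ultimately have "product_free G (insert g S)"
      using pf gS g S_closed unfolding product_free_def by auto
    then show False using max[of "insert g S"] gS by blast
  qed
  then show ?thesis
    using S_closed pf gen by unfold_locales auto
qed

section \<open>The subgroup \<open>H\<close> and the elements outside it\<close>

context product_free_cover begin

lemma in_carrier [simp]: "s \<in> S \<Longrightarrow> s \<in> carrier G"
  using S_closed by blast

abbreviation H where "H \<equiv> generate G S"

lemma H_subgroup: "subgroup H G"
  using generate_is_subgroup[OF S_closed] .

lemma H_carrier [simp]: "h \<in> H \<Longrightarrow> h \<in> carrier G"
  using generate_in_carrier[OF S_closed] .

lemma S_in_H [simp]: "s \<in> S \<Longrightarrow> s \<in> H"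
  by (rule generate.incl)

lemma H_closed [simp]: "x \<in> H \<Longrightarrow> y \<in> H \<Longrightarrow> x \<otimes> y \<in> H" "x \<in> H \<Longrightarrow> inv x \<in> H" "\<one> \<in> H"
  using H_subgroup by (simp_all add: subgroup.m_closed subgroup.m_inv_closed subgroup.one_closed)

lemma one_notin_S [simp]: "\<one> \<notin> S"
  using product_free[of \<one> \<one>] by auto

lemma square_in_S:
  assumes "x \<in> carrier G" "x \<notin> H"
  shows "x \<otimes> x \<in> S"
  using cover[OF assms(1)] assms(2) by auto

lemma H_cancel: "x \<in> carrier G \<Longrightarrow> h \<in> H \<Longrightarrow> x \<otimes> h \<in> H \<longleftrightarrow> x \<in> H"
  "x \<in> carrier G \<Longrightarrow> h \<in> H \<Longrightarrow> h \<otimes> x \<in> H \<longleftrightarrow> x \<in> H"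
  "x \<in> carrier G \<Longrightarrow> inv x \<in> H \<longleftrightarrow> x \<in> H"
proof -
  assume x: "x \<in> carrier G"
  show "inv x \<in> H \<longleftrightarrow> x \<in> H" using x by (metis H_closed(2) inv_inv)
  assume h: "h \<in> H"
  have "x \<otimes> h \<otimes> inv h = x" "inv h \<otimes> (h \<otimes> x) = x" using x h by (simp_all add: m_assoc flip: m_assoc[of _ h x])
  then show "x \<otimes> h \<in> H \<longleftrightarrow> x \<in> H" "h \<otimes> x \<in> H \<longleftrightarrow> x \<in> H" using h by (metis H_closed)+
qed

text \<open>\<open>inv x\<close> lies outside \<open>H\<close> as well. So squares of outside
  elements belong to \<open>S\<close> together with their inverses, and this is what controls the
  index of \<open>H\<close>.\<close>

lemma inv_square_in_S:
  assumes "x \<in> carrier G" "x \<notin> H"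
  shows "inv (x \<otimes> x) \<in> S"
  using square_in_S[of "inv x"] assms by (simp add: H_cancel inv_mult_group)

text \<open>If all elements outside \<open>H\<close> have the same square, each of them inverts \<open>H\<close> by conjugation,
  whereas a product of two of them centralizes \<open>H\<close>.\<close>

lemma card_le_double:
  assumes H: "finite H" "card H \<le> n" and h: "h \<in> H" "h \<otimes> h \<noteq> \<one>"
    and sq: "\<And>x. x \<in> carrier G \<Longrightarrow> x \<notin> H \<Longrightarrow> x \<otimes> x = z"
  shows "finite (carrier G) \<and> card (carrier G) \<le> 2 * n"
proof (cases "carrier G \<subseteq> H")
  case True
  then have "carrier G = H" using generate_in_carrier[OF S_closed] by blast
  then show ?thesis using H by simp
next
  case False
  then obtain x where x: "x \<in> carrier G" "x \<notin> H" by blast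
  have inverts: "h \<otimes> (y \<otimes> h) = y" if y: "y \<in> carrier G" "y \<notin> H" for y
  proof -
    have "y \<otimes> h \<otimes> (y \<otimes> h) = y \<otimes> y" using y h sq H_cancel by simp
    then show ?thesis using y h by (simp add: m_assoc)
  qed
  have "y \<in> (\<lambda>k. x \<otimes> k) ` H" if y: "y \<in> carrier G" "y \<notin> H" for y
  proof (rule ccontr)
    assume neg: "y \<notin> (\<lambda>k. x \<otimes> k) ` H"
    define w where "w = inv x \<otimes> y"
    have yw: "y = x \<otimes> w" "w \<in> carrier G" unfolding w_def using x y by (simp_all flip: m_assoc)
    then have w: "w \<notin> H" using neg by blast
    \<comment> \<open>Now \<open>x\<close>, \<open>w\<close> and \<open>x w\<close> all lie outside
      \<open>H\<close>. Moving \<open>h\<close> across \<open>x\<close> and then across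
      \<open>w\<close> inverts it twice, moving it across \<open>x w\<close> inverts it once, so
      \<open>h h = 1\<close>.\<close>
    have "h \<otimes> (x \<otimes> w \<otimes> h) = x \<otimes> w" using inverts[OF y] yw by simp
    moreover have "h \<otimes> (x \<otimes> w \<otimes> h) = h \<otimes> x \<otimes> (w \<otimes> h)" using h x yw by (simp add: m_assoc)
    moreover have "h \<otimes> x \<otimes> (h \<otimes> (w \<otimes> h)) = x \<otimes> (w \<otimes> h)"
      using inverts[OF x] x h yw by (metis H_carrier m_assoc m_closed)
    ultimately have "h \<otimes> x \<otimes> w = x \<otimes> (w \<otimes> h)" "h \<otimes> x \<otimes> (w \<otimes> h) = x \<otimes> w"
      using inverts[OF yw(2) w] h x yw by auto
    then have "x \<otimes> w \<otimes> h \<otimes> h = x \<otimes> w"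
      using h x yw by (metis H_carrier m_assoc m_closed)
    then show False using h x yw by (simp add: m_assoc)
  qed
  then have sub: "carrier G \<subseteq> H \<union> (\<lambda>k. x \<otimes> k) ` H" by blast
  have "card (H \<union> (\<lambda>k. x \<otimes> k) ` H) \<le> card H + card ((\<lambda>k. x \<otimes> k) ` H)" by (rule card_Un_le)
  also have "\<dots> \<le> 2 * n" using card_image_le[OF H(1), of "\<lambda>k. x \<otimes> k"] H(2) by simp
  finally show ?thesis using sub H(1) by (meson card_mono finite_UnI finite_imageI finite_subset le_trans)
qed

text \<open>The same induction is used twice: it shows that \<open>y\<close> commutes with the
  generators \<open>s\<close> and \<open>t\<close>, and then that \<open>x\<close> commutes with
  \<open>y\<close>.\<close>

lemma generate_pair_comm:
  assumes "s \<in> carrier G" "t \<in> carrier G" "s \<otimes> t = t \<otimes> s" "x \<in> generate G {s, t}" "y \<in> generate G {s, t}"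
  shows "x \<otimes> y = y \<otimes> x"
proof -
  have carr: "{s, t} \<subseteq> carrier G" using assms by simp
  have comm_gen: "x \<otimes> u = u \<otimes> x" if "u \<in> carrier G" "s \<otimes> u = u \<otimes> s" "t \<otimes> u = u \<otimes> t" "x \<in> generate G {s, t}" for u x
    using that(4)
  proof (induction x rule: generate.induct)
    case (inv h)
    then have "h \<in> carrier G" "h \<otimes> u = u \<otimes> h" using that assms by auto
    then show ?case using that(1) by (metis inv_closed inv_solve_left inv_solve_right m_assoc m_closed)
  next
    case (eng h1 h2)
    then have "h1 \<in> carrier G" "h2 \<in> carrier G" using generate_in_carrier[OF carr] by auto
    then show ?case using eng that(1) by (metis m_assoc)
  qed (use that assms in auto)
  have y: "y \<in> carrier G" using generate_in_carrier[OF carr] assms by auto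
  have "y \<otimes> s = s \<otimes> y" "y \<otimes> t = t \<otimes> y"
    using comm_gen[OF assms(1) refl assms(3)[symmetric] assms(5)] comm_gen[OF assms(2) assms(3) refl assms(5)] .
  from comm_gen[OF y this[symmetric] assms(4)] show ?thesis .
qed

lemma H_comm:
  assumes "s \<in> S" "t \<in> S" "s \<noteq> t" "s \<otimes> t = t \<otimes> s" "x \<in> H" "y \<in> H"
  shows "x \<otimes> y = y \<otimes> x"
  using generate_pair_comm[of s t x y] pair_generates[of s t] assms by simp

end

context product_free_triple begin

lemma abc_in [simp]: "a \<in> S" "b \<in> S" "c \<in> S"
  by (simp_all add: S_eq)

lemma abc_neq: "a \<noteq> b" "a \<noteq> c" "b \<noteq> c"
  using distinct by auto

end

section \<open>Abelian triples in which no element has its inverse in \<open>S\<close>\<close>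

locale abelian_triple = product_free_triple +
  assumes comm: "x \<in> generate G S \<Longrightarrow> y \<in> generate G S \<Longrightarrow> x \<otimes> y = y \<otimes> x"
begin

lemma abelian_no_inverses:
  assumes R: "\<And>s. s \<in> S \<Longrightarrow> inv s \<notin> S"
  shows "finite (carrier G) \<and> card (carrier G) \<le> 24"
proof -
  have "x \<in> H" if "x \<in> carrier G" for x
    using that R square_in_S inv_square_in_S by blast
  then have H: "carrier G = H" by auto
  interpret comm_group G
    by (rule group_comm_groupI) (use comm H in auto)
  \<comment> \<open>Together with all inverses there are 25 candidate values. Writing
    \<open>inv a\<close> as a product of two elements of \<open>S\<close> identifies two of
    them.\<close>
  obtain u v where uv: "u \<in> S" "v \<in> S" "inv a = u \<otimes> v"
  proof -
    have no_quotient: "inv a \<noteq> s \<otimes> inv t" if "s \<in> S" "t \<in> S" for s t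
    proof
      assume "inv a = s \<otimes> inv t"
      then have "inv a \<otimes> t = s" using that by (simp add: m_assoc)
      then have "t = a \<otimes> s" using that by (auto simp flip: m_assoc)
      then show False using product_free[of a s] that by simp
    qed
    \<comment> \<open>If the square of \<open>inv a\<close> lies in \<open>S\<close>, it serves as
      the second factor, with \<open>a\<close> as the first.\<close>
    have "inv a = a \<otimes> (inv a \<otimes> inv a)" by (simp flip: m_assoc)
    then show ?thesis
      using cover[of "inv a"] R[of a] that no_quotient m_comm[of "inv _"] by (metis abc_closed(1) abc_in(1) in_carrier inv_closed m_comm)
  qed
  \<comment> \<open>24 entries: 1, three elements of \<open>S\<close>, two of their inverses, six
    products, six inverses of products and six quotients.\<close>
  define L where "L = [\<one>, a, b, c, a \<otimes> a, b \<otimes> b, c \<otimes> c, a \<otimes> b, a \<otimes> c, b \<otimes> c,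
    a \<otimes> inv b, a \<otimes> inv c, b \<otimes> inv a, b \<otimes> inv c, c \<otimes> inv a, c \<otimes> inv b,
    inv b, inv c, inv a \<otimes> inv a, inv b \<otimes> inv b, inv c \<otimes> inv c, inv a \<otimes> inv b, inv a \<otimes> inv c, inv b \<otimes> inv c]"
  have "inv a \<in> set L" using uv by (auto simp: L_def S_eq m_comm)
  then have S1: "\<forall>s\<in>S. s \<in> set L" "\<forall>s\<in>S. inv s \<in> set L"
    by (simp_all add: S_eq) (simp_all add: L_def)
  have S2: "\<forall>s\<in>S. \<forall>t\<in>S. s \<otimes> t \<in> set L" "\<forall>s\<in>S. \<forall>t\<in>S. inv s \<otimes> inv t \<in> set L"
    by (simp_all only: S_eq ball_simps L_def list.set insert_iff simp_thms m_comm[of b a] m_comm[of c a]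
        m_comm[of c b] m_comm[of "inv b" "inv a"] m_comm[of "inv c" "inv a"] m_comm[of "inv c" "inv b"]
        abc_closed inv_closed)
  have S3: "\<forall>s\<in>S. \<forall>t\<in>S. s \<otimes> inv t \<in> set L"
    by (simp only: S_eq ball_simps L_def list.set insert_iff simp_thms r_inv abc_closed)
  have S4: "inv s \<otimes> t \<in> set L" if "s \<in> S" "t \<in> S" for s t
    using S3 that by (simp add: m_comm)
  have T: "g \<in> set L \<and> inv g \<in> set L" if "g \<in> carrier G" "g \<otimes> g \<notin> S" for g
    using cover[OF that(1)] that(2)
  proof (elim disjE bexE)
    fix s t assume st: "s \<in> S" "t \<in> S"
    show ?thesis if "g = s \<otimes> t" using that st S2 by (simp add: inv_mult)
    show ?thesis if "g = s \<otimes> inv t" using that st S3 S4 by (simp add: inv_mult)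
    show ?thesis if "g = inv s \<otimes> t" using that st S3 S4 by (simp add: inv_mult)
  qed (use S1 in auto)
  have "g \<in> set L" if g: "g \<in> carrier G" for g
  proof (cases "g \<otimes> g \<in> S")
    case True
    \<comment> \<open>A square root of an element of \<open>S\<close> is reached through its
      inverse, whose square is not in \<open>S\<close>; \<open>T\<close> puts an element and its
      inverse on the list simultaneously.\<close>
    then have "inv g \<otimes> inv g \<notin> S" using R g by (auto simp flip: inv_mult_group)
    then show ?thesis using T[of "inv g"] g by simp
  qed (use T g in blast)
  then have "carrier G \<subseteq> set L" by blast
  moreover have "card (set L) \<le> 24" using card_length[of L] by (simp add: L_def)
  ultimately show ?thesis by (meson card_mono finite_set finite_subset le_trans)
qed

end

section \<open>Index at most four\<close>

context product_free_cover begin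

text \<open>By \<open>swap\<close>, interchanging two outside elements whose product is also outside
  costs a factor from \<open>S\<close>. If \<open>x\<close>, \<open>y\<close> and \<open>w\<close>
  were independent modulo \<open>H\<close>, interchanging \<open>w\<close> with \<open>x y\<close>
  would cost a factor from \<open>S\<close> that is also a product of two elements of
  \<open>S\<close>.\<close>

lemma card_le_quadruple:
  assumes H: "finite H" "card H \<le> n"
    and S_inv: "\<And>s. s \<in> S \<Longrightarrow> inv s \<in> S"
    and S_triple: "\<And>s t u. s \<in> S \<Longrightarrow> t \<in> S \<Longrightarrow> u \<in> S \<Longrightarrow> s \<otimes> (t \<otimes> u) \<in> S"
    and normal: "\<And>x s. x \<in> carrier G \<Longrightarrow> x \<notin> H \<Longrightarrow> s \<in> S \<Longrightarrow> \<exists>t\<in>S. s \<otimes> x = x \<otimes> t"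
  shows "finite (carrier G) \<and> card (carrier G) \<le> 4 * n"
proof -
  have swap: "\<exists>s\<in>S. q \<otimes> p = p \<otimes> q \<otimes> s"
    if pq: "p \<in> carrier G" "q \<in> carrier G" "p \<notin> H" "q \<notin> H" "p \<otimes> q \<notin> H" for p q
  proof -
    \<comment> \<open>This is p^-1 q p q^-1, written as a product of p^-2, (p q)^2 and q^-2, all of
      which lie in \<open>S\<close>.\<close>
    define s where "s = inv (p \<otimes> p) \<otimes> (p \<otimes> q \<otimes> (p \<otimes> q) \<otimes> inv (q \<otimes> q))"
    have "s \<in> S" unfolding s_def using pq by (intro S_triple S_inv square_in_S) auto
    then obtain t where t: "t \<in> S" "s \<otimes> q = q \<otimes> t" using normal pq by blast
    have "p \<otimes> (s \<otimes> q) = p \<otimes> (inv p \<otimes> (inv p \<otimes> (p \<otimes> (q \<otimes> (p \<otimes> (q \<otimes> (inv q \<otimes> (inv q \<otimes> q))))))))"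
      using pq unfolding s_def by (simp add: m_assoc inv_mult_group)
    also have "\<dots> = q \<otimes> p" using pq by (simp flip: m_assoc)
    finally have "q \<otimes> p = p \<otimes> q \<otimes> t" using t pq by (simp add: m_assoc)
    then show ?thesis using t by blast
  qed
  define coset where "coset x = (\<lambda>h. x \<otimes> h) ` H" for x
  have coset_if: "q \<in> coset p" if "p \<in> carrier G" "q \<in> carrier G" "p \<notin> H" "p \<otimes> q \<in> H" for p q
  proof -
    have "q = p \<otimes> (inv (p \<otimes> p) \<otimes> (p \<otimes> q))"
      using that by (simp add: inv_mult_group m_assoc) (simp flip: m_assoc)
    moreover have "inv (p \<otimes> p) \<otimes> (p \<otimes> q) \<in> H" using inv_square_in_S[of p] that by simp
    ultimately show ?thesis unfolding coset_def by blast
  qed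
  have in_H: "p \<otimes> q \<in> H" if "p \<in> carrier G" "q \<in> carrier G" "p \<notin> H" "q \<notin> H" "q \<otimes> p \<in> H" for p q
    using swap[of p q] that by (metis H_cancel(1) S_in_H m_closed)
  obtain x y where xy: "x \<in> carrier G" "y \<in> carrier G"
    "carrier G \<subseteq> H \<union> coset x \<union> coset y \<union> coset (x \<otimes> y)"
  proof (cases "\<exists>x\<in>carrier G. x \<notin> H")
    case True
    then obtain x where x: "x \<in> carrier G" "x \<notin> H" by blast
    show thesis
    proof (cases "\<exists>y\<in>carrier G. y \<notin> H \<and> y \<notin> coset x")
      case True
      then obtain y where y: "y \<in> carrier G" "y \<notin> H" "y \<notin> coset x" by blast
      then have xy: "x \<otimes> y \<notin> H" using x coset_if by blast
      have False if w: "w \<in> carrier G" "w \<notin> H" "w \<notin> coset x" "w \<notin> coset y" "w \<notin> coset (x \<otimes> y)" for w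
      proof -
        \<comment> \<open>As \<open>w\<close> avoids the cosets of \<open>x\<close>,
          \<open>y\<close> and \<open>x y\<close>, the three products stay outside \<open>H\<close>
          and \<open>swap\<close> applies to each.\<close>
        have out: "w \<otimes> x \<notin> H" "w \<otimes> y \<notin> H" "w \<otimes> (x \<otimes> y) \<notin> H"
          using w x y xy coset_if in_H[of _ w] by (meson m_closed)+
        obtain s t u where s: "s \<in> S" "x \<otimes> w = w \<otimes> x \<otimes> s" and t: "t \<in> S" "y \<otimes> w = w \<otimes> y \<otimes> t"
          and u: "u \<in> S" "x \<otimes> y \<otimes> w = w \<otimes> (x \<otimes> y) \<otimes> u"
          using swap[of w x] swap[of w y] swap[of w "x \<otimes> y"] out w x y xy by auto
        obtain s' where s': "s' \<in> S" "s \<otimes> y = y \<otimes> s'" using normal y s by blast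
        have "x \<otimes> y \<otimes> w = x \<otimes> w \<otimes> (y \<otimes> t)" using x y w t by (simp add: m_assoc)
        also have "\<dots> = w \<otimes> x \<otimes> (s \<otimes> y) \<otimes> t" unfolding s(2) using x y w s t by (simp add: m_assoc)
        also have "\<dots> = w \<otimes> (x \<otimes> y) \<otimes> (s' \<otimes> t)" unfolding s'(2) using x y w s' t by (simp add: m_assoc)
        \<comment> \<open>Moving \<open>w\<close> past \<open>x\<close> and then past
          \<open>y\<close> costs \<open>s' t\<close>, moving it past \<open>x y\<close> at once
          costs \<open>u\<close>.\<close>
        finally have "s' \<otimes> t = u" using u x y w s' t by simp
        then show False using product_free s' t u by blast
      qed
      then show ?thesis using that[of x y] x y by blast
    next
      case False
      then show ?thesis using that[of x x] x by blast
    qed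
  qed (use that[of \<one> \<one>] in blast)
  have fin: "finite (coset z)" "card (coset z) \<le> n" for z
    using H card_image_le[OF H(1), of "\<lambda>h. z \<otimes> h"] unfolding coset_def by auto
  have "card (H \<union> coset x \<union> coset y \<union> coset (x \<otimes> y)) \<le> card H + card (coset x) + card (coset y) + card (coset (x \<otimes> y))"
    by (meson add_le_mono card_Un_le le_refl le_trans)
  also have "\<dots> \<le> 4 * n" using H fin[of x] fin[of y] fin[of "x \<otimes> y"] by linarith
  finally show ?thesis using xy fin H(1) by (meson card_mono finite_UnI finite_subset le_trans)
qed

end

section \<open>The abelian case\<close>

text \<open>Eliminates \<open>k\<close> from a congruence: multiplication by \<open>r\<close> makes
  the term with \<open>k\<close> vanish modulo \<open>N\<close>.\<close>

lemma multiples_combine: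
  fixes N :: int
  assumes "N dvd p + q * k" "N dvd r * k" shows "N dvd r * p"
proof -
  have "r * p = r * (p + q * k) - q * (r * k)" by (simp add: algebra_simps)
  then show ?thesis using assms by (metis dvd_diff dvd_mult)
qed

text \<open>The conditions on \<open>S\<close>, written additively, when \<open>S\<close> consists
  of the powers of an element \<open>g\<close> of order \<open>N\<close> with exponents in
  \<open>E\<close>. Infinite order is included as \<open>N = 0\<close>, where divisibility means
  being zero; a conclusion \<open>N dvd d\<close> with \<open>d > 0\<close> excludes it.\<close>

locale exponents =
  fixes N :: int and E :: "int set"
  assumes pf: "i \<in> E \<Longrightarrow> j \<in> E \<Longrightarrow> l \<in> E \<Longrightarrow> \<not> N dvd i + j - l"
    and cov: "\<exists>i\<in>E. N dvd m - i \<or> N dvd 2 * m - i \<or> (\<exists>j\<in>E. N dvd m - (i + j) \<or> N dvd m - (i - j))"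
    and dist: "i \<in> E \<Longrightarrow> j \<in> E \<Longrightarrow> i \<noteq> j \<Longrightarrow> \<not> N dvd i - j"
begin

text \<open>The test value is \<open>-k\<close>. As 1 and -1 both belong to \<open>E\<close>, every
  alternative other than the two claimed ones negates into a forbidden sum or a coincidence in
  \<open>E\<close>.\<close>

lemma pm1:
  assumes E: "E = {1, -1, k}" and k: "k \<noteq> 1" "k \<noteq> -1"
  shows "N dvd 2 * k \<or> N dvd 3 * k"
proof (rule ccontr)
  assume neg: "\<not> ?thesis"
  have pf': "\<forall>i\<in>E. \<forall>j\<in>E. \<forall>l\<in>E. \<not> N dvd i + j - l \<and> \<not> N dvd - (i + j - l)"
    using pf by (simp only: dvd_minus_iff) blast
  have dist': "\<not> N dvd 2" "\<not> N dvd k - 1" "\<not> N dvd k + 1" "\<not> N dvd 1 - k" "\<not> N dvd - 1 - k"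
    using dist[of 1 "-1"] dist[of k 1] dist[of k "-1"] dist[of 1 k] dist[of "-1" k] k by (simp_all add: E)
  have neg': "\<not> N dvd 2 * k" "\<not> N dvd 3 * k" "\<not> N dvd -(2 * k)" "\<not> N dvd -(3 * k)"
    using neg by auto
  have "N dvd - k - 1 \<longleftrightarrow> N dvd k + 1" "N dvd - (2 * k) - 1 \<longleftrightarrow> N dvd 2 * k + 1"
    by (metis dvd_minus_iff minus_add_distrib uminus_add_conv_diff diff_conv_add_uminus)+
  then show False
    using cov[of "-k"] pf' dist' neg' unfolding E by (simp add: algebra_simps)
qed

text \<open>At \<open>m = 3\<close> each alternative has the form \<open>N dvd p + q * k\<close>,
  and multiplication by 3 removes \<open>k\<close>. The largest result comes from
  \<open>N dvd 6 - k\<close>, which yields 18.\<close>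

lemma pm1_order_3:
  assumes E: "E = {1, -1, k}" and 3: "N dvd 3 * k"
  shows "\<exists>d\<in>{1..18}. N dvd d"
proof (rule ccontr)
  assume neg: "\<not> ?thesis"
  have d: "\<not> N dvd d" if "1 \<le> d" "d \<le> 18" for d
    using neg that by auto
  have pk: "\<not> N dvd p + q * k" if "1 \<le> 3 * p" "3 * p \<le> 18" for p q
    using multiples_combine[OF _ 3] d that by blast
  show False
    using cov[of 3] d[of 1] d[of 2] d[of 3] d[of 4] d[of 5] d[of 7] pk[of 2 "-1"] pk[of 2 1] pk[of 3 "-1"]
      pk[of 4 "-1"] pk[of 4 1] pk[of 3 "-2"] pk[of 6 "-1"]
    unfolding E by (simp add: algebra_simps)
qed

text \<open>The same alternatives at \<open>m = 3\<close>, now multiplied by 2, so that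
  \<open>N dvd 6 - k\<close> yields 12.\<close>

lemma pm1_order_2:
  assumes E: "E = {1, -1, k}" and 2: "N dvd 2 * k"
  shows "\<exists>d\<in>{1..12}. N dvd d"
proof (rule ccontr)
  assume neg: "\<not> ?thesis"
  have d: "\<not> N dvd d" if "1 \<le> d" "d \<le> 12" for d
    using neg that by auto
  have pk: "\<not> N dvd p + q * k" if "1 \<le> 2 * p" "2 * p \<le> 12" for p q
    using multiples_combine[OF _ 2] d that by blast
  show False
    using cov[of 3] d[of 1] d[of 2] d[of 3] d[of 4] d[of 5] d[of 7] pk[of 2 "-1"] pk[of 2 1] pk[of 3 "-1"]
      pk[of 4 "-1"] pk[of 4 1] pk[of 3 "-2"] pk[of 6 "-1"]
    unfolding E by (simp add: algebra_simps)
qed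

text \<open>The bound 12 matters because \<open>G\<close> may be twice as large as \<open>H\<close>.
  At \<open>m = 4\<close> all alternatives stay within it except \<open>N dvd 8 - k\<close>, which
  would only give 16. If that one holds, \<open>k\<close> can be replaced by 8, and the value
  \<open>m = 5\<close> finishes.\<close>

lemma involution_case:
  assumes E: "E = {1, -2, k}" and 2: "N dvd 2 * k"
  shows "\<exists>d\<in>{1..12}. N dvd d"
proof (rule ccontr)
  assume neg: "\<not> ?thesis"
  have d: "\<not> N dvd d" if "1 \<le> d" "d \<le> 12" for d
    using neg that by auto
  have pk: "\<not> N dvd p + q * k" if "1 \<le> 2 * p" "2 * p \<le> 12" for p q
    using multiples_combine[OF _ 2] d that by blast
  have 8: "N dvd 8 - k"
    using cov[of 4] d[of 1] d[of 2] d[of 3] d[of 4] d[of 5] d[of 6] d[of 7] d[of 8] d[of 10] pk[of 2 "-1"] pk[of 2 1] pk[of 3 "-1"]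
      pk[of 4 "-1"] pk[of 4 1] pk[of 3 "-2"] pk[of 6 "-1"] pk[of 3 1] pk[of 6 1] pk[of 5 "-1"] pk[of 4 "-2"]
    unfolding E by (simp add: algebra_simps)
  have pk': "\<not> N dvd p + q * k" if "1 \<le> \<bar>p + 8 * q\<bar>" "\<bar>p + 8 * q\<bar> \<le> 12" for p q
  proof
    assume "N dvd p + q * k"
    then have "N dvd (p + q * k) + q * (8 - k)" using 8 by simp
    then have "N dvd \<bar>p + 8 * q\<bar>" by (simp add: algebra_simps)
    then show False using d that by blast
  qed
  \<comment> \<open>For the alternative \<open>N dvd 7 + k\<close>, replacing \<open>k\<close> by 8
    would give 15; subtracting \<open>2 * k\<close> first turns it into \<open>7 - k\<close>, which
    gives -1.\<close>
  show False
    using cov[of 5] d[of 1] d[of 2] d[of 3] d[of 4] d[of 5] d[of 6] d[of 7] d[of 8] d[of 9] d[of 10] d[of 11] d[of 12]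
      pk'[of 3 "-1"] pk'[of 4 "-1"] pk'[of 5 "-1"] pk'[of 6 "-1"] pk'[of 7 "-1"] pk'[of 10 "-1"] pk'[of 4 1] pk'[of 5 "-2"]
      dvd_diff[OF _ 2, of "k + 7"]
    unfolding E by (simp add: algebra_simps)
qed

end

section \<open>Cyclic groups and exponents\<close>

context group begin

lemma int_pow_eq_iff_dvd:
  assumes "g \<in> carrier G"
  shows "g [^] (i :: int) = g [^] (j :: int) \<longleftrightarrow> int (ord g) dvd i - j"
  using int_pow_eq[OF assms, of j i] by auto

lemma generate_int_pow:
  assumes "g \<in> carrier G" "\<And>x. x \<in> X \<Longrightarrow> \<exists>i :: int. x = g [^] i" "h \<in> generate G X"
  shows "\<exists>i :: int. h = g [^] i"
proof -
  have "X \<subseteq> generate G {g}" using assms(2) generate_pow[OF assms(1)] by auto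
  then have "generate G X \<subseteq> generate G {g}"
    using generate_subgroup_incl generate_is_subgroup assms(1) by simp
  then show ?thesis using assms(3) generate_pow[OF assms(1)] by auto
qed

lemma card_le_of_int_pow:
  assumes "g \<in> carrier G" "\<And>h. h \<in> K \<Longrightarrow> \<exists>i :: int. h = g [^] i" "int (ord g) dvd d" "0 < d"
  shows "finite K \<and> card K \<le> nat d"
proof -
  have "h \<in> (\<lambda>i. g [^] i) ` {0..<d}" if h: "h \<in> K" for h
  proof -
    obtain i where i: "h = g [^] (i :: int)" using assms(2)[OF h] by blast
    have "d dvd i - i mod d" by (simp add: minus_mod_eq_mult_div)
    then have "h = g [^] (i mod d)" using i int_pow_eq_iff_dvd assms(1,3) dvd_trans by blast
    then show ?thesis using assms(4) by simp
  qed
  then have K: "K \<subseteq> (\<lambda>i. g [^] i) ` {0..<d}" by blast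
  have "card ((\<lambda>i. g [^] i) ` {0..<d}) \<le> nat d"
    using card_image_le[of "{0..<d}" "\<lambda>i. g [^] i"] by simp
  then show ?thesis using K by (meson card_mono finite_atLeastLessThan_int finite_imageI finite_subset le_trans)
qed

end

context product_free_cover begin

lemma exponents_of_cyclic:
  fixes E :: "int set"
  assumes g: "g \<in> carrier G" and S: "S = (\<lambda>i. g [^] i) ` E" and inj: "inj_on (\<lambda>i. g [^] (i :: int)) E"
  shows "exponents (int (ord g)) E"
proof
  note eq = int_pow_eq_iff_dvd[OF g]
  fix i j l :: int assume ij: "i \<in> E" "j \<in> E"
  show "\<not> int (ord g) dvd i + j - l" if "l \<in> E"
    using product_free[of "g [^] i" "g [^] j"] ij that eq[of "i + j" l] g by (auto simp: S int_pow_mult)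
  show "\<not> int (ord g) dvd i - j" if "i \<noteq> j"
    using inj ij that eq[of i j] by (auto simp: inj_on_def)
next
  note eq = int_pow_eq_iff_dvd[OF g]
  fix m :: int
  have "g [^] m \<otimes> g [^] m = g [^] (2 * m)" using int_pow_mult[OF g, of m m] by simp
  moreover have "g [^] i \<otimes> inv (g [^] j) = g [^] (i - j)" "inv (g [^] j) \<otimes> g [^] i = g [^] (i - j)" for i j :: int
    using int_pow_mult[OF g, of i "- j"] int_pow_mult[OF g, of "- j" i] g by (simp_all add: int_pow_neg)
  ultimately show "\<exists>i\<in>E. int (ord g) dvd m - i \<or> int (ord g) dvd 2 * m - i \<or>
      (\<exists>j\<in>E. int (ord g) dvd m - (i + j) \<or> int (ord g) dvd m - (i - j))"
    using cover[of "g [^] m"] g unfolding S by (simp add: eq int_pow_mult[symmetric] image_iff) blast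
qed

text \<open>If \<open>inv s\<close> is a quotient of two elements of \<open>S\<close>, then solving
  for one of them exhibits it as a product of two elements of \<open>S\<close>. If the square of
  \<open>inv s\<close> lies in \<open>S\<close>, then it is the third factor after \<open>s\<close>
  and \<open>s\<close>.\<close>

lemma inverse_cases:
  assumes "s \<in> S" "inv s \<notin> S"
  obtains (product) t u where "t \<in> S" "u \<in> S" "s \<otimes> (t \<otimes> u) = \<one>"
proof -
  have s: "s \<in> carrier G" using assms by simp
  consider t u where "t \<in> S" "u \<in> S" "inv s = t \<otimes> u" | t u where "t \<in> S" "u \<in> S" "inv s = t \<otimes> inv u"
    | t u where "t \<in> S" "u \<in> S" "inv s = inv t \<otimes> u" | "inv s \<otimes> inv s \<in> S"
    using cover[of "inv s"] assms by auto
  then show thesis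
  proof cases
    case (1 t u)
    then show ?thesis using product[of t u] s by (metis r_inv)
  next
    case (2 t u)
    then have "t = inv s \<otimes> u" using s inv_solve_right[of "inv s" t u] by simp
    then have "u = s \<otimes> t" using s 2 inv_solve_left[of t s u] by simp
    then show ?thesis using product_free[of s t] assms 2 by simp
  next
    case (3 t u)
    then have "u = t \<otimes> inv s" using s inv_solve_left[of "inv s" t u] by simp
    then have "t = u \<otimes> s" using s 3 inv_solve_right[of u t s] by simp
    then show ?thesis using product_free[of u s] assms 3 by simp
  next
    case 4
    then show ?thesis using product[of s "inv s \<otimes> inv s"] assms s by (simp flip: m_assoc)
  qed
qed

end

section \<open>Abelian triples with an involution or a pair of inverses\<close>

context abelian_triple begin

lemma S_comm: "s \<in> S \<Longrightarrow> t \<in> S \<Longrightarrow> s \<otimes> t = t \<otimes> s"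
  using comm by simp

text \<open>As \<open>c\<close> is b^-2, the element \<open>b\<close> generates \<open>H\<close>,
  and its order divides some number up to 12. Only \<open>a\<close> has its inverse in
  \<open>S\<close>, so all elements outside \<open>H\<close> have square \<open>a\<close> and
  \<open>H\<close> has index at most 2.\<close>

lemma abelian_involution_cyclic:
  assumes a2: "a \<otimes> a = \<one>" and others: "inv b \<notin> S" "inv c \<notin> S" and c: "b \<otimes> b \<otimes> c = \<one>"
  shows "finite (carrier G) \<and> card (carrier G) \<le> 24"
proof -
  have c_eq: "c = b [^] (-2 :: int)"
  proof -
    have "inv c = b \<otimes> b" using c by (simp add: inv_equality)
    then have "c = inv (b \<otimes> b)" using inv_inv[of c] by simp
    then show ?thesis
      using int_pow_mult[OF abc_closed(2), of 1 1] int_pow_neg[OF abc_closed(2), of 2] by simp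
  qed
  have cyc: "\<exists>i :: int. h = b [^] i" if "h \<in> H" for h
  proof (rule generate_int_pow)
    show "h \<in> generate G {b, c}" using that pair_generates[of b c] abc_neq by simp
    show "\<exists>i :: int. x = b [^] i" if "x \<in> {b, c}" for x
      using that c_eq int_pow_1[OF abc_closed(2)] by (metis insertE singletonD)
  qed simp
  obtain k where k: "a = b [^] (k :: int)" using cyc by force
  have S: "S = (\<lambda>i. b [^] i) ` {1, -2, k}" by (auto simp: S_eq c_eq k)
  interpret exponents "int (ord b)" "{1, -2, k}"
    by (rule exponents_of_cyclic[OF abc_closed(2) S]) (use abc_neq c_eq k in \<open>auto simp: inj_on_def\<close>)
  have "b [^] (2 * k) = b [^] (0 :: int)" using a2 k int_pow_mult[OF abc_closed(2), of k k] by simp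
  then have "int (ord b) dvd 2 * k" using int_pow_eq_iff_dvd[OF abc_closed(2), of "2 * k" 0] by simp
  then obtain d where d: "d \<in> {1..12}" "int (ord b) dvd d" using involution_case[OF refl] by blast
  have "nat d \<le> 12" using d by auto
  then have H: "finite H" "card H \<le> 12"
    using card_le_of_int_pow[OF abc_closed(2) cyc d(2), of H] d by auto
  have sq: "x \<otimes> x = a" if x: "x \<in> carrier G" "x \<notin> H" for x
    using square_in_S[OF x] inv_square_in_S[OF x] others by (auto simp: S_eq)
  have "b \<otimes> b \<noteq> \<one>" using others by (metis abc_closed(2) abc_in(2) inv_equality)
  then show ?thesis using card_le_double[OF H _ _ sq, of b] by simp
qed

text \<open>In a factorization of 1 into \<open>b\<close> and two further elements of
  \<open>S\<close>, the self-inverse \<open>a\<close> cannot occur, since it would be the product of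
  the other two factors.\<close>

lemma third_powers:
  assumes a2: "a \<otimes> a = \<one>" and others: "inv b \<notin> S"
  shows "b \<otimes> b \<otimes> b = \<one> \<or> b \<otimes> b \<otimes> c = \<one> \<or> c \<otimes> c \<otimes> b = \<one>"
proof -
  obtain t u where tu: "t \<in> S" "u \<in> S" "b \<otimes> (t \<otimes> u) = \<one>"
    using inverse_cases[of b] others by auto
  have a_inv: "inv a = a" using a2 by (simp add: inv_equality)
  have no_a: "v \<otimes> w \<otimes> a \<noteq> \<one>" if "v \<in> S" "w \<in> S" for v w
  proof
    assume "v \<otimes> w \<otimes> a = \<one>"
    then have "v \<otimes> w = a" using a_inv that by (metis abc_closed(1) in_carrier inv_equality inv_inv m_closed)
    then show False using product_free[of v w] that by simp
  qed
  have "b \<otimes> (a \<otimes> w) = b \<otimes> w \<otimes> a" "b \<otimes> (w \<otimes> a) = b \<otimes> w \<otimes> a" if "w \<in> S" for w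
    using that S_comm[of a w] by (simp_all add: m_assoc)
  then have "t \<noteq> a" "u \<noteq> a" using tu no_a by auto
  then consider "t = b" "u = b" | "t = b" "u = c" | "t = c" "u = b" | "t = c" "u = c"
    using tu by (auto simp: S_eq)
  then show ?thesis
  proof cases
    case 4
    have "b \<otimes> (c \<otimes> c) = c \<otimes> c \<otimes> b" using S_comm[of b c] by (metis abc_closed(2,3) abc_in(2,3) m_assoc)
    then show ?thesis using tu 4 by simp
  next
    case 3
    then show ?thesis using tu S_comm[of b c] by (simp add: m_assoc)
  qed (use tu in \<open>simp_all add: m_assoc\<close>)
qed

end

text \<open>Otherwise \<open>b\<close> and \<open>c\<close> have trivial cubes and \<open>H\<close>
  consists of at most six products of \<open>a\<close> and \<open>b\<close>. None of them can be
  \<open>c\<close>; the last candidate \<open>a b b\<close> has square \<open>b\<close>.\<close>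

lemma (in abelian_triple) abelian_involution:
  assumes a2: "a \<otimes> a = \<one>" and others: "inv b \<notin> S" "inv c \<notin> S"
  shows "b \<otimes> b \<otimes> c = \<one> \<or> c \<otimes> c \<otimes> b = \<one>"
proof (rule ccontr)
  assume neg: "\<not> ?thesis"
  interpret swap: abelian_triple G S a c b
    using comm distinct by unfold_locales (auto simp: S_eq)
  have b3: "b \<otimes> b \<otimes> b = \<one>" and c3: "c \<otimes> c \<otimes> c = \<one>"
    using third_powers[OF a2 others(1)] swap.third_powers[OF a2 others(2)] neg by auto
  define E where "E = {\<one>, a, b, b \<otimes> b, a \<otimes> b, a \<otimes> b \<otimes> b}"
  have ab: "b \<otimes> a = a \<otimes> b" using S_comm[of a b] by simp
  have "generate G {a, b} \<subseteq> E"
  proof (rule generate_subset_of_right_closed)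
    have "a \<otimes> b \<otimes> a = b" "b \<otimes> b \<otimes> a = a \<otimes> b \<otimes> b" "a \<otimes> b \<otimes> b \<otimes> a = b \<otimes> b"
      using ab a2 by (simp_all add: m_assoc) (simp_all flip: m_assoc)
    moreover have "a \<otimes> b \<otimes> b \<otimes> b = a" using b3 by (simp add: m_assoc)
    ultimately show "e \<otimes> g \<in> E" if "e \<in> E" "g \<in> {a, b}" for e g
      using that a2 b3 ab by (auto simp: E_def)
  qed (auto simp: E_def)
  then have "c \<in> E" using pair_generates[of a b] abc_neq by auto
  moreover have "c \<noteq> \<one>" using one_notin_S abc_in(3) by metis
  moreover have "c \<noteq> b \<otimes> b" by (metis abc_in(2,3) product_free)
  moreover have "c \<noteq> a \<otimes> b" by (metis abc_in product_free)
  moreover have "c \<noteq> a \<otimes> b \<otimes> b"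
  proof
    assume c: "c = a \<otimes> b \<otimes> b"
    have "b \<otimes> b \<otimes> a = a \<otimes> b \<otimes> b" using ab by (simp add: m_assoc) (simp flip: m_assoc)
    then have "c \<otimes> c = a \<otimes> a \<otimes> (b \<otimes> b \<otimes> b) \<otimes> b" unfolding c
      by (metis abc_closed(1,2) m_assoc m_closed)
    then have "c \<otimes> c = b" using a2 b3 by simp
    then show False using product_free[of c c] by simp
  qed
  ultimately show False using abc_neq by (auto simp: E_def)
qed


text \<open>Here \<open>a\<close> generates \<open>H\<close> and \<open>c\<close> is a power a^k
  with \<open>2 * k\<close> or \<open>3 * k\<close> divisible by the order of \<open>a\<close>. The
  work lies in the elements outside \<open>H\<close>: a square root of \<open>a\<close> among them
  forces a^3 into \<open>S\<close>.\<close>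

lemma (in abelian_triple) abelian_inverse_pair:
  assumes b: "b = inv a"
  shows "finite (carrier G) \<and> card (carrier G) \<le> 24"
proof -
  have cyc: "\<exists>i :: int. h = a [^] i" if "h \<in> H" for h
  proof (rule generate_int_pow)
    show "h \<in> generate G {a, b}" using that pair_generates[of a b] abc_neq by simp
    show "\<exists>i :: int. x = a [^] i" if "x \<in> {a, b}" for x
      using that b int_pow_1[OF abc_closed(1)] int_pow_neg[OF abc_closed(1), of 1] by (metis insertE singletonD)
  qed simp
  obtain k where k: "c = a [^] (k :: int)" using cyc by force
  have b': "b = a [^] (-1 :: int)" using b int_pow_neg[OF abc_closed(1), of 1] by simp
  have S: "S = (\<lambda>i. a [^] i) ` {1, -1, k}" by (auto simp: S_eq b' k)
  have k1: "k \<noteq> 1" "k \<noteq> -1" using abc_neq b' k by auto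
  interpret exponents "int (ord a)" "{1, -1, k}"
    by (rule exponents_of_cyclic[OF abc_closed(1) S]) (use abc_neq b' k in \<open>auto simp: inj_on_def\<close>)
  note eq = int_pow_eq_iff_dvd[OF abc_closed(1)]
  have not_2: "\<not> int (ord a) dvd 2" using dist[of 1 "-1"] by simp
  have not_k: "\<not> int (ord a) dvd k"
    using eq[of k 0] k abc_in(3) one_notin_S by (metis diff_zero int_pow_0)
  have aa: "a \<otimes> a \<noteq> \<one>" using not_2 eq[of 2 0] int_pow_mult[OF abc_closed(1), of 1 1] by simp
  \<comment> \<open>Passing from \<open>x\<close> to \<open>inv x\<close> turns the square a^-1 into
    \<open>a\<close>.\<close>
  have root: "\<exists>y\<in>carrier G. y \<notin> H \<and> y \<otimes> y = a" if x: "x \<in> carrier G" "x \<notin> H" "x \<otimes> x \<noteq> c" for x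
  proof (cases "x \<otimes> x = a")
    case False
    then have "x \<otimes> x = inv a" using square_in_S[OF x(1,2)] x b by (auto simp: S_eq)
    then have "inv x \<otimes> inv x = a" using x by (metis abc_closed(1) inv_inv inv_mult_group)
    then show ?thesis using x H_cancel(3) by (metis inv_closed)
  qed (use x in blast)
  \<comment> \<open>\<open>y\<close> commutes with its square \<open>a\<close>, so
    \<open>y a\<close> is another element outside \<open>H\<close>, with square a^3.\<close>
  have cube: "y \<otimes> a \<in> carrier G" "y \<otimes> a \<notin> H" "y \<otimes> a \<otimes> (y \<otimes> a) = a [^] (3 :: int)"
    if y: "y \<in> carrier G" "y \<notin> H" "y \<otimes> y = a" for y
  proof -
    have "y \<otimes> a = a \<otimes> y" using y by (metis m_assoc)
    then have "y \<otimes> a \<otimes> (y \<otimes> a) = y \<otimes> y \<otimes> a \<otimes> a" using y by (metis abc_closed(1) m_assoc m_closed)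
    also have "\<dots> = a [^] (3 :: int)"
      using y int_pow_mult[OF abc_closed(1), of 1 1] int_pow_mult[OF abc_closed(1), of 2 1] by simp
    finally show "y \<otimes> a \<otimes> (y \<otimes> a) = a [^] (3 :: int)" .
  qed (use y H_cancel in auto)
  show ?thesis
  proof (cases "int (ord a) dvd 2 * k")
    case False
    then have 3: "int (ord a) dvd 3 * k" using pm1[OF refl k1] by blast
    then obtain d where d: "d \<in> {1..18}" "int (ord a) dvd d" using pm1_order_3[OF refl] by blast
    have "nat d \<le> 18" using d by auto
    then have H: "finite H" "card H \<le> 18"
      using card_le_of_int_pow[OF abc_closed(1) cyc d(2), of H] d by auto
    \<comment> \<open>Otherwise the inverse of \<open>c\<close> is in \<open>S\<close>. It is not
      \<open>c\<close>, as \<open>2 * k\<close> is not divisible by the order, and being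
      \<open>a\<close> or a^-1 would make \<open>c\<close> equal to a^-1 or
      \<open>a\<close>.\<close>
    have sq: "x \<otimes> x \<noteq> c" if "x \<in> carrier G" "x \<notin> H" for x
    proof
      assume "x \<otimes> x = c"
      then have "inv c \<in> S" using inv_square_in_S that by metis
      moreover have "inv c = a [^] (- k)" using k int_pow_neg[OF abc_closed(1), of k] by simp
      ultimately have "a [^] (- k) \<in> (\<lambda>i. a [^] i) ` {1, -1, k}" using S by simp
      then obtain j where "j \<in> {1, -1, k}" "int (ord a) dvd - k - j" using eq by blast
      then consider "int (ord a) dvd - k - 1" | "int (ord a) dvd - k - - 1" | "int (ord a) dvd - k - k"
        by auto
      then show False
      proof cases
        case 1
        moreover have "\<not> int (ord a) dvd - 1 - k" using dist[of "-1" k] k1 by simp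
        ultimately show ?thesis by (metis minus_diff_commute)
      next
        case 2
        then show ?thesis using dist[of 1 k] k1 by simp
      next
        case 3
        then have "int (ord a) dvd - (2 * k)" by simp
        then show ?thesis using False by (simp only: dvd_minus_iff)
      qed
    qed
    have "x \<in> H" if x: "x \<in> carrier G" for x
    proof (rule ccontr)
      assume "x \<notin> H"
      then obtain y where y: "y \<in> carrier G" "y \<notin> H" "y \<otimes> y = a" using root sq x by blast
      have "a [^] (3 :: int) \<in> S" "a [^] (3 :: int) \<noteq> c" using cube[OF y] square_in_S sq by metis+
      then have "a [^] (3 :: int) = a [^] (1 :: int) \<or> a [^] (3 :: int) = a [^] (- 1 :: int)"
        by (auto simp: S_eq b')
      then have 4: "int (ord a) dvd 4" using not_2 eq[of 3 1] eq[of 3 "- 1"] by simp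
      \<comment> \<open>The fourth power of \<open>a\<close> and the third power of \<open>c\<close>
        are both trivial, which forces \<open>c = \<one>\<close>.\<close>
      have "int (ord a) dvd 4 * k - 3 * k" using 3 4 by (meson dvd_diff dvd_mult2)
      then show False using not_k by simp
    qed
    then have "carrier G = H" by auto
    then show ?thesis using H by simp
  next
    case 2: True
    show ?thesis
    proof (cases "\<forall>x\<in>carrier G. x \<notin> H \<longrightarrow> x \<otimes> x = c")
      case True
      obtain d where d: "d \<in> {1..12}" "int (ord a) dvd d" using pm1_order_2[OF refl 2] by blast
      have "nat d \<le> 12" using d by auto
      then have H: "finite H" "card H \<le> 12"
        using card_le_of_int_pow[OF abc_closed(1) cyc d(2), of H] d by auto
      then show ?thesis using card_le_double[OF H, of a c] aa True by auto
    next
      case False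
      then obtain y where y: "y \<in> carrier G" "y \<notin> H" "y \<otimes> y = a" using root by blast
      have "a [^] (3 :: int) \<in> (\<lambda>i. a [^] i) ` {1, -1, k}" using cube[OF y] square_in_S S by metis
      then obtain j where "j \<in> {1, -1, k}" "int (ord a) dvd 3 - j" using eq by blast
      then consider "int (ord a) dvd 4" | "int (ord a) dvd 3 - k"
        using not_2 by auto
      then have 3: "int (ord a) dvd 3 - k"
      proof cases
        case 1
        \<comment> \<open>If the order of \<open>a\<close> divides 4, then \<open>k\<close> is not 0
          because \<open>c \<noteq> \<one>\<close>, not 2 because \<open>c\<close> is not
          \<open>a a\<close>, and not odd because \<open>2 * k\<close> would then be congruent to
          2.\<close>
        have "k mod 4 = 0 \<or> k mod 4 = 2 \<or> (2 * k) mod 4 = 2" by presburger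
        moreover have "int (ord a) dvd j - j mod 4" for j using 1 by (metis dvd_minus_mod dvd_trans)
        ultimately show ?thesis
          using not_k not_2 2 pf[of 1 1 k] by (metis (no_types) diff_zero dvd_diff_commute insertCI one_add_one dvd_add_right_iff diff_add_cancel)
      qed
      have c3: "c = a \<otimes> (a \<otimes> a)"
        using 3 eq[of 3 k] k int_pow_mult[OF abc_closed(1), of 1 1] int_pow_mult[OF abc_closed(1), of 1 2] by simp
      have cc: "c \<otimes> c = \<one>"
        using 2 eq[of "2 * k" 0] k int_pow_mult[OF abc_closed(1), of k k] by simp
      have "int (ord a) dvd 2 * (3 - k) + 2 * k" using 2 3 by (meson dvd_add dvd_mult)
      then have 6: "int (ord a) dvd 6" by (simp add: algebra_simps)
      then have H: "finite H" "card H \<le> 6"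
        using card_le_of_int_pow[OF abc_closed(1) cyc 6, of H] by auto
      \<comment> \<open>\<open>S\<close> now consists of the odd powers of \<open>a\<close>, where
        a^6 = 1: it is the nontrivial coset of the even powers. This provides the closure properties
        required by \<open>card_le_quadruple\<close>.\<close>
      have odd_powers: "a [^] i \<in> S" if "odd i" for i :: int
      proof -
        have "int (ord a) dvd i - i mod 6" using 6 by (metis dvd_minus_mod dvd_trans)
        then have "a [^] i = a [^] (i mod 6)" using eq by blast
        moreover have "i mod 6 = 1 \<or> i mod 6 = 3 \<or> i mod 6 = 5" using that by presburger
        moreover have "a [^] (5 :: int) = b" "a [^] (3 :: int) = c" using b' k 3 6 eq[of 5 "- 1"] eq[of 3 k] by simp_all
        ultimately show ?thesis by (metis abc_closed(1) abc_in int_pow_1)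
      qed
      have S_odd: "\<exists>i :: int. odd i \<and> s = a [^] i" if "s \<in> S" for s
      proof -
        have "c = a [^] (3 :: int)" using k 3 eq[of 3 k] by simp
        then have "\<exists>i\<in>{1, -1, 3}. s = a [^] (i :: int)" using that b' unfolding S_eq by auto
        moreover have "\<forall>i\<in>{1, -1, 3 :: int}. odd i" by simp
        ultimately show ?thesis by blast
      qed
      have S_triple: "s \<otimes> (t \<otimes> u) \<in> S" if stu: "s \<in> S" "t \<in> S" "u \<in> S" for s t u
      proof -
        obtain i j l :: int where "odd i" "odd j" "odd l" "s = a [^] i" "t = a [^] j" "u = a [^] l"
          using S_odd stu by metis
        then show ?thesis using odd_powers[of "i + (j + l)"] int_pow_mult[OF abc_closed(1)] by simp
      qed
      have S_inv: "inv s \<in> S" if s: "s \<in> S" for s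
      proof -
        obtain i :: int where "odd i" "s = a [^] i" using S_odd s by metis
        then show ?thesis using odd_powers[of "- i"] int_pow_neg[OF abc_closed(1)] by simp
      qed
      have "\<exists>t\<in>S. s \<otimes> x = x \<otimes> t" if x: "x \<in> carrier G" "x \<notin> H" and s: "s \<in> S" for x s
      proof -
        have comm_root: "a \<otimes> y = y \<otimes> a" if "y \<in> carrier G" "y \<notin> H" "y \<otimes> y \<noteq> c" for y
        proof -
          have "y \<otimes> y = a \<or> y \<otimes> y = inv a" using square_in_S that b by (auto simp: S_eq)
          then have "a = y \<otimes> y \<or> a = inv y \<otimes> inv y" using that by (metis abc_closed(1) inv_inv inv_mult_group)
          then show ?thesis using that(1) by (auto simp: m_assoc) (simp flip: m_assoc)
        qed
        \<comment> \<open>It suffices to move \<open>a\<close> past \<open>x\<close>, since the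
          other elements of \<open>S\<close> are powers of \<open>a\<close>. If \<open>x x\<close>
          is \<open>a\<close> or a^-1, they commute; if \<open>x x = c\<close>, the square of
          \<open>x a\<close> decides whether \<open>x\<close> inverts or centralizes
          \<open>a\<close>.\<close>
        obtain a' where a': "a' \<in> S" "a \<otimes> x = x \<otimes> a'"
        proof (cases "x \<otimes> x = c")
          case xc: True
          have xa: "x \<otimes> a \<in> carrier G" "x \<otimes> a \<notin> H" using x H_cancel by auto
          show thesis
          proof (cases "x \<otimes> a \<otimes> (x \<otimes> a) = c")
            case True
            then have "x \<otimes> (a \<otimes> (x \<otimes> a)) = x \<otimes> x" using x xc by (simp add: m_assoc)
            then have "a \<otimes> x \<otimes> a = x" using x by (simp add: m_assoc)
            then have "a \<otimes> x = x \<otimes> inv a" using x inv_solve_right[of "a \<otimes> x" x a] by simp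
            then show thesis using that[of "inv a"] S_inv[of a] by simp
          next
            case False
            then have "a \<otimes> (x \<otimes> a) = x \<otimes> a \<otimes> a" using comm_root[OF xa] by simp
            then have "a \<otimes> x = x \<otimes> a" using x by (simp flip: m_assoc)
            then show thesis using that[of a] by simp
          qed
        qed (use that[of a] comm_root x in auto)
        then have "inv a \<otimes> x = x \<otimes> inv a'"
          using x by (metis abc_closed(1) in_carrier inv_closed inv_solve_left inv_solve_right m_assoc m_closed)
        moreover have "c \<otimes> x = x \<otimes> (a' \<otimes> (a' \<otimes> a'))"
          unfolding c3 using x a' by (metis abc_closed(1) in_carrier m_assoc m_closed)
        ultimately show ?thesis using s a' S_inv S_triple b unfolding S_eq by blast
      qed
      then show ?thesis using card_le_quadruple[OF H S_inv S_triple] by auto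
    qed
  qed
qed

section \<open>The nonabelian case\<close>

text \<open>The certificates were found by Knuth--Bendix completion, recording for every derived rule the
  conjugates of earlier relators of which it is a product.\<close>

lemma certificate_cube:
  "check ([] @ forbidden_words) [(CHR ''e'', ''aaa''), (CHR ''d'', ''abc'')] (
   Branch CHR ''f'' ''AB'' [
    Contra [''gef''],
    Contra [''gAdaEaaDF''],
    Contra [''gcafAd''],
    Contra [''gbaFABD''],
    Contra [''gaFABAD''],
    Contra [''gdaEaaDFAAFABafAeAD''],
    Contra [''gcAdaCBAdaEabafAeBAdbaf''],
    Contra [''gaFABAD''],
    Contra [''gbaFABaf''],
    Contra [''gbDaF''],
    Contra [''gaFABAD''],
    Closed [''gDabaFABBADabcaDAeCFABBADabADabcaF'', ''hagcBADabFCFABBADabGbbafAe'', ''iDaHAeAD'',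
     ''jbIgcBADabCBAdaEaaFABBADabADabcaFACF'', ''kdi'',
     ''iadiAdCHcgcbafABCFABeADabaEaacfBAdabCGAhAdi''] ''ab'' ''b'' 7 [('''', [(0, ''a''), (1,
     '''')]), (''a'', [(0, ''aa''), (2, ''a'')]), (''aa'', [(0, ''''), (4, ''aa'')])],
    Closed [''gBeAD'', ''heAGaf'', ''iaBADabcaFACFABDbgcAD'',
     ''gFEaicAdaCGBaFAADabcaBBADabbAicbaFABCCAd'', ''iacADaCIAef''] ''ac'' ''c'' 7 [('''', [(0,
     ''a''), (1, '''')]), (''a'', [(0, ''aa''), (4, ''a'')]), (''aa'', [(0, ''''), (2, ''aa'')])],
    Contra [''gef''],
    Contra [''gBAdabafAeAD''],
    Contra [''gcAdaCBAdaEbafbDaFABAeAD''],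
    Contra [''gBAdabafbDaF''],
    Contra [''gcAdaCBAdaEbaf''],
    Contra [''gdaf''],
    Contra [''gBAdabbaf''],
    Contra [''gdbaf''],
    Contra [''gBAdabaf''],
    Closed [''gbafafAAef'', ''hGCbafABcbafAe'', ''iaBAdafbFABDeADabcAGDaChbAD'',
     ''hIahAdCEadAdcgcafACBAd'', ''jdCfcDi'', ''iadCEdcgAi''] ''ab'' ''b'' 7 [('''', [(0, ''a''),
     (1, '''')]), (''a'', [(0, ''aa''), (4, ''a'')]), (''aa'', [(0, ''''), (2, ''aa'')])],
    Contra [''gaBAdabafAAeAD''],
    Contra [''gcAdaCBAdaEaFAbafDAeAD''],
    Contra [''gaBAdabafdAAeAD''],
    Contra [''gBAdBAdabaf''],
    Closed [''gABAdabaf'', ''hacADaCG'', ''ih'', ''jEad'', ''kDabagagAAegBAdajAeAD'',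
     ''lahcBAdaEbCagBAdabAAeADabagAJBKBBADabGAD'', ''mEaaBADabcJCAhcGCAh'',
     ''hAJAbaGABAdamcHCagcbhBAdagCHacjCBAd'', ''hMABBAdabbkajaCEchBhbkAd''] ''ac'' ''c'' 7 [('''',
     [(0, ''a''), (1, '''')]), (''a'', [(0, ''aa''), (2, ''a'')]), (''aa'', [(0, ''''), (4,
     ''aa'')])]])"
  by code_simp

text \<open>The consistent leaves are coset tables of size 20 and 24.\<close>

lemma certificate_no_cubes:
  "check ([''aaa'', ''bbb'', ''ccc'', ''aaaaa''] @ forbidden_words) [(CHR ''d'', ''abc'')] (
   Branch CHR ''e'' ''AA'' [
    Contra [''fAdaae''],
    Contra [''faE''],
    Contra [''fEae''],
    Contra [''fEae''],
    Branch CHR ''f'' ''AB'' [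
     Contra [''gFaf''],
     Contra [''gaEAAf''],
     Contra [''gcafAd''],
     Contra [''gbaFABD''],
     Contra [''gaFABAD''],
     Contra [''gAdaaaeaDFAAFABafEAAD''],
     Contra [''gdCADabAFaaeFABDaEAAf''],
     Contra [''gaFABAD''],
     Contra [''gbaFABaf''],
     Contra [''gbDaF''],
     Contra [''gaFABAD''],
     Branch CHR ''g'' ''aac'' [
      Contra [''hAdG''],
      Contra [''hdAG''],
      Contra [''hAAgAdaaae''],
      Contra [''hGad''],
      Contra [''hAg''],
      Contra [''hAg''],
      Contra [''hg''],
      Closed [''hBBAdabbafAAg'', ''iafcafACBAdabh'', ''jdCHcDaF'', ''kAAGaacABADabaCAAgAdaaae'',
       ''haHBADabcAgbdBaCAAgaHBADabcacbDBGaaFAACBAdabafAAgCFABADabaakgAdCaKAHcDaF'',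
       ''lKAAGaackCBAd'', ''maK'', ''kaKAAGaackCF''] ''ab'' ''B'' 5 [('''', [(0, ''a''), (4,
       '''')]), (''a'', [(0, ''aa''), (3, ''a'')]), (''aa'', [(0, ''aaa''), (1, ''aa'')]),
       (''aaa'', [(0, ''''), (2, ''aaa'')])],
      Contra [''hAAGaacBBADabbCAAgAdaaae'', ''iAAgaahad'', ''jFABADabiaCbIBAdaf'', ''kBAdahg'',
       ''lKcADaCFADabAAgAdaaae'', ''lJclJcKBAdabCiaChcDabadAIBAdafAAHCklAd''],
      Contra [''hg''],
      Contra [''hgBAd'', ''hAAhafAAhaaae''],
      Contra [''hbGaEAAAGaaBAdaf''],
      Contra [''hg''],
      Contra [''hBAdabAG''],
      Contra [''hAAgaD''],
      Contra [''hFABADabAAgaaae''],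
      Contra [''hAAgAdaaae'', ''hbHBAdccBADabCCh''],
      Contra [''haBADabAAgBAd'', ''iaBHbAhfBAd'', ''iaIAIhf''],
      Contra [''hbAAgaaaeAgBAdaf''],
      Contra [''hdAEAAADaaG''],
      Contra [''hg''],
      Contra [''hdCBBAdabbafAAgaf''],
      Contra [''haEAAAG''],
      Contra [''hcEAAAGaaaCAAgaaeAgD''],
      Contra [''hFADabAAgD''],
      Contra [''hAcAGaaBAdabACBAdabaf'', ''hbEhBAdah''],
      Contra [''hGaaBAd'', ''iBAdaaeAH'', ''jcFCibbaf'', ''kHbbbafABaFABBI'',
       ''lADabKHbDaFABBCbbaFABBcDahaEAAf'', ''hJcLAAdaaaeACBAdabbafBAdabbafABAdBhkBAd'',
       ''iibbafABBh'', ''hHJcIKaaBBAdabbafAEAAAiaCi'', ''haaIKaahAdAEAAADaalFAh''],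
      Contra [''hAgae'']],
     Branch CHR ''g'' ''aac'' [
      Contra [''hAdG''],
      Contra [''hAdAG''],
      Contra [''hAAgAdaaae''],
      Contra [''hGad''],
      Contra [''hAg''],
      Contra [''hAg''],
      Contra [''hg''],
      Contra [''hGaaFABADabFABDAEAAADaGaacABAdabaCD''],
      Closed [''had'', ''iAAGaacBBADabbCAAgAdaaae'', ''jaI'', ''kDaGI'', ''lBAdaig'',
       ''mAAgaaiad'', ''ncLBAdabCmaCicBLBAd'',
       ''obEAAADaGaaBAdBADabcAgaClbkADaBGaaccBAdabCmCBAdabaflAd'', ''pADabnBoaCDcBL'',
       ''qdkAlapaBl'',
       ''oBaFABADablbCaMAAgDackAcnCBAdabDabmaDaBADabAAgBGaacAdaClbCBLbcDBAdBLADabcAgbAdaBaClbkAlapBoMAAg'',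
       ''raBLboAL'', ''sdBLmbopaBl'', ''oAdCaiAcBLBAdaboADabaKCGcBLBAdabADabcPOBMADabcAgaClCn'',
       ''poaBl'', ''oaIAAoaBADabloaBl''] ''ab'' ''aC'' 4 [('''', [(0, ''a''), (2, ''a'')]), (''a'',
       [(0, ''aa''), (0, ''ab'')]), (''aa'', [(0, ''aaa''), (1, '''')]), (''ab'', [(1, ''ab''), (1,
       ''aa'')]), (''aaa'', [(0, ''''), (3, ''aaa'')])],
      Contra [''hg''],
      Contra [''hFABADabG''],
      Contra [''hbAAGaaBAdaf'', ''haHAdCAAGaacBADabHbADahBAd''],
      Contra [''hg''],
      Contra [''hBAdabAG''],
      Contra [''hAAgaD''],
      Contra [''hbEAAADaGaaBAd''],
      Contra [''hAAgAdaaae'', ''hbHBAdccBADabCCh''],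
      Contra [''hFABADabAAgaaae''],
      Contra [''hbgBAdaf'', ''iCGcDah'', ''jgciCBAd'', ''hHbaaBADabAAgBAdJaaDahAAgcBAD'',
       ''jHcJCBAdadbiah'', ''jdCiajAghjIcD''],
      Contra [''hdAEAAADaaG''],
      Contra [''hg''],
      Contra [''hAGaacADaCAAgBdbaf'', ''hHADabcBADabCHAGaaH''],
      Contra [''hFAGaaDAg''],
      Contra [''hcEAAAGaaaCAAgaaeAgD''],
      Contra [''hAdG'', ''iCAdhacBafAADabcg'', ''jaaeAgiAd'',
       ''jadCBJADabcBAdabCAHAdaaaeaDabADaBhEAAjAHcGaEAAji''],
      Contra [''hAdAGaaBAd'', ''hFAHbADah''],
      Contra [''hcafACBAdaFaaeaBADabAAgAdbaf'', ''iBHADabcaFABDbCh'', ''iIBADabcICh''],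
      Contra [''hAgae'']],
     Contra [''gFFeaFed''],
     Contra [''gcAdaaaeFAACBAdaBADabbafaEAAAD''],
     Contra [''gaBAdaf''],
     Contra [''gBAdabafbDaF''],
     Contra [''gAdAdBAdabafcaeACBAdabafD''],
     Contra [''gdaf''],
     Contra [''gBAdabbaf''],
     Contra [''gdbaf''],
     Contra [''gBAdabaf''],
     Branch CHR ''g'' ''BB'' [
      Contra [''hcdCbg''],
      Contra [''hbgdBAGafgd''],
      Contra [''hbG''],
      Contra [''hGbg''],
      Contra [''hbGBBAD''],
      Contra [''haFABADabcaDGACBAdabg'', ''ibafafAEAAfaf'', ''jADabbFaeHaFAFABiBAd'',
       ''kcAAdaaaeACBAdadbafBafAdbafgdAEAAAD'', ''lbFABADabaJfBcbbfBBAdaCk'', ''jJLkae'',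
       ''mbaLbFABADabaBAdCjdciBAdajah'', ''mbFBmJKlADabbFBmaHaFAFABicICD''],
      Contra [''hbbAdafBBAdAdbafafAGFABDADabcaEAAADaaCBAdaae''],
      Contra [''hbGBBAD''],
      Contra [''hBdbafgAdbaf'', ''icAAdaaaeACBAdadbafBafAbhAdCaFAcD'',
       ''hBAdaaeAbhbbhbaEAfBBAdafBcbbfBBAdaCi'', ''jdCafAcDabaFABAHiaD'', ''kbafafAEAAfaf'',
       ''haKAIhabafABAdCdckccafACBAdabgCbFAAdaaaejaE'', ''hAdaaaeAJakAhAdCfcDh''],
      Contra [''hbfBcbbfBBAdAdaaaeACBAdadbafgAd'', ''ihCaFAcD'', ''jadAIbf'', ''kbafafAEAAfaf'',
       ''lbaBAdabF'', ''hbaEAAADaaBhDal'', ''mHbjBAd'', ''nbFABADabaBi'',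
       ''iADabbFBiaFABCAdkaMHbaFABClckcnCBAdabcD'', ''hckCKbafafAABhaCfcDaKAEAAADaai'',
       ''iHLbIMahAjndhaFABh'', ''iJHCdckcciCBAdabiCBAdabi''],
      Contra [''hbGBBAD''],
      Contra [''hDabfBGFABD'', ''iaFABDbHbafBADabbFBAdh'', ''jbafafAEAAfaf'',
       ''kJCbafBADabABcbafIaFAFABjcJ'', ''lIaHbafBADabABAdCdcjccFCCkD'',
       ''lbLaEAfBcbLaIaFAFABjkhBdbafACBAdabg''],
      Contra [''haEAAAD'', ''icHCBAdadbafg'', ''jbaBAdabF'', ''kJbIBAdaaed'', ''ldCFckaD'',
       ''mBADabcaEAAADaaCilalaE'', ''nBBADabbFAmaae'', ''obafafAEAAfaf'',
       ''pHaKJAdCdcoccFCCObafafAANBADabcaFABDbmCBAdaae'', ''qbbfBBAd'', ''iKbafAPfBcqCil'',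
       ''hPHaiaE'',
       ''hBAdaMBADabcNBADabcaFACCOCDiLaBAdabAPQbbaeAIKDabfBABjkabafABAdbafAhBBqphcbaf''],
      Contra [''hAdabgbGBf''],
      Contra [''hGBADabcaF''],
      Contra [''hABAdaaaeAAbafBBAdabbg'', ''ibafafAEAAfaf'',
       ''jabafBADabABAdCdciccFABADabahCbFBCbF'', ''iHAcfCDabICDcDabaBAdabFABAjAdiBAdabafBchCbF'',
       ''ibFBIDaIAj''],
      Contra [''hGBADabcaF''],
      Contra [''haEAADabG'', ''ibbfBBAd'', ''jIbbAD'',
       ''iDabfBGBBdbbFABDADabcaEAAADaaICbFIbbaeAh'', ''kDabaBAdabF'', ''lbafafAEAAfaf'',
       ''mADabLCD'', ''nAGBBADabbFaaeAhg'', ''obbaFABDaIAKBMAcFCan'', ''nADabOBJAMaaeAhFAgan'',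
       ''oObbaFABDaIAKCdclccFnCL'', ''nOcBdbafACBAdabgcn'', ''mJAOamn'',
       ''jHadCHcDabaFABAEAAADabbaFABBajmcbFBCbFaeAh'', ''nNOcjCBAdabj'', ''nJCoAdlnacimn''],
      Contra [''hAdGafg''],
      Contra [''hBdbafg'', ''icAAdaaaeACBAdadbafBafAbh'', ''jbafafAEAAfaf'',
       ''kaEAAGBADabcaFABDbhCbFBaGBADabcaFABDbhbbfBBAdaCi'',
       ''kHIcGBADabcaFACCJbafafAAkaFABDabafBADabABAdCdcjccFCCJCbafBADabABcbafAkaBAdabFABCfcDaBAdafbFABDbhAd''],
      Contra [''hAdaaaeAEAADabcAAdaaaeACBAdadbafg''],
      Contra [''hBAdabbg''],
      Contra [''hbafafAEAAfaf'', ''iBBADabbFABdbafgF'', ''jADabcafGACBAdabiAiaaeaFAFABh'',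
       ''kCdchJfcDaBAdafbgFAFjH'', ''jchCHKCdchccafACBAdabijH'', ''jJkj''],
      Contra [''hBBAdabbgDabGBBAD'', ''hdAHafh''],
      Contra [''hcAAdaaaeACBAdadbafgbafABAdCdcbafafAEAAfafBccafACBAdabgbafABCbF'',
       ''hHcAAdaaaedCafAcDabaFABGFABDaFAbFABDADabcaEAAADaaChCbF''],
      Contra [''hcAAdaaaeACBAdadbafgdbafABAdCdcbafafAEAAfafBccafACBAdabgdbafABCbF'',
       ''hHcAAdaaaedCafAcDabaFABDGFABDaFAbFABDADabcaEAAADaaChCbF''],
      Closed [''hBAd'', ''ibafafAEAAfaf'', ''jADabbFBBGBADabcaFABD'',
       ''jCdcicJADabbFBBCbFjBAdBAD'', ''jbFABADabaJCdciBAdaJCaFAcD'',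
       ''iDabfBcAdaCjEAAADaDabbFADaBBG'', ''kabFBAdi'', ''jcjCBAdabafBADabbFBAdi'', ''lGICfcD'',
       ''maaEAAADalabFBAdi'', ''laLAdbafABlabFBAdi''] ''ac'' ''B'' 5 [('''', [(0, ''a''), (0,
       ''c'')]), (''a'', [(0, ''aa''), (3, '''')]), (''c'', [(1, ''''), (3, ''aa'')]), (''aa'',
       [(4, ''c''), (4, ''a'')])],
      Contra [''hcBdbafACBAdabgbF'', ''iabafBADabABAdCdcbafafAEAAfafBchbaeFABCbaBAdabF'',
       ''hIabafBADabABAdCdCBBAdabADabcaFABDbChbfBcbHBAdafBBAdabbChbAfaf'', ''haHAih'']],
     Contra [''gBAdabaf''],
     Branch CHR ''g'' ''BC'' [
      Contra [''hdbg''],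
      Contra [''hbGBD''],
      Contra [''hbGBD''],
      Contra [''haEAAADabGBD''],
      Contra [''hdCBADabGBADabcaFABBADabbbafABAd''],
      Contra [''hdCGBDbcD''],
      Contra [''haDabaFABAEAAfDabAd'', ''iAAdaaaeaFAbafDAGBFABBADabchCbbafAdCADacFAbafAGBDabDaF'',
       ''jDabGBCDcAhbiBAdai'', ''kIADabJDaFABBcbaFABBBAdabbafACBAdabbafbgBAd'',
       ''kbAdKBAdabafDabbaFABBcaeACBAdadKJADabchCIAHajkF''],
      Contra [''hcbaFABBBAdabbafACBAdabg'', ''ibbaFABBcaeACBAd'', ''jDEAAADabhBiafCbaFABcDaBAd'',
       ''jAdaaaeAdCafAcjBDbIAdFABADabhbADaBAdFaaeabafABAdj''],
      Contra [''hbGBD''],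
      Contra [''hBAdabAEAAfDabGBaaaeaCDcDabaFABAEAAfDabAdaBAdCAAdaaaeaFAbafDFABAEAAfDabGBDabaFABcD''],
      Contra [''haEAAfD'', ''icbaFABBBAdabbafACBAdabgbbaf'', ''jDabaFABAAhIcAdaCbbafABBH'',
       ''jaaeAhIcHCBAdaJADabcaDabaFABAAhbAdaBCibbaFABBcaeACBAdabAJDabadFABafAEAAAD'',
       ''iJfDaIbbafAdBBAdFjAD'', ''iIJi''],
      Contra [''hbGBD''],
      Contra [''hbcADabGBCCaFAcDaFABBBAdabbafCADacFAbafABAdaaaeaFAbafDABAdcbgBAdaaEACbbafABBAdFABfbafDabbDaFABBcbbaFABBcADabG''],
      Contra [''hGBADabcaF''],
      Contra [''hAdabgFbg''],
      Contra [''haDabaFABAEAAfDabAd'',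
       ''haBAdabAEAAfaaaeaFAbafDABAdAhDabcHCBAdabgbaFABBcHCBAdabg''],
      Contra [''hcAGaf''],
      Contra [''haDabaFABAEAAfDabAd'', ''hCADacFAbafABAdaaaeaFAbafDABAdAhDabcHCBAdabgBAd'',
       ''hHCaaeAHFABBADabbbafHFABBAD''],
      Contra [''hDabcafACBAdabgBAd'', ''hAdaaaeHAdChhcFAhh''],
      Contra [''hdbg''],
      Contra [''haDabaFABAEAAfDabAd'',
       ''iAAdaaaeaFAbafDABAdCaEAcDabGBFABBADabcaFABBADabbbafABCbbafAdAhbGBDabDaF'',
       ''iCIcDaHaCdcAEAAADaaicAdbgBaicbG''],
      Contra [''hcbaFABBBAdabbafACBAdabgBAD''],
      Contra [''hdcbg''],
      Contra [''haFABBAD'', ''icbaFABHCBAdabg'', ''jbDaFABBibg'', ''ibaFABHaIbbafAdBBAdIcbdBj'',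
       ''iiJbIbaF''],
      Contra [''hdbg''],
      Contra [''hBdbg'', ''iBhbhacAHaCAHaf'', ''iadAIBibh''],
      Contra [''hdbgAd''],
      Contra [''hadbgBAd'']],
     Contra [''gBAdabafd''],
     Contra [''gBAdBAdabaf''],
     Branch CHR ''g'' ''CC'' [
      Contra [''hdcg''],
      Contra [''hABAdabafcbcgCBAdaCBAd''],
      Contra [''hdgAdBAdabafcGCg''],
      Contra [''hcG''],
      Contra [''hABAdabaf'', ''iCHAD'', ''jCCHccg'', ''kIbCChccj'', ''lHABAd'', ''mADabl'',
       ''nbaHABAd'', ''oaEAAAD'', ''pOaaChcAd'', ''qKCMhcbIbCBCHcbcDBnBMAbPOaEABapaCChccjAop'',
       ''rBdChcbDaqAoADabH'', ''sahcAdaaeACBAd'', ''tHAHaae'', ''ucbNBCtaaBAd'',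
       ''qcbaaeAABClNbaBAdabABqaCBCHcbcDAo'',
       ''uJDabCHcBCHaeAcBCHcDbASccmCuCBAdabrbLcnCBAdaaeAUq'',
       ''uCHcDaRAScchaUaahcAdaCAEAAhqOCBAdaaIAdChcbCPhcbkBCtau''],
      Contra [''hGCD''],
      Contra [''hAAGDabgaFABfBAdabafcbbGBAdgaBCFbafAGCCABAdabafcAdBAdabafcAdgaBAdg'',
       ''iCHABAdabafcHADabFABADabah'', ''iICHABAdabafcbiBICAdBAdabafcAdg''],
      Contra [''hCABAdabaf'', ''iCAdachbCBHbcD'', ''iIDabIBHCADabFBAdachbgBAd''],
      Contra [''hcGCD''],
      Contra [''hABAdabaf'', ''iCHcDabADaGBAdg'',
       ''iBAdhahcbiBCHAHABAdabahahcbiBICHAIDabHABADabahBAdIDabH''],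
      Contra [''hABAdabaf'', ''ibaHABAd'', ''jIbaahAEAAhahBAd'', ''kdCajAAdahcbgBAd'', ''lIbaBAd'',
       ''mJIbaahGDaCHcAEAAADabaeABDabHABAdabalbkBaJABAk'',
       ''lbKBLIKaBADabcaEAADaCHAcchCahcAdaCACBAdaBAdabbajAbbaeABiABChcbDaKEAAlDabHABAdabajmaJABalbkBaJ'',
       ''lLMAl''],
      Contra [''hcGCD''],
      Contra [''hdCAdBAdabafcbgBAdBAdabaf''],
      Contra [''hABAdabaf'', ''iaEAAAD'', ''jIaaChcAd'', ''kADabHABAd'',
       ''kADabHAHaaeaHAAGAJAbIBakajaCDaEAhcbChcBAdCCHccBCHADaKhcbCAdahcbCBCHcbcDaHABAdaBKAbJBajag'',
       ''kKAbbhBAdaBajagAik''],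
      Contra [''hAdacg''],
      Contra [''hAdaCABAdabafcAdgAdaae''],
      Contra [''hdg''],
      Contra [''hABAdabaf'', ''iaChcAdg'', ''iAicICBAdaChcbAiahahcbbaHABAdBADabciCahcAdaCBAd''],
      Contra [''hABAdabaf'', ''ibaHABAd'', ''jCHAD'', ''kaJAdgah'', ''lGCCAdahcbDBcJbCBCHcbcDk'',
       ''macADaCH'', ''nILMachClAdCdcgah'', ''oHAHaae'', ''pIbaahAAOBAd'', ''qaEAAAD'',
       ''kaNIbNABADabahBAdaQaaDaLAAOcbAdaBCHADablBAdAk'', ''rPIbaahAAk'',
       ''qADabHADabGCCAdaccBjBCHQaaChcAdAcBCHcDajAADabcqrCHABAdaban'',
       ''pNILcMCBAdaBAdabbapAbbaeABRqaHABAd'', ''pPQPmlRqaHAok''],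
      Contra [''hAdCdcgaGCDcD''],
      Contra [''hABAdabaf'', ''iGDabghBAd'', ''iAdahcbghBAdaiCHAHABAdabaaibi''],
      Contra [''hCABAdabaf'', ''iHCAD'', ''jIbg'',
       ''jbbGChcjdCBhbcBijaaFABADabFABABGChchbCdcDaij''],
      Contra [''hABAdabaf'', ''iCAdahcbg'', ''jICAdahcbCChcci'',
       ''jaIDaJcADaCHAcHADaCHAcahcAdaCACBAdaj'', ''jcbJaahAjABCHABAdabDabahAj''],
      Contra [''hABAdabaf'', ''iADabahahAEAAhahBAd'', ''jCAdahcbgBCH'', ''kdCaiAcjj'',
       ''lbIABADabahBAdbaBADabHABAdaaaekBCHcbAk'', ''mbaEAhBAdbChcbGBCHADacDaaIABBADabbAk'',
       ''icahcAdaCACBAdaBAdabbaiAbbaeABm'', ''nLIccHCCahcAdaaeACBAdabAkBCH'', ''jNDaCHADacj'',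
       ''obaHABAdj'', ''lNLbMoBCHcbjBon'', ''paaLAkAJlKal'',
       ''pLBADabcaLAkObPPaaEAAADaBCHAHaaeApacHADaCHAibMoBCHcbjBonl''],
      Contra [''hdcg''],
      Contra [''hABAdabaf'', ''iCDcBCHcADabcaCAdahcAdgCBAd'', ''jahcAdahCAGiBHAD'',
       ''iJcahcAdaCACBAdabICChcAdahcbi'', ''iIji''],
      Contra [''hABAdabaf'', ''iADaGDabgAdahBAd'', ''iAdahcbgAdahBAdaiCHAHABAdabaaibi''],
      Closed [''hABAdabaf'', ''iaCAdahcAdg'', ''jBADabcaHACI'', ''kbaHABAdj'', ''laHAcjCBAd'',
       ''mDaCHADacAiAl'', ''nadChcAdmAj'', ''iAiahcAd'', ''oICAdahcbCChcciBAdAD'',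
       ''oBADabcaEADaboBAdChcbiBAdaCo'', ''iaJBADabcaHACAlBD'',
       ''mbbhBAdaOBADabciCahBAdabHABAdLacahACBAdabjaChcAdmAj'',
       ''iaadAAioAj''] ''ab'' ''C'' 5 [('''', [(0, ''a''), (0, ''b'')]), (''a'', [(0, ''aa''), (1,
       '''')]), (''b'', [(3, ''''), (2, ''aa'')]), (''aa'', [(2, ''b''), (2, ''a'')])]]],
    Contra [''faaEAABAD''],
    Contra [''faEAAD''],
    Contra [''fEae''],
    Contra [''fcDaE''],
    Contra [''faEAAD''],
    Contra [''fEae''],
    Branch CHR ''f'' ''aaa'' [
     Contra [''gf''],
     Contra [''gEFaFAfbFafAfe''],
     Contra [''gFaf''],
     Contra [''gFaf''],
     Contra [''gf''],
     Contra [''gAf''],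
     Contra [''gAf''],
     Contra [''gf''],
     Contra [''gAfAdaDaFaaaBADabEAABaEAADabcBADabCE''],
     Contra [''gAdaDabEADaFaaBADabAAfAdAEADaF''],
     Contra [''gf''],
     Contra [''gfEAABADabFaaaBdbAAAf''],
     Contra [''gcADaCEAABADabFaaaCd'', ''gfcgCBAdabAAAfccBADabCFafACEAABADabFaaaCfcg''],
     Contra [''gEAAAF''],
     Contra [''gAdAF''],
     Contra [''gFaf''],
     Contra [''gAAfAdF'', ''hBADabcaaEAACG'',
      ''haEAADabGHaaeAAAfbdBFaaaEAACGaEAcBFADabcfbDBFCBAdabhacHCGacBAdabCAAAf''],
     Contra [''gFaf''],
     Contra [''gaaDAAf'', ''hAgBAd'', ''iAhae'', ''jBADabICg'', ''jAgDabJBIADabchAjGaCBAdabj'',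
      ''jjAdGaj''],
     Contra [''gaFaf''],
     Contra [''gaFaadAAAfAD''],
     Contra [''gEAAF''],
     Contra [''gEAAF''],
     Contra [''gAdF''],
     Contra [''gADabcAAdFaaCBAdabAAAfDaaaeBAd'', ''gaaGGAg''],
     Contra [''gf''],
     Contra [''gaaBADabE'', ''hGaaaaeAAAAfbeBAd'', ''iADabEAAD'', ''jaaaEAABADabEAAhibH'',
      ''kbaaEAABCJaaEAAcD'', ''lAKbaaEAABDabH'', ''maDabaaEAABAbhBIAbbaaeAABkaDaEAABl'',
      ''nMKbaaE'', ''nBJaaaEAAAADabcghAAdaJaKbaaEAABALbaaeAdbaaeAABAdNmnBaibHBn'',
      ''nNBJadAKbaGaEAABCaBADabcaEACEAABADabacbaaeAABkADabcgnCBAdabn''],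
     Contra [''gaaeBAdabaaeAAAAfce'', ''haaEAABDabaaEAABAbgcEAeDabGBCBAdabaae'',
      ''iHaaaEAABADabEAAgcECFhh'', ''jaEAABAD'', ''kJIadAdCaaeAAiaBADabcaEACAjcbaaeAAIaaEAABBAD'',
      ''lKecbjBCEAeDabG'', ''lIHHfceKJCBAdalbgccAdaClCBAd'']],
    Contra [''faEAAD''],
    Contra [''faaeaE''],
    Contra [''faaeaE''],
    Contra [''fEae''],
    Contra [''faaeAd''],
    Contra [''fdae''],
    Branch CHR ''f'' ''AB'' [
     Contra [''gFaf''],
     Contra [''gAFae''],
     Contra [''gcafAd''],
     Contra [''gbaFABD''],
     Contra [''gaFABAD''],
     Contra [''gBAdaaaeAAADabcaFABCEcbCEAADabAEaecBADabCBAdaaecbafABaaeBAdabAACBAdabCEADabEBAdaecBaDFAbaf''],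
     Contra [''gBDbCEaeAcDabaEAAAdaaeBAdaf'', ''gGBADabcaBaaeAAADabcGCEAADaaaeBAdabAAGCEAAD''],
     Contra [''gaFABAD''],
     Contra [''gaaeBAdabEAAbDaFABaf''],
     Contra [''gBDbCEaeAcDabaEAAAdaaeBAdafAd'', ''gAdGcGCEAADaaaecg''],
     Contra [''gaFABAD''],
     Contra [''gBBAdabbafceCEAAAdaaecafACBAdaBAdabbaf'',
      ''hBADabcaFACEAADaaaecEAADaaaeACBAdabgaE'', ''haEAADaHgaFAh''],
     Contra [''gaaEAAbDaEAAAdaaeBAdaf''],
     Contra [''gEf''],
     Closed [''gaaaEAAAd'', ''haEAAAdaae'', ''iecBhADabcaE'', ''jDabIeBAdBhbafaBADabE'',
      ''kBADabcaEACjbdBaae'', ''lGKBBAd'', ''hClcDaBlADabcaLGAglCHacECEAAbADaaaeAABJ'', ''mgl'',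
      ''nmBkaaE'', ''laCEcDAAglBAD'', ''ibiccADaCCBAdaLaBdbkAmBkaaE'',
      ''ladCecAlAjaaeBAdabkAmBkaaE''] ''ab'' ''C'' 8 [('''', [(0, ''a''), (5, ''a'')]), (''a'',
      [(0, ''aa''), (1, '''')]), (''aa'', [(2, ''''), (3, ''aa'')])],
     Contra [''gdaaecDaFADabEBAdCAEaecBADabCE''],
     Contra [''gcbaFABADabcaEACBAdADaaaeACBAdabafAdAD''],
     Contra [''gaBADabFADabEBAdCecBaaE'', ''gdGaBADabEAAAdaaecBADabcaGACBAdabCEf''],
     Contra [''gdaf''],
     Contra [''gBAdabbaf''],
     Contra [''gEAADaaae'', ''hGcBDbCEaeAcDabGBAdaf'', ''hBAdaaeAhADabcaEACHGcBCecbCHaEAADabHaE''],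
     Contra [''gBAdabaf''],
     Contra [''gEAADaaae'', ''hbGBAdaf'', ''iBDbCEaeAcDah'', ''jBADabcICg'', ''kHbaBAdabABhiajaE'',
      ''iJBADabcIHaaeBAdabAACBAdabk'', ''ibIJBBADabADabcJBCEcbCgieBAdkaaeAi''],
     Contra [''gBAdabaf''],
     Contra [''gcaaeAdFABafAbCEAD''],
     Contra [''gBAdabafd''],
     Contra [''gBAdBAdabaf''],
     Contra [''gaEAADabFABAD'']],
    Contra [''fAdabaae''],
    Contra [''fdaae''],
    Contra [''fBAdabEaeBAD''],
    Contra [''fAdaae''],
    Contra [''fBAdabaaaeDaE''],
    Branch CHR ''f'' ''BB'' [
     Contra [''gcdCbf''],
     Contra [''gbFBf''],
     Contra [''gbF''],
     Contra [''gFbf''],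
     Contra [''gbFBBAD''],
     Contra [''gbFBf''],
     Contra [''gaadE'', ''haaaeAAAgf'', ''hcHCBAdabGHCBAdabGagAhhaaEAAcD''],
     Contra [''gbFBBAD''],
     Branch CHR ''g'' ''BC'' [
      Contra [''hdbg''],
      Contra [''hbGBD''],
      Contra [''hbGBD''],
      Contra [''hAddbgBAdaaebgBAdADabGBD''],
      Contra [''hBAdabcABAdabaaeACBAdabgaCaEAADacEADabcABAdabaaeACBAdabgaDaEAABcAdBAdabaaeACBAdabgaEAAf''],
      Contra [''hdCGBDbcD''],
      Contra [''hBaaaeAAAADabcaaadEAAACBAdabf'', ''hBAdBAdabaaeGBDaHBaBADabAbAbhAdbg''],
      Contra [''hbcBGBADabcaEAABADabaCbaaeAACBAd''],
      Contra [''hbGBD''],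
      Contra [''hbaaeAdAGBCDaaEAAcD''],
      Contra [''hcABAdabaaeACBAdabg''],
      Contra [''hbGBD''],
      Contra [''hbaaEAABcADabGBCD''],
      Contra [''hGBADabcaE''],
      Contra [''hdEbgbg''],
      Contra [''hbaaEAABcaeACBAd'', ''ibbaaEAABBAd'', ''jBhbbfbDBBiAAAdaaIbbaEABGBD'',
       ''kDaGHAdCj'', ''jKKCIcEIbbdBFBBHbj'', ''jJKj''],
      Contra [''hcaGGfbGfBAd''],
      Contra [''hBaaaeAAAADabcaaadEAAACBAdabf'',
       ''ibDabaeDaEAABcAdCHcDaaaaeAAACBAdabaaeAEAABBAdabgBAd'', ''iBAdabIHBaBADabAbI''],
      Contra [''hBADabGBADabcaE'', ''hbhcHCBAdaaeAbhBAdabh''],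
      Contra [''hFBdbgeD''],
      Closed [''hBaaaeAAAADabcaaadEAAACBAdabf'', ''ibgADaHBaaaebgBAdEAABAD'', ''jbaaeAdEAABAD'',
       ''kJcbG'', ''lk'', ''haaaEAAAAdChcDabAdaBk'', ''madEAAeDabAdaBk'', ''nCdcbgaeDaE'',
       ''nadnbaaeAABAdnjk''] ''ab'' ''C'' 6 [('''', [(0, ''a''), (2, ''a'')]), (''a'', [(0,
       ''aa''), (1, '''')]), (''aa'', [(3, ''''), (0, ''aab'')]), (''aab'', [(1, ''aab''), (3,
       ''aa'')])],
      Contra [''hbaaEAABcABAdabaaeACBAdabg'', ''hcBhbaaeDaEAAACBAdaH''],
      Contra [''hdcbg''],
      Contra [''hbaaEAABcABAdabaaeACBAdabg'', ''iHbaBAdabaEAABcaeACBAd'', ''haHAdi'',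
       ''jaaEAABBAdabHaEAAHaEAABADabaaeCAdacbg'',
       ''jFBHaEAADabcaaeDAAjiBJADabcaadEAACBAdaaeAhbfCbaaeAdAh''],
      Contra [''hdbg''],
      Contra [''hacECAGBDAD''],
      Contra [''hdbgAd''],
      Contra [''hadbgBAd'']],
     Contra [''gcFaaeDaEAAACBAdabaaeDadAdEAAfAD''],
     Contra [''gbFBBAD''],
     Contra [''gBAdabDabFBf''],
     Contra [''gFaaeDaE''],
     Contra [''gdEbfbf''],
     Contra [''gaadE'', ''hbFBaaeAAADabcgCBAdaaeD'',
      ''hbaaeAAHbaDaEAABBAdAdaDabbaaeAABhBhgBBADabcaEACbaae''],
     Contra [''gFaaeDadEAAf''],
     Contra [''gaadEAABBaaEAAbf''],
     Contra [''gFaaeDadEAAf''],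
     Contra [''gdbf''],
     Contra [''gbaaeAdEAFBfAD''],
     Contra [''gAdEFBBADabcaEACbaaeABAD''],
     Contra [''gdEbbfbf''],
     Contra [''gdCBaaeAdEAAfD''],
     Contra [''gAdBAdabbfBAdFBBADabbaaeDabFBBAD''],
     Contra [''gbdFBfD''],
     Contra [''gbFBf''],
     Contra [''gbaaeAdEAADaBFBBaaeAAbbaaeDaaEAAAdEAAfDabcbAd''],
     Contra [''gFbf'']],
    Contra [''faE''],
    Contra [''fEae''],
    Contra [''fEae'']])"
  by code_simp

text \<open>All leaves are contradictions, so this configuration does not occur at all.\<close>

lemma certificate_fifth_powers:
  "check ([] @ forbidden_words) [(CHR ''g'', ''ccccc''), (CHR ''f'', ''bbbbb''), (CHR ''e'', ''aaaaa''), (CHR ''d'', ''abc'')] (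
   Branch CHR ''h'' ''AB'' [
    Contra [''iHah''],
    Contra [''ichd''],
    Contra [''icahAd''],
    Contra [''ibaHABD''],
    Contra [''iaHABAD''],
    Contra [''iahafahAAeAhd''],
    Contra [''iAHaEaad'', ''jbADaBCiaHAcD'', ''kaJAdbah'', ''lDabaHABAJbAhaBAd'',
     ''mchCBAdHADaaLCHcbah'', ''nBdbahMAHABAD'', ''oHABADabaNBaHABDbnAD'',
     ''pbahAIBAdaLDabaHABCLcGcOHCAHABADabaNBMchCBAdabbFbbAdaBjaDHABCKclAbaHABDajdCahAI'',
     ''pJAdbahABAdahacbDaHABCLcGccBAdabCCOacahACBAdabnADabgpBfAMchoCgpCikbaH'',
     ''pdCahdAJbhBKapAp''],
    Contra [''iaHABAD''],
    Contra [''ifah''],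
    Contra [''ibDaH''],
    Contra [''iaHABAD''],
    Contra [''iaBADabcaHACHAF'', ''jaaDAAeAAIaahcAd'', ''kaaHABBADabbAi'', ''lahcICBAdabahAAk'',
     ''mEaakLAiAdG'', ''nKaaBAdabAiAdGcMCJ'', ''nEaNKaaHAANLBDibDaKAAem'',
     ''nAIaBBAdabbahJaaDAAencHCJaaDAAenHABADabci'', ''nNADabNAI'', ''nhnnBAd''],
    Contra [''icahACBAdagbah'', ''jAAdaaEaaIHABADabcICHAF'', ''jbeAjajbbADaBBfBBADabcaHACiabah''],
    Contra [''iAdaah''],
    Contra [''iBfBBBADabbahAeADabbah''],
    Contra [''iaBAdah''],
    Contra [''iBAdabahbDaH''],
    Contra [''iABAdabahcECBAdabahBAd'', ''jaaHAAIABAdabah'', ''kcAdaCJ'', ''laaDAAeAADabkBDabkae'',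
     ''jLKcbGBAdaiaBADabHABjHADabcBBAdabAIaEaaaHAAAbahBAdabACBAdabFCkad'',
     ''jAdAdaaEalAdAJLaJbEaKcAdaCHABD''],
    Contra [''idah''],
    Contra [''ifahh''],
    Contra [''idbah''],
    Contra [''iBAdabah''],
    Contra [''iaBAdahbFAdbahAd'', ''jaaDAAeAAIacahACBAdabFbbAdaBBI'',
     ''jBAdabCbHBIacBADabgDabDaHABDabIaBAdabHABAAjcECBAdajbHABADabahCAiAdacbahBADabAiBI''],
    Contra [''iBAdabah''],
    Contra [''ifahDaahDafahDAAe''],
    Contra [''iBAdabahd''],
    Contra [''iBAdBAdabah''],
    Contra [''iABAdabah'', ''jaIAcBADabcaIACCgCDcBCI'', ''kAjDabai'', ''lCIAD'', ''mLbGBAdaicAd'',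
     ''jaBBADabADabcaIACAjBDADabceCMLbCCiccmBAdAD'', ''mMDafAj'',
     ''mKcIADabkBCIAIABAdabaiaicfBADabcjCmCmADabIADabaiABKgBlD'']])"
  by code_simp

lemma certificate_involutions:
  "check ([] @ forbidden_words) [(CHR ''h'', ''babC''), (CHR ''g'', ''abaC''), (CHR ''f'', ''cc''), (CHR ''e'', ''bb''), (CHR ''d'', ''aa'')] (
   Closed [''iahGabdBAAde'', ''jbDBDagcECDaaGAdhAAdcDCGabdEBeDAd''] ''ab'' ''ab'' 3 [('''', [(0,
    ''a''), (2, ''a'')]), (''a'', [(0, ''''), (1, '''')])])"
  by code_simp

text \<open>The surviving coset tables have size 12 and 24.\<close>

lemma certificate_two_involutions:
  "check ([] @ forbidden_words) [(CHR ''f'', ''ccc''), (CHR ''e'', ''bb''), (CHR ''d'', ''aa'')] (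
   Branch CHR ''g'' ''aCa'' [
    Contra [''hagDAd''],
    Contra [''hfDag''],
    Contra [''hafCDcAgbaCDcAgBe''],
    Branch CHR ''h'' ''bcb'' [
     Contra [''iEbh''],
     Contra [''iEbbFcECBhabcECBhAdBe'', ''ifii''],
     Contra [''iEbh''],
     Contra [''iHbce''],
     Contra [''iEbhd''],
     Contra [''ih''],
     Contra [''iHbce'', ''iIaDaiAcDagAibfBCDaiAAd''],
     Contra [''iEbhBe''],
     Contra [''ih''],
     Contra [''iEbhBe''],
     Contra [''iaCDcAgHbce'', ''iIaDaiACGaCdcAibfBcDaiAAd''],
     Contra [''ih''],
     Branch CHR ''i'' ''abC'' [
      Contra [''ji''],
      Contra [''jEbDaiAd'', ''jfjbjBe''],
      Contra [''jaDaaIAdIAdbFBIAd''],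
      Contra [''jDaifAg''],
      Contra [''jid''],
      Contra [''jbDaIIAdBeF''],
      Contra [''jDaIAdbFDaIAdBe''],
      Closed [''jaeDAd'', ''kDaEbIaIAdBe'', ''lbaEAiBeacDCkAdF'',
       ''kaIAdbCEcDaKAEbIabiBeAdBBe''] ''ab'' ''c'' 3 [('''', [(0, ''a''), (0, ''b'')]), (''a'',
       [(0, ''''), (0, ''ab'')]), (''b'', [(2, ''ab''), (0, '''')]), (''ab'', [(1, ''b''), (0,
       ''a'')])],
      Contra [''jie''],
      Contra [''jibHIabFBIAde''],
      Contra [''jiGaCd''],
      Contra [''jaGAdFHbfBDaiGAdCice''],
      Contra [''jDaif''],
      Contra [''jbDaaeAIaeAIAdBeF''],
      Contra [''ji''],
      Closed [''jaeDAd'', ''kibD'', ''lbkBe'', ''mDaEbKaKAdBe'', ''nbaEABlacDCmAdF'',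
       ''maKAdbCEcDaMALbalAdBBe''] ''ab'' ''c'' 3 [('''', [(0, ''a''), (0, ''b'')]), (''a'', [(0,
       ''''), (0, ''ab'')]), (''b'', [(2, ''ab''), (0, '''')]), (''ab'', [(1, ''b''), (0, ''a'')])],
      Contra [''ji''],
      Contra [''jicDCGaCd''],
      Contra [''jaGAdFHbfBDaicECGAdCi''],
      Contra [''jbDadIdIAdBeF''],
      Contra [''jDadIAdbFDadIAdBe''],
      Closed [''jaeDAd'', ''kDaEbeIaeIAdBe'', ''lbaEAiEBeacDCkAdF'',
       ''kaeIAdbCEcDaKAEbeIabiEBeAdBBe''] ''ab'' ''c'' 3 [('''', [(0, ''a''), (0, ''b'')]), (''a'',
       [(0, ''''), (0, ''ab'')]), (''b'', [(2, ''ab''), (0, '''')]), (''ab'', [(1, ''b''), (0,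
       ''a'')])],
      Contra [''jiEbHeIabFBeIAde''],
      Contra [''jGaIAdbFGaIAdBe''],
      Contra [''jFHbfBDaiCDcAgciCe'', ''jfjj''],
      Contra [''jGaCdcEbDaabFHBeceCAIabDagABAAdBeAd''],
      Contra [''jDaaCDcAgHbceCBIabDagAdBAAd'', ''jfjbjBe''],
      Contra [''jDaabaGAdBAifCEcFHbce'']],
     Contra [''ibcECBh''],
     Contra [''iHbce'', ''iIaDaiACGaCdcAibfBcDaiAAd''],
     Contra [''iEbhbDBBe''],
     Contra [''icECEbhBeFcEbhBe''],
     Contra [''iaCDcAgcdCHbce'', ''iIaDaiACGaCdcAibfBcDaiAAd''],
     Contra [''idHbce''],
     Contra [''ihD''],
     Contra [''idHbce'', ''iIaDaiAcDagAibfBCDaiAAd''],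
     Contra [''iEbhEBe''],
     Contra [''iEbhEBe''],
     Contra [''iaGAdHbce'', ''iIaDaiAcDagAibfBCDaiAAd''],
     Contra [''ifEbbFBh''],
     Contra [''ibCEcFcECBh'', ''iaDaIAIbFBAI''],
     Contra [''ifEbbFcECBh''],
     Branch CHR ''i'' ''abC'' [
      Contra [''ji''],
      Contra [''jHbceCfBDaiAd''],
      Contra [''jHbceCfBDaie''],
      Contra [''jDaifAg''],
      Contra [''jid''],
      Contra [''jDaIAdbFcECBh''],
      Contra [''jDaIAdbFcECBh''],
      Closed [''jaeDAd'', ''kHbceCfBDaibaIAdBe'', ''lbaEAiBeacDCkAdF'',
       ''kaIAdbCEcDaKAEbIabiBeAdBBe''] ''ab'' ''c'' 3 [('''', [(0, ''a''), (0, ''b'')]), (''a'',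
       [(0, ''''), (0, ''ab'')]), (''b'', [(2, ''ab''), (0, '''')]), (''ab'', [(1, ''b''), (0,
       ''a'')])],
      Contra [''jie''],
      Contra [''jHbceCBIae''],
      Contra [''jiGaCd''],
      Contra [''jacECIAdbFcECBh''],
      Contra [''jDaif''],
      Contra [''jaHbceCfBAi''],
      Contra [''ji''],
      Closed [''jaeDAd'', ''kbibDBBe'', ''labdBIAd'', ''mHbceCfBLablBe'', ''nbaEABkacDCmAdF'',
       ''mlbCEcDaMAKbakAdBBe''] ''ab'' ''c'' 3 [('''', [(0, ''a''), (0, ''b'')]), (''a'', [(0,
       ''''), (0, ''ab'')]), (''b'', [(2, ''ab''), (0, '''')]), (''ab'', [(1, ''b''), (0, ''a'')])],
      Contra [''ji''],
      Contra [''jicDCGaCd''],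
      Contra [''jaHbceCfBAi''],
      Contra [''jDadIAdbFcECBh''],
      Contra [''jDadIAdbFcECBh''],
      Closed [''jaeDAd'', ''kHbceCfBDaiEbaeIAdBe'', ''lbaEAiEBeacDCkAdF'',
       ''kaeIAdbCEcDaKAEbeIabiEBeAdBBe''] ''ab'' ''c'' 3 [('''', [(0, ''a''), (0, ''b'')]), (''a'',
       [(0, ''''), (0, ''ab'')]), (''b'', [(2, ''ab''), (0, '''')]), (''ab'', [(1, ''b''), (0,
       ''a'')])],
      Contra [''jHbceCBeIae''],
      Contra [''jGaIAdbFcECBh''],
      Contra [''jDaiCbfBDaiCDcAgcAdbFcECBh''],
      Contra [''jGaCdcEbDaabCEcFcECBhceCAIabDagABAAdBeAd''],
      Contra [''jHbceCfCe'', ''jjbDaaCDcAgABDaabaGAdBAibcECjBeDagAAd''],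
      Contra [''jDaabaGAdBAifCEcEbbFcECBh'']]],
    Contra [''hagAd''],
    Contra [''hcDaGAd''],
    Contra [''hcDaGAd''],
    Contra [''hcaEGAd''],
    Contra [''hageDAd''],
    Closed [''hcd'', ''ibaCDcAgBe'', ''jIbdBicaDAd'', ''kIbdcDCBGaCdcFDAd'', ''laGAd'',
     ''maIAlCaLAd'', ''nmCGcLabdBAlCd'', ''ofCDcLabDBiAmCbDBicaDAd'',
     ''mIbacDCAmCDaabFBAlFcICAcLabfMafABicgCfCMcAgbfCmcFBBecbDBiCfLabDBiAmCbDBicaDAd''] ''ac'' ''ac'' 4 [('''',
     [(0, ''a''), (0, ''c'')]), (''a'', [(0, ''''), (1, '''')]), (''c'', [(0, ''ca''), (3,
     ''a'')]), (''ca'', [(0, ''c''), (0, ''cac'')]), (''cac'', [(0, ''caca''), (3, ''caca'')]),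
     (''caca'', [(0, ''cac''), (1, ''ca'')])],
    Contra [''hGaFGAd''],
    Closed [''hcd'', ''iDagce'', ''jcICabdBAciaDAd'', ''kacICAd'', ''lKacd'', ''mbLBe'', ''nkmCd'',
     ''oGaCd'', ''pfCDOcbaDAdCDcBlaDAd'',
     ''lcICabcDCfBKacgCfAAdFccKICCfCicMbafAgcbDBCoaFABmCOcbaDAdCDcBlaDAd'',
     ''ocICamAgcbDBCoaFDAd''] ''ac'' ''ac'' 4 [('''', [(0, ''a''), (0, ''c'')]), (''a'', [(0,
     ''''), (1, '''')]), (''c'', [(0, ''ca''), (3, ''a'')]), (''ca'', [(0, ''c''), (0, ''cac'')]),
     (''cac'', [(0, ''caca''), (3, ''caca'')]), (''caca'', [(0, ''cac''), (1, ''ca'')])],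
    Contra [''hFGaCd'', ''hfChchaF''],
    Contra [''hcDaaeAGAd''],
    Contra [''hcDagAd''],
    Contra [''hcaEGaCdcAAd''],
    Contra [''hbaCDcAgBeDag''],
    Contra [''hfDaaFGaCdcAAd''],
    Closed [''hcd'', ''igcE'', ''jDaice'', ''kcJCabdBAcjaDAd'', ''lacJCAd'', ''mLacd'', ''nbMBe'',
     ''olnCd'', ''pIaCd'', ''qfCDPcbaDAdCDcBmaDAd'',
     ''mcJCabcDCfBLaciCfAAdFccLJCCfCjcNbafAicbDBCpaFABnCPcbaDAdCDcBmaDAd'',
     ''pcJCanAicbDBCpaFDAd''] ''ac'' ''ac'' 4 [('''', [(0, ''a''), (0, ''c'')]), (''a'', [(0,
     ''''), (1, '''')]), (''c'', [(0, ''ca''), (3, ''a'')]), (''ca'', [(0, ''c''), (0, ''cac'')]),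
     (''cac'', [(0, ''caca''), (3, ''caca'')]), (''caca'', [(0, ''cac''), (1, ''ca'')])],
    Contra [''hcDadGAd''],
    Contra [''hcDadGAd''],
    Contra [''hcaGAd''],
    Closed [''hcd'', ''igE'', ''jbaCDcAiBe'', ''kJbdBjcaDAd'', ''lJbdcDCBIaCdcFDAd'', ''maIAd'',
     ''naJAmCaMAd'', ''onCIcMabdBAmCd'', ''pfCDcMabDBjAnCbDBjcaDAd'',
     ''nJbacDCAnCDaabFBAmFcJCAcMabfNafABjciCfCNcAibfCncFBBecbDBjCfMabDBjAnCbDBjcaDAd''] ''ac'' ''ac'' 4 [('''',
     [(0, ''a''), (0, ''c'')]), (''a'', [(0, ''''), (1, '''')]), (''c'', [(0, ''ca''), (3,
     ''a'')]), (''ca'', [(0, ''c''), (0, ''cac'')]), (''cac'', [(0, ''caca''), (3, ''caca'')]),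
     (''caca'', [(0, ''cac''), (1, ''ca'')])],
    Contra [''hg''],
    Contra [''hcGaCEcGAdCabd''],
    Contra [''hfDaaFGaCdcAAd''],
    Contra [''hDaaCDcAgbDafCDcAgbDBBeAd'', ''hfhh''],
    Contra [''hcdCGaCdcF'']])"
  by code_simp

text \<open>All surviving coset tables have size 12.\<close>

lemma certificate_one_involution:
  "check ([] @ forbidden_words) [(CHR ''f'', ''ccc''), (CHR ''e'', ''bbb''), (CHR ''d'', ''aa'')] (
   Branch CHR ''g'' ''BC'' [
    Contra [''hfbg''],
    Contra [''hcbDG''],
    Contra [''hfbgBegBebE''],
    Contra [''hGEbbFG''],
    Contra [''hfbgd''],
    Closed [''hCecbgagAdBe'', ''ifhE'', ''jfChEchBfbgabhBf'', ''hjahgAd'',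
     ''jjagAd''] ''bc'' ''b'' 3 [('''', [(1, ''''), (0, ''c'')]), (''c'', [(0, ''cb''), (0,
     ''cc'')]), (''cb'', [(1, ''cc''), (1, ''cb'')]), (''cc'', [(2, ''c''), (0, '''')])],
    Contra [''hbGBF''],
    Contra [''hcbgBeBd''],
    Contra [''hfbgBebgBe''],
    Contra [''hbGBF''],
    Closed [''hbgcd'', ''ifChegcacgCfhbf'', ''jacDCiAd'', ''kiaDaIcdCAAd'', ''lHFciCiae'',
     ''hfCDchlagiAd'', ''lialAdE''] ''ac'' ''b'' 3 [('''', [(0, ''a''), (0, ''c'')]), (''a'', [(0,
     ''''), (1, ''a'')]), (''c'', [(0, ''ca''), (1, ''ca'')]), (''ca'', [(0, ''c''), (2, '''')])],
    Branch CHR ''h'' ''abc'' [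
     Contra [''ibGBH''],
     Contra [''ieDaHAdbDaHAdbfBBeg''],
     Contra [''iGEbbFBDahDahAAd''],
     Contra [''iDah''],
     Contra [''ibGBDH''],
     Contra [''iDahAd''],
     Contra [''ih''],
     Contra [''iBDahbdBAh'', ''iDaafAIcICfCBHbcDaBHbEbHBHAdbcDahACiaCecDaBHaBhbAdbgAAdiBHAd'',
      ''iIEI''],
     Contra [''iGBFbDaaEHAdbf''],
     Contra [''ih''],
     Contra [''iDahcd'', ''jDaCBibcbgBiAd'', ''jJbgBDahAIbHabJFBAhcIbGBCBIbHBeBBIbHIbHaeAd''],
     Closed [''iDah'', ''jBibEbbIBeBcBaFAIbCfbgfD'', ''kEbJBi'', ''lJBibkaf'', ''mabDBlAdF'',
      ''neBDbkajlAdF'', ''olaFcDaKBdbACDaKBdbEAAd'', ''ibhBDahceCBi'',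
      ''ilaFcDaKAIbabDBJcECHAdbciakAdCfBBeCjlaFAAd''] ''ab'' ''c'' 3 [('''', [(0, ''a''), (0,
      ''b'')]), (''a'', [(0, ''''), (2, ''a'')]), (''b'', [(0, ''ba''), (2, ''ba'')]), (''ba'',
      [(0, ''b''), (1, '''')])],
     Contra [''ih''],
     Contra [''iGEbbFBDahAdEbDahAd''],
     Contra [''iGEbDaabFBAhAd''],
     Contra [''iBDahAhbD'',
      ''iDaafAIcICfCdBHbcDadBHbEbbdBHdBHAdbcDahbDBACiaCecDadBHaBhbDAdbgAAdidBHAd'', ''iIEI''],
     Contra [''iDaabFBAh'', ''iGBBiaDaIAIbFBAIbbE''],
     Contra [''ihcD'', ''jDaicd'', ''kDaCBjbcbgBjAd'',
      ''kKbgBDaiAJbIabKFBAicJbGBCBJbIBeBBJbIJbIaeAd''],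
     Contra [''ibbgBBeBDaaHAdbGBFHAdbcbG'', ''iDaaHAdbGBFccICGCHaiAAd''],
     Contra [''iDahDAd''],
     Contra [''iDah''],
     Contra [''iFGBDaabgBAhEbbaEAhBhBabgBeAAdcDCbEbDahBdbEAhBabgBAhBhbEbbHaeABBeBaBDbHAdbcd'',
      ''iIFI''],
     Contra [''ieDaaEAh''],
     Contra [''iDahCd'', ''jIbGBCBI'', ''jCBibcFccBIbcJCBiaFAJIbCf''],
     Contra [''iabGBCEcHAdbGBF''],
     Contra [''iBDahabgBAAd''],
     Contra [''iDaaCecbgfCbgBecBHAdbcaEbbGBBHAdCGBAd'', ''jEbIFcGCGBCEcii'', ''jcJCJEbbGBCEci''],
     Contra [''iFGBDaabgBAhBDbEbbaEAhBDhBDabgBeAAdcDCbEbDahEAhBDabgBAhBDhBDbbEbdbHaeABBeBaHAdbcd'',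
      ''iIFI'']],
    Contra [''hbGBF''],
    Contra [''hbgaDaGAGBFbAG'', ''hfhh''],
    Contra [''heg''],
    Contra [''hDcbgBeBd''],
    Contra [''heg''],
    Closed [''hBCDcbg'', ''ibhcd'', ''jfCiehcachCfibf'', ''kacDCjAd'', ''ljaDaJcdCAAd'',
     ''mIFcjCjae'', ''ifCDcimahjAd'', ''mjamAdE''] ''ac'' ''b'' 3 [('''', [(0, ''a''), (0,
     ''c'')]), (''a'', [(0, ''''), (1, ''a'')]), (''c'', [(0, ''ca''), (1, ''ca'')]), (''ca'', [(0,
     ''c''), (2, '''')])],
    Contra [''hFcGCGBF'', ''ihBceCGBhbE'', ''iIbgIFcIhCG''],
    Closed [''hCecbgDagDAdBe'', ''ifhE'', ''jfChEchBfbgDabhBf'', ''hjahgDAd'',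
     ''jjagDAd''] ''bc'' ''b'' 3 [('''', [(1, ''''), (0, ''c'')]), (''c'', [(0, ''cb''), (0,
     ''cc'')]), (''cb'', [(1, ''cc''), (1, ''cb'')]), (''cc'', [(2, ''c''), (0, '''')])],
    Contra [''hbdGBF''],
    Contra [''hfbg''],
    Contra [''hfbg''],
    Contra [''heBgCdcbg'', ''hcGEbhBh''],
    Contra [''hcbgBCfCCecbgbgBBecbgF'', ''hHEH''],
    Branch CHR ''h'' ''CB'' [
     Contra [''iDaGBh''],
     Contra [''ieBBHbgHbgafhAd''],
     Contra [''iDaGBh''],
     Contra [''iDaGBh''],
     Contra [''iBCDaGADagAdcbcbGBhd''],
     Contra [''icHCE''],
     Contra [''ibGBh''],
     Contra [''iGBh''],
     Contra [''iGBhebE''],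
     Contra [''iGch''],
     Contra [''iDaG'', ''jFcH'', ''kBCicjbE'', ''lBCDIcbk'', ''mLgak'', ''nMKcLBCDIcbCfCmcj'',
      ''nKDaGBFbEAMLBCecbgaNMbGBhcICfCKicjEAn'', ''nNKcKCfCn''],
     Contra [''icHCE''],
     Contra [''ibGBh''],
     Contra [''ifh''],
     Contra [''ibaFAGBh'', ''jbgIBeBI'', ''kaDaJAJCEcAJ'', ''jKJCBDIbJCBIbkcF'', ''jaJAkj''],
     Contra [''iGBCBDbch''],
     Contra [''ifDaaFAGBh''],
     Contra [''iDaG'', ''jFcHCBd'', ''kBCicjbE'', ''lBCDIcbk'', ''mLgak'', ''nMKcLBCDIcbCfCmcj'',
      ''nKDaGBFbEAMLBCecbgaNMbGBCBDbchcICfCKicjEAn'', ''nNKcKCfCn''],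
     Contra [''ifh''],
     Contra [''icdHCE''],
     Contra [''ibGBhD''],
     Contra [''ieBHbg'', ''jHbgBiaf'', ''kagAd'',
      ''kfDaJAbHBeBgIbkBCKIecbgacjCAIbdCkcBeBKaBFbAbjahjAd''],
     Contra [''ibDGBhBGbEbh''],
     Contra [''iDaG'', ''jBCicHbg'', ''kgajAd'', ''lKBCIcbj'', ''iLcICfCCjafAcHbgBcFcBCidcbkCf'',
      ''mJKBCecbgi'', ''iHMi'', ''iMLcJCfICaeAcihihiF'', ''iIMaKBifbgAdj''],
     Contra [''iech''],
     Contra [''ieBBHbgHbgaE''],
     Contra [''iDaGBh'', ''ieiaiAd''],
     Contra [''iDaHCgd'']],
    Contra [''hbgBe'', ''iBFbHCHcF'', ''hCechBIbE'', ''hCEchbhBei'', ''hHFH''],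
    Contra [''hcbgfBCfCCecbgfbgfBBecbg'', ''hHEH'']])"
  by code_simp

text \<open>The products \<open>abc\<close> and \<open>acb\<close> may be forbidden because the case
  in which one of them is trivial is treated separately. The surviving coset tables have size 21 and
  24.\<close>

lemma certificate_order_three:
  "check ([''abc'', ''acb''] @ forbidden_words) [(CHR ''f'', ''ccc''), (CHR ''e'', ''bbb''), (CHR ''d'', ''aaa'')] (
   Branch CHR ''g'' ''AB'' [
    Contra [''heag''],
    Contra [''heagAdgAdaD''],
    Contra [''hGDaaEG''],
    Contra [''haG''],
    Contra [''heagAdagAd''],
    Contra [''haGAE''],
    Contra [''hcbDaG''],
    Branch CHR ''h'' ''abc'' [
     Contra [''ih''],
     Contra [''ifAH''],
     Contra [''iBHabfBHAdbage''],
     Contra [''idHaHaeAAdg''],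
     Contra [''iAhdaD''],
     Contra [''iAh''],
     Contra [''ih''],
     Contra [''iAhaDaaG'', ''iiaEbbFBiaEbiaEGABABGABAH''],
     Contra [''ifbEHBGAbEHBGaD''],
     Contra [''ih''],
     Contra [''iBAhabagAh'', ''iIcDCI''],
     Contra [''iHaGABAHabcECHabHaG''],
     Contra [''ih''],
     Contra [''iBAhabE''],
     Contra [''iBAhaFBAhabbE''],
     Contra [''iaBAhabageagAAd''],
     Contra [''ibEbAhaDaabFBAhG''],
     Contra [''iHaGABAH'', ''iIcDCI''],
     Contra [''iceCHabHaG''],
     Contra [''ibEbAhaDaG''],
     Contra [''iGDaaEAhDah''],
     Contra [''idBGABDbH''],
     Contra [''iGDaaEAh''],
     Contra [''iCBAhabagbFBAhcF'', ''iIACDcaicdCBAhabagbFBAhaicdCBAh''],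
     Contra [''iafAdAAHabcECfCHabfBGABAHabcBH''],
     Contra [''icBAHabCfCaGAcAHabf'', ''ieBAHabcabiBeACBAhaFcibAHaBeCi''],
     Contra [''iCaGAcBHaGAbE'', ''jAdABICaGAcbagaDaaG'',
      ''jCDcbAJcaGABdbageBagAbAJCfibAfieagBeBdbagbgBe'', ''jJFcJCD''],
     Contra [''iAhag'']],
    Contra [''haGAE''],
    Branch CHR ''h'' ''AC'' [
     Contra [''ifah''],
     Contra [''ifahAdhAdaD''],
     Contra [''iaH''],
     Contra [''iHDaaFH''],
     Contra [''iahAd'', ''jIbageBgbGABFccEbGBCBGDbEbbaEGABiBe'', ''jJbciCBGABgbJeagbcBgbCfiBe''],
     Contra [''iHAbagABaDaaGAEbbaGABBGABFbEbGAEbaGABah''],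
     Contra [''iaHAF''],
     Contra [''iahbaHACgcbageABBeBdgbcbgBeBfbagH'', ''jICGcah'',
      ''jJGABgbcbIFcBGbCBjaBgjaGAbEbiBHACaD''],
     Contra [''iHAbagAdBeagbcEbHAbagABaBCBGDaGAbEBeag''],
     Contra [''iaHAF''],
     Contra [''ibAeagBeBfbagbbagABBe'', ''jbAbagABaBiaBdgbce'',
      ''jaHAbagiAdgBeBHbEbjaHACgcbageBfbagAAdBiaBdgbcjaH''],
     Contra [''iAbaGABah'', ''icdCIDaaGABFcICIAeag''],
     Contra [''iaHAF''],
     Contra [''iahAd'', ''jcEbGBCBGDbEbbaEG'', ''kBfbageBagAdgbcbIBJCfbagBGbEGABiDAd'',
      ''lccbagAdgBekAeagbcBgbCfiBCCfiD'', ''lLcECBGbEbbIBJckCBGABgbceCl''],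
     Contra [''idh''],
     Closed [''ibaGABFccEbGBCBGDbEbbaEGABBCBGbEbbhBe'', ''jaGAEbHDBiAHaD'', ''kiAHaD'',
      ''lbHDBiAHaD'', ''mahbDBGABahGAbE'', ''idgbfmHDBiAHaD'', ''nbAeagBeBfbagbbagABBe'',
      ''naahAAdAeagbcBFbEbGBCBGDbEbbaBfbagAAdBnaEbbaGABCEcFcBGbCBGAEbDaaGABFbEGABahnaEbbaGABCEcFcBGbCBGAEbDaaGAEGABahnAdABdhBeBgbcbaGABCagbdBHAmbCahAcahGABCMcF''] ''ab'' ''aC'' 7 [('''',
      [(0, ''a''), (0, ''b'')]), (''a'', [(5, ''b''), (4, '''')]), (''b'', [(2, ''''), (3,
      ''a'')])],
     Contra [''ifHg''],
     Contra [''iFcHCHAF'', ''jiAcdCHAiaD'', ''jJahJFcJiCH''],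
     Contra [''iGAE'', ''jaGABF'', ''kcEbGBCBGDbEbbaEG'', ''lbaGABFckbahG'',
      ''mbgBeJabahABlJAdIbcBFbCkbahABlBf'', ''nLbaHAFcBGbCBiAm'', ''mMbgBenh'',
      ''oAMaNLbaGABCEcahfCahAcmcaHACG'', ''oaHAbageagAAdIBeJabbagABBeOAMaNLbaHABKcnAmaoCHAmcaH''],
     Contra [''ibFcBGbCBGAEbDaGABah'', ''jcEbGBCBGDbEbbaEG'',
      ''jIJcBfbageBagAdgbcbAbaGABahDaGABCGABFbCji''],
     Contra [''ifah''],
     Contra [''iEbbaEG'', ''jcEbGBCBGDbi'', ''kCGcahE'', ''lcaGABFbCjbkaG'', ''iIBaHAbag'',
      ''mfCahAdcahBg'', ''maHALcIJCfbagAMBGABgbaDaMAMcDCl'', ''mMaHALfCMaHAcFBGDaGAbE'',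
      ''mahEbbaGABBGABFbEbGAEaBMkIbmBeagAKme'', ''mfmBmbE''],
     Contra [''iGAHAFaaD''],
     Contra [''iCdcahahAAd'', ''jcahACfCicahF'',
      ''kfCbagAJBcbageBgbGABFccEbGBCBGDbEbbaEGABBCBGIbagbaGABAJICaGAcbagAJIbagbaGABHACgcbageABBeBdgbcbgBeBfbCBGAEaDaaGABFbcbagAJBCBGDbEbbaGABBGABFbEbGAEajaG'',
      ''kaKAJAcECBGbagbcjCfCicahFBGbEGABCbjaGABcFk''],
     Closed [''iAbaGABah'', ''jfCIcIAeag'', ''kEbJBJcD'', ''lEbaiABaiF'', ''mBGD'',
      ''nbaGABFccEbGBCmEbbaEGABFcBGbCBGAEbDBai'',
      ''mAjaDaaGAkALBdgbmlafIAbjBekcLMCfbageBgbABnaGABIgbcekCf'',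
      ''nBGbEbbAbagABeagBeBfbagbbagABBeBdgbceCABn'', ''ijaiFALBdgbnalAd'',
      ''najGABgbnalAd''] ''ac'' ''Ac'' 7 [('''', [(0, ''a''), (4, ''a'')]), (''a'', [(0, ''aa''),
      (2, ''aa'')]), (''aa'', [(0, ''''), (1, '''')])],
     Contra [''iahAd'', ''jAFaICIcF'', ''kCdciAJaD'', ''jICDckakAdj'', ''lij'', ''mbaEG'',
      ''maDaabLMBeBdgbcbgBeCfCbagABclcbaGABCBfbagAAdAeagbcagAdCJICDckalBGbABmlBGDbEbmlBG''],
     Contra [''iBGcahGACfbagbbagAdcahGABgbCfbageABBeBdgbcbgBeCBGAEaDaaGAAAdg''],
     Contra [''iahf'', ''jCdciaiAd'', ''kfCjciaF'', ''lciCk'', ''mcEbGBCBGDbEbbaEG'',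
      ''iLJCaGAcbagALJbagbaGABAICgcBMcBfbCBGAEaDaaGABF'', ''mbaGABFcmCBGJbagbaG'',
      ''kIMbKcLCBGABgbceCal'', ''mKIMbaBGbEGABCblaGABcF'',
      ''kMKacbagALBCBGDbEbbaGABBGABFbEbGAEalaG'', ''kaKAmk'']],
    Branch CHR ''h'' ''BC'' [
     Contra [''ifbh''],
     Contra [''iH''],
     Contra [''ifbhBehBebE''],
     Contra [''iHEbbFH''],
     Contra [''ibGAEaDaabaGABAFGABDaaGABDabaGABAbh''],
     Contra [''iDaaGABD'', ''jabagAdbagfABBeAIAcbagAHBCag'', ''kJCaGAcbh'', ''ibDaabaGABAFGABi'',
      ''lbhaKGAEbKGBaDaabDaGABAFcGAEaCGABDbAIbAeagkBe'', ''mbaGABAbhaGABaD'',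
      ''mbaDaLAMbIBeagALjkeABmal''],
     Contra [''ibHBF''],
     Contra [''ibDaabaGABAFGABDaaGABD'', ''jbGAEaBiaBabaGABAbh'',
      ''jeBEbjabbagABBeAIHBabagADaGABACabaGABAcFbagcaGABDbagACGAEbjabaGABAbhBe''],
     Contra [''ibFcGDCGAEaDaabaGABAFGABAcAbaGABaDCaDaaGAh'', ''iHEbiabDaGABABi''],
     Contra [''ibHBF''],
     Contra [''ibDaabaGABAFGABDaaGABD'', ''jbGAEaBiaBabaGABAbh'', ''kBjaGAbE'',
      ''kjaGABDbAIbAeagkbgkBeBaD''],
     Contra [''iaGABD'', ''jDai'', ''kabaGABACjcFcGAEbaGABaD'', ''lbDaabaGABAFGABj'',
      ''lDaaGAEblaGABAbhGBaDaabDaGABAFcGAEaCAiALbAeag'', ''mcDaaGAACGAEaDaabDaG'',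
      ''mHagKabcDCBLAcbaGABCajaEbbaFGABDaGABAAMcAfaCAiEbbaFGABDaaGAGABAbhBaDaabaGABAFcmCGAhalbcdCBAkGAhal''],
     Contra [''ibHBF''],
     Closed [''icDaaGAACGAEaDaabDaG'', ''jabaGABAFciCGAh'', ''kaHEAjBHbE'', ''ljBHbE'',
      ''mbaGABDaHEAjBHbE'', ''nabagbaGABAFBAjBaGAbEbD'', ''oCEcnbaGABAnbaGABaD'',
      ''jeagfoHEAjBHbE'', ''pbDaabaGABAFGABDaaGABD'',
      ''icbDaGABAFaCiaabagAdBAAdAbDaaGAGABaDaoAdbagAd'',
      ''ibnBeBdbagcbagABCGAEbpHBCdcabagABehAdbagABNCecoaFibbagABBeAPIce''] ''ab'' ''bC'' 7 [('''',
      [(0, ''a''), (0, ''b'')]), (''a'', [(3, ''b''), (2, '''')]), (''b'', [(4, ''''), (5,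
      ''a'')])],
     Contra [''idAHag''],
     Contra [''ibGAEaDaabaGABAFGABAcDaabDaGABAACaDaaGAh'', ''jcbDaGABAFaDaaGAACGAEbDaaGAGABaD'',
      ''kabagABiAdAbabagAdBGABaDaCecAJcbgBiCG'', ''kaKAJcbKFBiaiAdAeagCfabagAdgBiAdAbaGABaDak'',
      ''kekk''],
     Contra [''ieh''],
     Contra [''icDaaGAACGAEaDaabDaG'', ''jDaaGABD'', ''kcdAbagABeagCfCJcabagAH'',
      ''labaGABAFciCkIH'', ''maLAdAbfBeBLabaGABACDcbhk'', ''nJAHagk'',
      ''obMaagAAdbagfABBeBaabagAdBAAdbEbbDaabaGABAFGABjnaFGABjn'', ''kcbaGABAFaCiKcICfabagAf'',
      ''nOAKcbaGABCajaEbbaFGABDaGABAMn'', ''nAOaDaKcbaGABCGABDnlbEon'',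
      ''mbaGABDaObaGABACbagABcnd'', ''mMbaGABDaOAKcmCHLabaGABAn''],
     Contra [''iFcHCHBF'', ''jceCHBibE'', ''kiBj'', ''lbDaabaGABAFGABDaaGABD'',
      ''mbGAEaBlaBabaGABAbhcagACG'', ''nabKaGABACbagABeciBHbEbkBm'',
      ''oMJcbaGABAFaDaaGAACGAEaDaabDaGABACaGAciNabaGABACDaaGABDbAcFcGAEbaGABaDakACGAIk'',
      ''pKFcOCH'', ''qbaGABAiagcaKACGAhpag'', ''maPOMbGDaGABAFcGAEaDCQbLBeagjAnop'',
      ''mMBqKabagAdMaGABAiagQbmBAnopbElm''],
     Contra [''iEbbFcGDCGAEaDaabaGABAFGABAcAbaGABaDCaDaaGAh'',
      ''jbGAEaDaabaGABAFGABAcDaabDaGABAACaDaaGAibDaGABACdcabag'',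
      ''jaHibgBjabaGABACecAdAbagagAAdBeagcaagAAdAfabagAdgBjCG''],
     Contra [''ifbh''],
     Contra [''iaaGAHBabagABAdbagAAdbagfabagABAAdAeag''],
     Contra [''ifbh''],
     Closed [''iDaabaGABAHBabagABAdbagAAdbagfabagABAAdAeag'', ''jbFBIAIaD'',
      ''kabagAdBAJbabagABAJBe'', ''lfCCagAckagAckBdbag'',
      ''mBlaGAbEbDaLALcECfBjalAdAfCagAckagcaLALcECCf'', ''jlajAdAeKabagAdiBe'',
      ''lblaGABAKabagAdiBe''] ''bc'' ''Bc'' 7 [('''', [(0, ''b''), (4, ''b'')]), (''b'', [(0,
      ''bb''), (2, ''bb'')]), (''bb'', [(0, ''''), (1, '''')])],
     Contra [''iCecbhbhBBe'', ''jfCicbhF'', ''kcbhBCj'', ''lKICbaGABcabag'',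
      ''mcDaaGAACGAEaDaabDaG'', ''nabaGABAFcmCGAIabagbaG'', ''oLNabGDaGABACakbaGABAcF'',
      ''mOaKIabagABKBdbagAAdbagfABKBdbagcAFaCmaCaGAcbhabagABGABAikAocDCG'',
      ''mbMBKBcDCGbagckCjAnlom''],
     Contra [''iGAEbbDaabaGABAFGABAcbagAHBCaBaDaabDaGABAFcGAEabagAH''],
     Contra [''iabDaG'', ''jbhBe'', ''kBFbJCJcF'', ''lCecjBKbE'', ''kJCEclblBek'', ''mjk'',
      ''nEbbaFG'', ''oDaaGABD'', ''pceCKJCEcl'', ''lLCbaGABcabag'',
      ''kcaGACKJCagAcIaNAOAcbagABCplabm'', ''jaEbbaGABBAimcamACk'', ''qNBamGAbE'',
      ''iQbgMCabaGABAcFcDaaGAACGAEaDaimG'', ''oJObagfabagABAAdBi'',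
      ''oOJaEOKcaMAdAbagABObMBaDaLPcbaGABCGABDbnqiCG''],
     Contra [''ibhf'', ''jCecibiBe'', ''kfCjcibF'', ''lciCk'', ''mLJCbaGABcabag'',
      ''ncDaaGAACGAEaDaabDaG'', ''oabaGABAFcnCGAJabagbaG'', ''pMOabGDaGABACalbaGABAcF'',
      ''nPaLJabagABLBdbagAAdbagfABLBdbagcAFaCnaCaGAcibabagABGABAjlApcDCG'',
      ''nbNBLBcDCGbagclCkAompn'']],
    Contra [''haGAE''],
    Contra [''hcFG''],
    Contra [''hdg''],
    Contra [''hbagAd''],
    Contra [''hEbGBGAE'', ''ihAbdBGAhaD'', ''iIagIEbIhBG''],
    Branch CHR ''h'' ''BC'' [
     Contra [''ifbh''],
     Contra [''iH''],
     Contra [''ifbhBehBebE''],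
     Contra [''idAbhfBeBhbag''],
     Contra [''ifCBGbcFcbagAHBCD''],
     Contra [''iaEbbaGABBGABfbh'', ''jbageAi'', ''kEbJcbaGABCfBGAE'', ''lEbJBeBagAbkAe'',
      ''lbagABJLkDaaGABfbAiCbaGABclKl''],
     Contra [''iGABfbh''],
     Contra [''iGcbhBeCbagagAAdAeagBeBFbagbbagABBeagAAdAGcbhBeCbagEGABacbhBeageAdcbhBeCCfCBgbcFbageGABcEbHBCgbFBeBagAdgbCbDaaGAGABcEbHBCgcFcbageagAAdAeagBeBFccEbHBCCbEbHBCAccbhBeCCfCEcBGbagbbhBe''],
     Contra [''iGAEHBFbagbbagABBeBaGAbE'', ''ibEbIBeBFbagIG''],
     Contra [''iaGABfbh''],
     Contra [''iBFbagbbagABBe'', ''jbageagAAdAeagBei'', ''kJcbH'', ''laEGAEbbHBBGABgbCecaKJ'',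
      ''mFcLaEACLk'', ''iMCEcBGMbik'', ''iLaagAAdiKJfCBGbcmiD''],
     Contra [''iaEbbaGABBGABfbh'', ''jDaaGAAicAIaCbagAd'', ''jbAiaBJDaaGABfbEbGBJ''],
     Contra [''iaGABfbh''],
     Contra [''iHEbG''],
     Contra [''idbh''],
     Contra [''iaGAEbeBagAdgbCbAeagBehbgBehcBGD'',
      ''iIaHBFbagAAdAeagbCagAicBGAEbbaEGABBaDaaGABfBGbbEAi'', ''ieii''],
     Contra [''ieh''],
     Contra [''ieBhbageBBgbFbagAAdAbbageABBeageBhbag'',
      ''ieBBgbbhcDIeBhbagbbaGABBGABfbEbGAEaDaaGAEGABCfBGDIeBhbbEbfBi''],
     Contra [''iHEbG''],
     Contra [''iaDaaEbbaGABBGABfbh'', ''ieii''],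
     Contra [''iGABfbhaD''],
     Contra [''idcbh''],
     Contra [''iGABfbhaDaaEGABfbh''],
     Closed [''ibAeagBeBFbagbbagABBe'', ''jbAbagABaBiaBdgbCe'', ''kaCAeagcBGDaJGAbEGABfbh'',
      ''ibageagAAdBi'', ''lAfaDakAI'', ''mbaGABcECLALaD'', ''nbagABm'', ''oeBgbFcLDkCbagABm'',
      ''pCdcAkagbAkagBe'', ''qJeBBgbbPCaGABfbPcF'', ''pMbdBjqcdlCfBGbagmAdliaKAdApagbp'',
      ''qbbagABmBmafAqckCbagABm''] ''bc'' ''ac'' 7 [('''', [(0, ''b''), (1, ''b'')]), (''b'', [(0,
      ''bb''), (2, ''bb'')]), (''bb'', [(0, ''''), (4, '''')])],
     Contra [''iaEbbaGABBGABfbh'', ''jabageAiBG'', ''keBAiagbCGcIaE'',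
      ''lEbGbJaGABcagAKbaGABCfBGAE'', ''mHl'',
      ''maaLBFbagAAdLBmbEbbMBGMBGbJaGABcagbMBGAEaLBmbJaceCbagABkAdLBmDbAimi''],
     Contra [''iAHBFbagbbagABBeBaGAbE''],
     Contra [''iabEbHBFbagbbagABBGABcbaGABCfBGAE''],
     Contra [''iaEbbaGABBGABfbhf'', ''jabageAiBG'', ''keBAiagbCGcIaE'',
      ''lEbGbJaGABcagAKbaGABCfBGAE'', ''mFHl'',
      ''maaLBFbagAAdLBmbEbbMBGMBGbJaGABcagbMBGAEaLBmbJaceCbagABkAdLBmDbAimi'']],
    Branch CHR ''h'' ''abA'' [
     Contra [''ih''],
     Contra [''iaaDHAHaeAAdg''],
     Contra [''iH''],
     Contra [''ifaDaaCDcFcHCHaeAAdgHAd''],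
     Contra [''iGDaaEAhdAhd''],
     Contra [''iAH''],
     Contra [''iAH''],
     Contra [''iAhbahbdBAhBeag''],
     Contra [''iGAEH''],
     Contra [''ieBagAbagf'', ''iGABhbaDaacdCGABgbEbHabDBABiaCidcFcGCGAEaDahAAd''],
     Contra [''iabdBAh'', ''jBdAIabaCDcABAiabag'', ''kbAIaBej'', ''laIKAhchcdCCfCDcABAiabagHakAd'',
      ''laLJEbAifaBkAdAFIablBk''],
     Contra [''iGBAhabagcDacdCGAECHAdAeagcgCfCDhceBagAbagcGCGAE''],
     Contra [''ifCFHcFHae'', ''iiaBdbEbAhfaBAhaDaacDCiAdgcDCiAdg''],
     Contra [''iaGAAH''],
     Contra [''icAh''],
     Contra [''ih''],
     Contra [''iFcGCGAE'', ''jaHAdICD'', ''kGABhbJ'', ''kkbFccECkHabIBAj''],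
     Contra [''ih''],
     Branch CHR ''i'' ''AC'' [
      Contra [''jfai''],
      Contra [''jfaiAdiAdaD''],
      Contra [''jaI''],
      Contra [''jIDaaFI''],
      Contra [''jdAAeagcgCfai''],
      Contra [''jecFcHabDBeBagAbagfAIACBCdcFcGCGAEaDahAbagfaiAd''],
      Contra [''jaIAF''],
      Contra [''jdAAeagcgCfai''],
      Contra [''jeBagAbagf'', ''kDaJIAFcHaI'', ''lHAdAeagcgCfCDcakag'',
       ''lALaDaLHAdAbgfAJaBAhaDaacdCGABkbE''],
      Contra [''jaIAF''],
      Contra [''jdAAeagcgCfai'', ''jdgcBAjGaDbCHj''],
      Contra [''jeBagAbagf'', ''kaagcDCAAdAHabAj'', ''lDaaIAFGABaHAdAeagcgCfCDcbcaiGACHaKAdg'',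
       ''mKaagcDCAAdl'', ''mbCalGAcFalGABHbagceCHAdAbgfBmalcDaJbdBAhCfaiGAAkmalGDakABjaCm''],
      Contra [''jaIAF''],
      Contra [''jFcGCGAE'', ''kaHAdJCD'', ''laiAd'', ''mCEcl'', ''neBagAbagf'',
       ''oKaHAdMFcHabDBnAdCGLF'', ''pAbfANaBAhaDaacdCGABDaNbdBAhOKacECGABhOKbagfm'',
       ''jBAhabAdAgaLCbGBAhcECacjpaD'', ''jOKacECAJMFccPjafACCfCNcl'', ''jJcEbJHBnalACGLo''],
      Contra [''jdi''],
      Contra [''jaHAdAeagcgCfCD'', ''keBagAbagf'', ''kbIAJaHaIAJBkaEbbDBkaaiAAdBAh''],
      Contra [''jGi''],
      Contra [''jeBagAbagf'', ''jbDBjaaicdCGAAJbaHAdAeagcgCfCDcaiABj''],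
      Contra [''jeBagAbagf'', ''kagcDCIACjdcFcGCGAEaDahIAF'', ''laagcDCAAdAHabAj'',
       ''mhcBaKagcDCKAAdbCHabDBjAdACEcaiceCHAdAbgfBLakaD'',
       ''mMabKagcDCIACjcFccdCGDalbFBAmdCGDalABjaaiAAd''],
      Contra [''jecai''],
      Contra [''jfai''],
      Contra [''jdAAeagcgCfai'', ''kEbbJaeJAdBBeBDbCHjcFcHj'', ''kdJaekGAk''],
      Contra [''jfai''],
      Contra [''jdAAeagcgCfai''],
      Closed [''jacdCG'', ''keBagAbagf'', ''laJAdAHabAk'', ''mFcGBAhcECabCHabAAHaaBAhGaDAd'',
       ''naHAdMCD'', ''oaEbLaJAdBAhAnCjcaim'', ''pBcdCGbJaclCGABdAOabEbF'', ''qGDalAdAOaBFbp'',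
       ''paPAKbnCjcFcHabDBkAdCGDaoABe'', ''jPabGBAhcE'', ''rqbHdAOaBmALaj'', ''saqApj'',
       ''tFcJCHabDBkAd'', ''pJBAHabAeagqbfBeBAoaDbagceCAnCaGAEctAtaDKbdBAhftaDp'',
       ''tdAHabTFHdAOaBmALaj''] ''ac'' ''cb'' 7 [('''', [(0, ''a''), (2, ''a'')]), (''a'', [(0,
       ''aa''), (1, ''aa'')]), (''aa'', [(0, ''''), (4, '''')])],
      Contra [''jIAFcGBAhcECabCHabAAHaaBAhGaDAdaD'', ''jeBagAjhbagAjhcBHbCHaeAdAgAjaaDahAj''],
      Contra [''jIAFcGCGAEaaD'', ''jEbbFBjajAdBAh'', ''jAdAJagcAFaJCH''],
      Contra [''jdAAeagcgCfaif'']],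
     Contra [''iabGBAh''],
     Contra [''iAhaD'', ''iGAEiacabIBeACAIaD''],
     Contra [''iGAH''],
     Branch CHR ''i'' ''AC'' [
      Contra [''jfai''],
      Contra [''jfaiAdiAdaD''],
      Contra [''jaI''],
      Contra [''jIDaaFI''],
      Contra [''jdAAeagcgCfai''],
      Contra [''jecaiAdgcDaI''],
      Contra [''jaIAF''],
      Contra [''jdAAeagcgCfai''],
      Contra [''jFcGCGAE'', ''kaHAdJCD'', ''leBagAbagf'', ''mDaaIACEcALbhBcaI'',
       ''nKaMJFcGAHaCGABhbE'', ''nBNbMJCAKacaiNALbdBNKaBDbagcdCGAAkn''],
      Contra [''jaIAF''],
      Contra [''jdAAeagcgCfai''],
      Closed [''jFcGCGAE'', ''kJFcGAH'', ''leBagAbagf'', ''mLbd'', ''nacdCG'', ''oLbh'',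
       ''paNAdAO'', ''qaHAdJCD'', ''rcHCOaCecALbp'', ''sabQaHAdBAhAqChcaifj'',
       ''tbPBlaCEcPaNachCrAsAe'', ''ubQBlaFcrtCOAd'',
       ''vcbQaHAdBCKAbKBaDahAqFcOaCecAoCfCTRcBrtbag'',
       ''pdAkcMCaDanApCucFccUCvaGABTRbAqCqcFaDanAp'', ''wabgBAp'', ''xDaaPAdkGABhbE'', ''ybOBlaF'',
       ''zBgcxCbHabkcMCByavAd'', ''vFcZNCOaCycAmbAfaBMaCLcAocdUCv'', ''saGABaPAdkbHabDahAqBAsAl'',
       ''jbxBeBGbzczCfvsjAeagcDCOaCecvAdAGaD'',
       ''sdxysvnzcEloCfCTRcHabgBAp''] ''ab'' ''bA'' 7 [('''', [(0, ''a''), (1, ''a'')]), (''a'',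
       [(0, ''aa''), (2, ''aa'')]), (''aa'', [(0, ''''), (4, '''')])],
      Contra [''jaIAF''],
      Contra [''jeBagAbagf'', ''kJbh'', ''laDaaKAdiAd'', ''llDaaGALKaCJcAkcd''],
      Contra [''jdi''],
      Contra [''jeBagAbagfaiAAdAeagcgCfCDcai''],
      Contra [''jGi''],
      Contra [''jbDBeBagAbagfaicdCGAHAdAeagcgCfCDcai''],
      Contra [''jaFGABaGAbEbh'', ''jeBHbagIDajIDajAAdAcdCGD''],
      Contra [''jecai''],
      Contra [''jfai''],
      Contra [''jdAAeagcgCfai'', ''jdgcDajEAj''],
      Contra [''jfai''],
      Contra [''jdAAeagcgCfai''],
      Contra [''jecaiACbHBeBagAbagfIAF''],
      Contra [''jIAFcGCGAEaaD'', ''jagAjhagcDajAdCG'', ''jejj''],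
      Contra [''jFcGCGAE'', ''kIAjaD'', ''lDaKAKbf'', ''jjl'', ''mCdcjbjBe'',
       ''jaDaabMBAKbdBAhBGAEalJClcbMCKcbMBAKbKBeHabgBkAdlbjBe'', ''jealbjBjMbJBL''],
      Contra [''jdAAeagcgCfaif'']],
     Contra [''iAHabD'', ''jaBibAdAfaibaFGABibacdCABIDbEbIBBe'', ''jDcHCABIbaDajAj'', ''jdjj''],
     Contra [''iHabAEaDahCeBagAbagfHAdAeagcgCfCDccFcdCG'', ''ifii''],
     Contra [''iGDaaEAhd''],
     Contra [''iGAEbHaeABH''],
     Contra [''iHaeBdbEAhaDaacDCHaeAAdgcDCHaeAAdg'']],
    Contra [''hfag''],
    Contra [''heag''],
    Contra [''hfbag''],
    Contra [''hbagABeBBdbagagAAdbagE'', ''hHDH''],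
    Branch CHR ''h'' ''bcB'' [
     Contra [''ih''],
     Contra [''iaHAHbfBeBagHAHbfCBDaHAHbfcFcE''],
     Contra [''idAbbEHBHbfBBeagE''],
     Contra [''iH''],
     Contra [''ieGAEbbFBhdAhdaDBaDH'', ''iceCBhdbEbihdBi''],
     Contra [''ihae'', ''jDaaiAdg'', ''jHBeAIbfBajIajAdAEajI''],
     Contra [''iBfbagagAAd'', ''jbHBeiAE'', ''kacbagABjAhaCfbagFABj'',
      ''jeBibEbbDaGABCbaGABcFceCBhBjDakAkbE'', ''jbagABJhacbaGABCJAkj'', ''jfjj''],
     Contra [''iBH''],
     Contra [''iGAEbbFBheBhe'', ''ieiAiaD''],
     Contra [''iBH''],
     Contra [''ibaeG'', ''jbaGABCh'', ''kbIBeBJ'', ''iDaBjbEbbaGABBAJiF'', ''lKbaiG'',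
      ''iLKbFBhcahACHbIDaGABCbaGABcFIDaJblBAJbaG'', ''iILI''],
     Contra [''iEbhceCBhcbFBhcbhceCBhCf'', ''iIEI''],
     Contra [''iBHbcBFHbCHbcECfCFHcFHbfBBeBFH'', ''iFHbIBHbcBFHbICBhf'', ''ifii''],
     Contra [''ih''],
     Branch CHR ''i'' ''BA'' [
      Contra [''jdbi''],
      Contra [''jeidAidaD''],
      Contra [''jbIBAEbIBaD''],
      Contra [''jabI''],
      Contra [''jeBdbiBdbi''],
      Contra [''jeBBfbagagAAdbi''],
      Contra [''jaIEbbDaGABCbaGABcFceCBhAdACagAcabiaaGAGABF''],
      Contra [''jbIBD''],
      Contra [''jeBBfbagagAAdbi''],
      Contra [''jbiBe'', ''kabaGABAH'', ''lbbagEABBeBk'', ''mBfbagagAAd'', ''nFcLbCEcbagABBe'',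
       ''oLbCmcnBh'', ''pfCbagABcbagAd'', ''qeBagAbJACaGAcaDaHbcECpBei'', ''lcJCLbCagAcBqkh'',
       ''rCHcbaglAdj'', ''qcRCOcApeaMEbhBCpq'', ''kbDRCOcBPcKabdBACqabDBAk'',
       ''kcRCLNCMEbKPBKPceClcr'', ''kacJAFaCocrCkpAQk''],
      Contra [''jbIBD''],
      Contra [''jeBGbi''],
      Contra [''jbEbbaeGABCBfbagagAAdcFcBhabagABAbEbbaeGABCEcbagABBeCBhaCHcAHbIBaDaGAGABF''],
      Contra [''jAHeBBfbagagAAdbiaE'', ''jfjj''],
      Contra [''jacECfCbagABcAHbcabaGABAHCfCbagABcbagAdBBei''],
      Contra [''jei''],
      Contra [''jfCbagABcbagAd'', ''kacEbbaGABCecbagEABBeBabaGABAHbCfCDaaGAGABFbcAHbcECjBei'',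
       ''lFcAkJceCaDakbDaGABAHCjbDakJceCAkBe'', ''ldAbLBeBagLAbLCHcbagAkJceCBhalE''],
      Contra [''jbbGAiaBBeGAiaD''],
      Contra [''jceCIBDaaGAGABFbbE''],
      Contra [''jBfbagagAAd'', ''keBjbi'', ''kbbjKBejAEkaDHkJ''],
      Closed [''jfCbagABcbagAd'', ''kbaeG'', ''lBfbagagAAd'', ''mcaEbJceCBhAdAKeaLEbhBCj'',
       ''nabaGABAH'', ''obKBeBn'', ''pMcdALaCObCEcbagABBeBaObClcFcObCEcbagABBeCBhAdbi'',
       ''qBpbagE'', ''rPJcbHBelAEbaGABaDaHAnCjbAObKBeaLEbNabdBJceCGABChcqBkCagAcq'',
       ''kAJaDaRbagAJceCBharAdAjbDBkPbbagABBe'', ''rcdCObraGABCNcqae'', ''lbLBraEAnhaqAd'',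
       ''raeARmpCDcqnhaqAd''] ''ab'' ''Ab'' 7 [('''', [(0, ''a''), (4, ''a'')]), (''a'', [(0,
       ''aa''), (2, ''aa'')]), (''aa'', [(0, ''''), (1, '''')])],
      Contra [''jdbi''],
      Contra [''jfabi''],
      Contra [''jdbi''],
      Contra [''jeBBfbagagAAdbi'', ''jbEbjFBj''],
      Contra [''jBfbagagAAd'', ''keBjbid'', ''kbbjKBejAEkaDHkJ''],
      Contra [''jBfbagagAAd'', ''keBjbi'', ''kbagABKbfbagABKBejAEbFBhaCkcbagAdJ'', ''kKFK''],
      Contra [''jBfbagagAAd'', ''kJEbeBjbiBeBjbicd'', ''kaeAdAJakcDaafAbakAHBejAE'']],
     Contra [''iaBh''],
     Contra [''icBh''],
     Contra [''ibHBeBfbagagAAdAE'', ''jBiCHcbag'', ''kDaJAJcD'', ''lkcaFAJckCf'',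
      ''kbagALCHcbagALDaGABCbaGABcFchjCKAfbagABaIhjaGABChcl'', ''kfkakAdl''],
     Contra [''ih''],
     Contra [''ihAeagEhAeag''],
     Contra [''ibFBhAfCbagABcbagAdHBeBfbagagAAdAEaaD'', ''ifbagagEAIbbagABBeBIbGABFcaHAICaH''],
     Contra [''ieCBhbEcbGABFBhbEbaBe''],
     Contra [''iEbeBHeBHbcE'', ''iicbFBeBHbciCf'', ''iIEI''],
     Branch CHR ''i'' ''BA'' [
      Contra [''jdbi''],
      Contra [''jeidAidaD''],
      Contra [''jbIBAEbIBaD''],
      Contra [''jabI''],
      Contra [''jeBdbiBdbi''],
      Contra [''jeBBfbagagAAdbi''],
      Closed [''jfCbagABcbagAd'', ''kBfbagagAAd'', ''lbAbkBaBJceCBhbagE'',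
       ''mbAbagABaBJceCBhbagBdKbE'', ''nAFaBlbEbbMBei'', ''oEbJceCBhCaGAcbagEABNAbagABNaDaF'',
       ''pbcECjBeo'', ''qeo'', ''rnbaGABChcF'', ''scDCRKBRKbE'',
       ''naRAkrcdCsbfHBekAEaDaMbnBeBdbGABFcsCjbAfanbdBlaN'',
       ''scagACRAElabFsBekgo''] ''bc'' ''ac'' 7 [('''', [(0, ''b''), (4, ''b'')]), (''b'', [(0,
       ''bb''), (1, ''bb'')]), (''bb'', [(0, ''''), (2, '''')])],
      Contra [''jbIBD''],
      Contra [''jeBBfbagagAAdbi''],
      Contra [''jabHBeBfbagagAAdAE'', ''kJabF'', ''kKbAFaBJbEbbKBeiBe''],
      Contra [''jbIBD''],
      Contra [''jeBGbi''],
      Contra [''jBfbagagAAd'', ''kbHBejAE'', ''laKbF'', ''mAFaBaKAbEbbLBei'',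
       ''maBhbagAAdJEbMBlaM'', ''jKbMaGABChcF'', ''laHALbDaGABCbaGABcFckjCf'',
       ''lfbagaDaCJKcbagAlBkjAmAlGABCkjcE''],
      Contra [''jbDaGABCbaGABcFce'', ''kEbbIEbjBBeBfbagagAAdAEaBj'',
       ''kfCHcbagBhbagAAdAkBhbagkJBei''],
      Contra [''jBfbagagAAd'', ''kEbbabHBejAEBei'', ''kfCHcbagABKEbKBaejAE''],
      Contra [''jei''],
      Contra [''jBfbagagAAd'', ''keaJEbh'', ''lbagEAKBei'',
       ''lbjBLFccbEbLbagEABBeBKCfCbagABhcFCfl''],
      Contra [''jbbGAiaBBeGAiaD''],
      Contra [''jBfbagagAAd'', ''kbDaGABCbaGABcFce'', ''kJEbbIEbkBBejAEaBk'', ''kceCKJBKJbE''],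
      Contra [''jaeBBfbagagAAdbi''],
      Contra [''jAeaDaaGAGABFbEbh'', ''jJAbIEbajbFBABBeBaJAbAfaaD''],
      Contra [''jdbi''],
      Contra [''jabHBeBfbagagAAdAE'', ''jaBJbEbbabfBAjBei''],
      Contra [''jdbi''],
      Contra [''jeBBfbagagAAdbi'', ''jbEbjFBj''],
      Contra [''jaeBBfbagagAAdbid''],
      Contra [''jbEbeBBfbagagAAdbiBe''],
      Contra [''jBfbagagAAd'', ''kIBJbE'', ''lJEbKBKcd'', ''mDaaLAGABH'',
       ''mKcdCLJEbKamLABaGAbEbHBejlclCBKcaLACMALaD'', ''mkmaaDaMKcdCLAAMbLJ'']],
     Contra [''iaeGABHbcE''],
     Contra [''idBeGAEbbFBhBaDaHbfBAH''],
     Contra [''iGAEbbFBhe'', ''ieiAiaD''],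
     Contra [''iFBhbEbhcbFBhCBhce'', ''iIFI'']],
    Branch CHR ''h'' ''AC'' [
     Contra [''ifah''],
     Contra [''ifahAdhAdaD''],
     Contra [''iaH''],
     Contra [''iHDaaFH''],
     Contra [''iDaHDaaGABDbAAdgCdgcF'', ''iIgFcIg''],
     Contra [''iabaGABAcDaH'', ''jcIaeBdbagAAdCabagABAiBCDcGbagahAd'',
      ''jeBIdADaabaGABAfGABDaaGABDbAJcaEAiCjbabagahAd''],
     Contra [''iaHAF''],
     Contra [''ifCGDcGDaaBdbagAAdh''],
     Contra [''idAbagABaDaaHAGABgCdcFcabagABHACbE''],
     Contra [''iaHAF''],
     Contra [''ieBagAdbagCDcGDaaBdbagAAdhAAd'', ''idaIbIBeagAAdh''],
     Contra [''iabagAdbagABBe'', ''jaGABD'', ''kDaaGABDbAIcacabaGABACfAj'', ''lKACecah'',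
      ''kklcE'', ''mgCd'', ''nbafG'', ''ibMDaIABnAGaD'', ''oLabagJAdkabagABGABAcbabDaGABABCK'',
      ''ldAkabagbaGABAfCMcBiaBlo'', ''iBiLaGAbEbbagABBe'', ''meBIMbagAlaEbaG'',
      ''mDLaCbaGABcAjEbnkMbaGABAKaDlBmo'', ''mLaCMciJAdNbaabagABAAdAeam''],
     Contra [''iaHAF''],
     Contra [''iahAd'', ''jabagAdbagABBe'',
      ''jiaIGABDaabDaGABAAbEbbafGABAGaDBaICecGABgCdigcFjaBdbagAAdbagFabagADaGABAcJCfGI'',
      ''jfjBjbE''],
     Contra [''idh''],
     Contra [''idAHDaaGAE''],
     Contra [''iccGhCCfGhD''],
     Contra [''iHDaaG''],
     Contra [''iDaabaGABAfGABDaaGABDbEbbaGABDaGABAcaH'', ''jdAbagABai'',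
      ''jcahAjaEbaGABACfCicahAj''],
     Contra [''iecah''],
     Contra [''ifah''],
     Contra [''iahBdbagAAdh'', ''ifiBibE''],
     Contra [''ifah''],
     Contra [''iHDaaCDcGDaaBdbagAAdhAAdhG'', ''ifiBibE''],
     Closed [''iCecHACE'', ''jbdAgabagFABBeBaabagAdBAAdbagi'', ''kjCIcF'', ''lHACEciaD'',
      ''malAdAFabagABjCIcF'', ''neaglAdAFabagABjCIcF'', ''oBabagABAdbagALCagALcF'',
      ''pbCDcGDaaEbbaGABDaGABAfGABAGaD'', ''qDaabaGABAcDCOAP'', ''rbfBQAQaD'',
      ''pcrabaGABACfCqciAFabagfGABAiaDarAdqbibagFABBeBdbagCbagABecahGABgCdcFbAPbCbagABecahGABAoabagAdqBe'',
      ''rdAEaqbFBralAdAFabagABjCIcF''] ''ab'' ''cb'' 7 [('''', [(0, ''a''), (0, ''b'')]), (''a'',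
      [(5, ''b''), (4, '''')]), (''b'', [(2, ''''), (3, ''a'')])],
     Contra [''iBdbagCDcGDaaBdbagAAdhAd'', ''iIEbbIBaGAbEBe''],
     Contra [''iaBdbagAAdh'', ''jaIAdgCd'', ''jaBIbAibcAiaDajFcfCJcGCfCJcGAf''],
     Contra [''iFHDaaCDcGDaaBdbagAAdhfAAdhfG'', ''ifiBibE'']],
    Contra [''heag''],
    Contra [''hagAd'', ''iAEaHBHbE'', ''hBdbhAIaD'', ''hBDbhahAdi'', ''hHEH''],
    Contra [''hbageABeBBdbageageAAdbag'', ''hHDH''],
    Branch CHR ''h'' ''AC'' [
     Contra [''ifah''],
     Contra [''ifahAdhAdaD''],
     Contra [''iaH''],
     Contra [''iHDaaFH''],
     Contra [''iGDaHACg''],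
     Contra [''icDaH'', ''ieIcgCfCecahAdAIGABgceICfCg''],
     Contra [''iaHAF''],
     Contra [''iGcah''],
     Contra [''icaHACE''],
     Contra [''iaHAF''],
     Contra [''iCGcahcECG'', ''ibdBeBIbdAAEabIBeBdbagceBI''],
     Contra [''iccahGACCfah''],
     Contra [''iaHAF''],
     Contra [''iCGDaHAcF''],
     Contra [''idh''],
     Closed [''ifCE'', ''jEbHBHAF'', ''kGAjaD'', ''lCkcah'', ''lClcaheClcahAAdAeahbDaLbFBHACKcBe'',
      ''maEHACaHAcFcKCf'', ''nkm'', ''kDaKAKce'', ''obKBHDamAm'',
      ''keBKbjAfaDamAm''] ''bc'' ''Cb'' 6 [('''', [(0, ''b''), (0, ''c'')]), (''b'', [(0, ''bb''),
      (4, ''b'')]), (''c'', [(2, ''c''), (1, ''bb'')]), (''bb'', [(0, ''''), (5, '''')])],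
     Contra [''iaGh''],
     Contra [''iFcHCHAF'', ''jiAcdCHAiaD'', ''jJahGABhcIjCfCg''],
     Contra [''iCEcahG'', ''jBdbICIcF'', ''keBBgceBjbCJBaHAbbEbah'', ''lHDaaahAAdAJBdbagckaH'',
      ''kDaKALcI'', ''jaIFcJCH'', ''iJdAgak'', ''iLcKDaaICaHAcFGAAji''],
     Contra [''iccaHACaHACE''],
     Contra [''ifah''],
     Contra [''iCGcahE''],
     Contra [''ifah''],
     Contra [''icahACfCCdcahahAAdcahF'', ''iIDI''],
     Contra [''icDaHACBcaHACbE'', ''jEbbFccaHACCBIcgCfCbaGABgcBe'',
      ''kaGABgbcahCGAJabagABecahahAAd'', ''kaGaDaJcahFiAKafHACjAkAd''],
     Contra [''iahAd'', ''jAFaICIcF'', ''iCdciAJaD'', ''iCDciaiAdj'', ''iIFI''],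
     Contra [''icbagABCGbagf'', ''jbaCGcFGABABi'', ''kbahABjahbf'', ''lcECGABDaKAKbah'',
      ''lClcJbajFGABAEbLBHaDaCgcIGABgfJ'', ''mBjblaHAJbKbCDcBBelaIGABg'', ''nMKbCABdbagcBeBD'',
      ''mCdcahbiBeNMKbJbaGABAlaeBlAd'',
      ''mcbNBcagACbEbHDaLEAKbCAGaDcmhBeBcaGACbnBBCGABDbEbIBHaDaCDcm''],
     Contra [''icahfACfCCdcahfahfAAdcah'', ''iIDI'']]])"
  by code_simp

section \<open>Triples without commuting pairs: orders of elements and the equality of
  \<open>G\<close> and \<open>H\<close>\<close>

locale nonabelian_triple = product_free_triple +
  assumes noncomm: "s \<in> S \<Longrightarrow> t \<in> S \<Longrightarrow> s \<otimes> t = t \<otimes> s \<Longrightarrow> s = t"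
begin

lemma rotate: "nonabelian_triple G S b c a"
proof unfold_locales
  show "S = {b, c, a}" by (auto simp: S_eq)
  show "distinct [b, c, a]" using distinct by auto
qed (fact noncomm abc_closed)+

lemma swap: "nonabelian_triple G S a c b"
proof unfold_locales
  show "S = {a, c, b}" by (auto simp: S_eq)
  show "distinct [a, c, b]" using distinct by auto
qed (fact noncomm abc_closed)+

lemma bound_by_certificate:
  assumes "check (bad @ forbidden_words) D cert" "\<forall>w\<in>set bad. ev w \<noteq> \<one>" "relators_hold D"
  shows "finite H \<and> card H \<le> 24"
  using check_sound(1)[OF assms(1) _ assms(3)] bad_words_nontrivial assms(2) noncomm by auto

text \<open>An element of \<open>S\<close> that is a power of another one commutes with it and hence
  equals it. So an inverse of \<open>s\<close> in \<open>S\<close> is \<open>s\<close> itself, and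
  if \<open>s t u = 1\<close> has a repeated factor, then all three factors agree.\<close>

lemma square_one_or_cube_one:
  assumes s: "s \<in> S"
    and prod: "\<And>t u. S = {s, t, u} \<Longrightarrow> s \<noteq> t \<Longrightarrow> s \<noteq> u \<Longrightarrow> t \<noteq> u \<Longrightarrow> s \<otimes> (t \<otimes> u) \<noteq> \<one>"
  shows "s \<otimes> s = \<one> \<or> s \<otimes> (s \<otimes> s) = \<one>"
proof (cases "inv s \<in> S")
  case True
  then have "inv s = s" using noncomm[of s "inv s"] s by simp
  then show ?thesis using s by (metis in_carrier r_inv)
next
  case False
  then obtain t u where tu: "t \<in> S" "u \<in> S" "s \<otimes> (t \<otimes> u) = \<one>"
    using inverse_cases s by metis
  then have inv_s: "inv s = t \<otimes> u" and inv_tu: "inv (t \<otimes> u) = s"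
    using s by (metis in_carrier inv_equality inv_inv m_closed)+
  consider "t = s" | "u = s" | "t = u" | "t \<noteq> s" "u \<noteq> s" "t \<noteq> u" by blast
  then show ?thesis
  proof cases
    case 1
    then have "u = inv s \<otimes> inv s" using inv_s s tu inv_solve_left[of u s "inv s"] by simp
    then have "u = s" using noncomm[of u s] s tu by (simp add: m_assoc) (simp flip: m_assoc)
    then show ?thesis using 1 tu by simp
  next
    case 2
    then have "t = inv s \<otimes> inv s" using inv_s s tu inv_solve_right[of t "inv s" s] by simp
    then have "t = s" using noncomm[of t s] s tu by (simp add: m_assoc) (simp flip: m_assoc)
    then show ?thesis using 2 tu by simp
  next
    case 3
    then have "s = inv t \<otimes> inv t" using inv_tu tu by (simp add: inv_mult_group)
    then have "s = t" using noncomm[of s t] s tu by (simp add: m_assoc) (simp flip: m_assoc)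
    then show ?thesis using 3 tu by simp
  next
    case 4
    then have "S = {s, t, u}" using s tu abc_neq by (auto simp: S_eq)
    then show ?thesis using prod[of t u] 4 tu by metis
  qed
qed

text \<open>\<open>x x\<close> and its inverse both lie in \<open>S\<close> and commute, hence they
  coincide.\<close>

lemma outside_square:
  assumes x: "x \<in> carrier G" "x \<notin> H"
  shows "x \<otimes> x \<in> S" "x \<otimes> x \<otimes> (x \<otimes> x) = \<one>"
proof -
  show s: "x \<otimes> x \<in> S" using square_in_S x by blast
  have "inv (x \<otimes> x) = x \<otimes> x" using noncomm[OF inv_square_in_S[OF x] s] x by simp
  then show "x \<otimes> x \<otimes> (x \<otimes> x) = \<one>" using x by (metis m_closed r_inv)
qed

text \<open>Two of the three elements \<open>x\<close>, \<open>x s\<close> and \<open>x s\<^sup>2\<close> have the same square \<open>t\<close>, so that \<open>s\<close>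
  commutes with the involution \<open>t\<close>.\<close>

lemma order_three_imp_eq_H:
  assumes s: "s \<in> S" "s \<otimes> s \<noteq> \<one>" "s \<otimes> (s \<otimes> s) = \<one>"
  shows "carrier G = H"
proof -
  have False if x: "x \<in> carrier G" "x \<notin> H" for x
  proof -
    have *: False if y: "y \<in> carrier G" "y \<notin> H" and h: "h \<in> {s, s \<otimes> s}" and eq: "y \<otimes> y = y \<otimes> h \<otimes> (y \<otimes> h)" for y h
    proof -
      define t where "t = y \<otimes> y"
      have t: "t \<in> S" "t \<otimes> t = \<one>" using outside_square[OF y] by (simp_all add: t_def)
      have h': "h \<in> carrier G" using h s by auto
      have "y \<otimes> t = t \<otimes> y" using y by (simp add: t_def m_assoc)
      moreover have "y \<otimes> h \<otimes> t = t \<otimes> (y \<otimes> h)" using y h' unfolding t_def eq by (simp add: m_assoc)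
      ultimately have "y \<otimes> (h \<otimes> t) = y \<otimes> (t \<otimes> h)" using y h' t by (metis in_carrier m_assoc)
      then have ht: "h \<otimes> t = t \<otimes> h" using y h' t by simp
      \<comment> \<open>For \<open>h = s s\<close> the square of \<open>h\<close> is s^4 = s, so
        whatever commutes with \<open>h\<close> commutes with \<open>s\<close>.\<close>
      have "s = h \<or> s = h \<otimes> h" using h s by (auto simp: m_assoc)
      then have "s \<otimes> t = t \<otimes> s" using ht h' t by (metis in_carrier m_assoc)
      then show False using noncomm s t by metis
    qed
    obtain t u where "S - {s} \<subseteq> {t, u}" using s by (auto simp: S_eq)
    then have sq: "y \<otimes> y = t \<or> y \<otimes> y = u" if "y \<in> carrier G" "y \<notin> H" for y
      using outside_square[OF that] s by blast
    have out: "x \<otimes> s \<in> carrier G" "x \<otimes> s \<notin> H" "x \<otimes> s \<otimes> s \<in> carrier G" "x \<otimes> s \<otimes> s \<notin> H"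
      using x s H_cancel by auto
    \<comment> \<open>Pigeonhole: the three squares are involutions in \<open>S\<close>, and
      \<open>s\<close> is none, so only two values are available.\<close>
    have "x \<otimes> x = x \<otimes> s \<otimes> (x \<otimes> s) \<or> x \<otimes> s \<otimes> (x \<otimes> s) = x \<otimes> s \<otimes> s \<otimes> (x \<otimes> s \<otimes> s)
        \<or> x \<otimes> x = x \<otimes> s \<otimes> s \<otimes> (x \<otimes> s \<otimes> s)"
      using sq[OF x] sq[OF out(1,2)] sq[OF out(3,4)] by metis
    then show False
      using *[OF x, of s] *[of "x \<otimes> s" s] *[OF x, of "s \<otimes> s"] x s H_cancel by (auto simp: m_assoc)
  qed
  then show ?thesis by auto
qed

text \<open>Every inverse of an element of \<open>S\<close> is a product of two elements of
  \<open>S\<close>, so \<open>S\<close> contains no involution that could be the square of an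
  element outside \<open>H\<close>.\<close>

lemma product_one_imp_eq_H:
  assumes "a \<otimes> (b \<otimes> c) = \<one>"
  shows "carrier G = H"
proof -
  have "inv (b \<otimes> c) = a" using assms by (simp add: inv_equality)
  then have inv_a: "inv a = b \<otimes> c" using inv_inv[of "b \<otimes> c"] by simp
  have inv_c: "inv c = a \<otimes> b" using assms by (simp add: inv_equality m_assoc)
  have "b \<otimes> (c \<otimes> a) = \<one>" using inv_a l_inv[of a] by (simp add: m_assoc)
  then have "inv (c \<otimes> a) = b" by (simp add: inv_equality)
  then have inv_b: "inv b = c \<otimes> a" using inv_inv[of "c \<otimes> a"] by simp
  have "inv s \<noteq> s" if "s \<in> S" for s
    using that inv_a inv_b inv_c product_free abc_in unfolding S_eq by (metis empty_iff insert_iff)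
  then have "x \<in> H" if "x \<in> carrier G" for x
    using outside_square[of x] that by (metis in_carrier inv_equality)
  then show ?thesis by auto
qed

text \<open>The conjugate \<open>a b a\<close> is an involution, so its square is not in
  \<open>S\<close>, and quotients from \<open>S\<close> are products. If it were a product
  \<open>s t\<close>, then \<open>s\<close> and \<open>t\<close> would commute and it would be 1.
  Only membership in \<open>S\<close> remains.\<close>

lemma involutions_conjugate:
  assumes "\<And>s. s \<in> S \<Longrightarrow> s \<otimes> s = \<one>"
  shows "a \<otimes> (b \<otimes> a) = c"
proof -
  define g where "g = a \<otimes> (b \<otimes> a)"
  have inv: "inv s = s" if "s \<in> S" for s using assms that by (simp add: inv_equality)
  have g: "g \<in> carrier G" by (simp add: g_def)
  have "g \<otimes> g = a \<otimes> (b \<otimes> (a \<otimes> a \<otimes> (b \<otimes> a)))" unfolding g_def by (simp add: m_assoc)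
  also have "\<dots> = \<one>" using assms by (simp flip: m_assoc)
  finally have g2: "g \<otimes> g = \<one>" .
  have g_ne: "g \<noteq> a" "g \<noteq> b"
  proof -
    show "g \<noteq> a"
    proof
      assume "g = a"
      then have "a \<otimes> (b \<otimes> a) = a \<otimes> \<one>" by (simp add: g_def)
      then have "b \<otimes> a = \<one>" by (simp del: r_one)
      then show False using abc_neq inv by (metis abc_closed(1,2) inv_equality abc_in(1))
    qed
    show "g \<noteq> b"
    proof
      assume "g = b"
      then have "a \<otimes> (a \<otimes> (b \<otimes> a)) = a \<otimes> b" by (simp add: g_def)
      then have "b \<otimes> a = a \<otimes> b" using assms[of a] by (simp flip: m_assoc)
      then show False using noncomm[of b a] abc_neq by simp
    qed
  qed
  have "g \<noteq> s \<otimes> t" if st: "s \<in> S" "t \<in> S" for s t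
  proof
    assume gst: "g = s \<otimes> t"
    then have "s \<otimes> t = t \<otimes> s" using inv_equality[OF g2 g g] inv st by (simp add: inv_mult_group)
    then have "g = \<one>" using noncomm assms st gst by metis
    then have "a \<otimes> (a \<otimes> (b \<otimes> a)) \<otimes> a = a \<otimes> a" by (simp add: g_def)
    then have "b = \<one>" using assms[of a] by (simp flip: m_assoc) (simp add: m_assoc assms)
    then show False using one_notin_S abc_in by metis
  qed
  then have "g \<in> S" using cover[OF g] g2 inv one_notin_S by metis
  then show ?thesis using g_ne by (simp add: g_def S_eq)
qed

text \<open>The square of \<open>x b\<close> is \<open>a\<close>, \<open>b\<close> or
  \<open>c\<close>. The first value is the claim, the second would give \<open>a = b\<close>, and
  the third would make \<open>x\<close>, and with it \<open>x x = a\<close>, commute with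
  \<open>b\<close>.\<close>

lemma involutions_outside:
  assumes invol: "\<And>s. s \<in> S \<Longrightarrow> s \<otimes> s = \<one>" and x: "x \<in> carrier G" "x \<notin> H" "x \<otimes> x = a"
  shows "x \<otimes> b = c \<otimes> x"
proof -
  interpret rotate: nonabelian_triple G S b c a by (rule rotate)
  interpret rot: nonabelian_triple G S b a c by (rule rotate.swap)
  have aba: "a \<otimes> (b \<otimes> a) = c" "b \<otimes> (a \<otimes> b) = c"
    using involutions_conjugate rot.involutions_conjugate invol by auto
  \<comment> \<open>x^4 is the square of \<open>a\<close> and hence trivial, so the inverse of
    \<open>x\<close> is x^3.\<close>
  have inv_x: "inv x = a \<otimes> x"
  proof -
    have "a \<otimes> x \<otimes> x = \<one>" using x invol[of a] by (simp add: m_assoc)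
    then show ?thesis using x by (simp add: inv_equality)
  qed
  define s where "s = x \<otimes> b \<otimes> (x \<otimes> b)"
  have s: "s \<in> S" unfolding s_def using x H_cancel by (intro square_in_S) auto
  have "s \<otimes> b = x \<otimes> b \<otimes> x" unfolding s_def using x invol[of b] by (simp add: m_assoc)
  then have "x \<otimes> b = s \<otimes> b \<otimes> inv x" using x s inv_solve_right[of "x \<otimes> b" "s \<otimes> b" x] by simp
  then have xb: "x \<otimes> b = s \<otimes> (b \<otimes> (a \<otimes> x))" using x s by (simp add: inv_x m_assoc)
  consider "s = a" | "s = b" | "s = c" using s by (auto simp: S_eq)
  then show ?thesis
  proof cases
    case 1
    then show ?thesis using xb x by (simp flip: aba(1) add: m_assoc)
  next
    case 2
    then have "x \<otimes> b = b \<otimes> b \<otimes> (a \<otimes> x)" using xb x by (simp add: m_assoc)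
    moreover have "a \<otimes> x = x \<otimes> a" using x(1) by (simp flip: x(3) add: m_assoc)
    ultimately have "b = a" using x invol[of b] by simp
    then show ?thesis using abc_neq by simp
  next
    case 3
    then have "x \<otimes> b = b \<otimes> (a \<otimes> (b \<otimes> b \<otimes> (a \<otimes> x)))" using xb x by (simp flip: aba(2) add: m_assoc)
    then have "x \<otimes> b = b \<otimes> (a \<otimes> a \<otimes> x)" using x invol[of b] by (simp add: m_assoc)
    then have xb: "x \<otimes> b = b \<otimes> x" using x invol[of a] by simp
    have "a \<otimes> b = x \<otimes> x \<otimes> b" using x by simp
    also have "\<dots> = x \<otimes> (b \<otimes> x)" using x(1) xb by (simp add: m_assoc)
    also have "\<dots> = x \<otimes> b \<otimes> x" using x(1) by (simp add: m_assoc)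
    also have "\<dots> = b \<otimes> (x \<otimes> x)" unfolding xb using x(1) by (simp add: m_assoc)
    also have "\<dots> = b \<otimes> a" using x by simp
    finally show ?thesis using noncomm[of a b] abc_neq by simp
  qed
qed

text \<open>Conjugation by an outside \<open>x\<close> would exchange \<open>b\<close> and
  \<open>c\<close>, so \<open>x x = a\<close> would commute with \<open>b\<close>.\<close>

lemma involutions_imp_eq_H:
  assumes invol: "\<And>s. s \<in> S \<Longrightarrow> s \<otimes> s = \<one>" and x: "x \<in> carrier G" "x \<otimes> x = a"
  shows "x \<in> H"
proof (rule ccontr)
  assume xH: "x \<notin> H"
  interpret swap: nonabelian_triple G S a c b by (rule swap)
  have xb: "x \<otimes> b = c \<otimes> x" and xc: "x \<otimes> c = b \<otimes> x"
    using involutions_outside swap.involutions_outside invol x xH by auto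
  have "a \<otimes> b = x \<otimes> x \<otimes> b" using x by simp
  also have "\<dots> = x \<otimes> c \<otimes> x" using x(1) xb by (simp add: m_assoc)
  also have "\<dots> = b \<otimes> (x \<otimes> x)" unfolding xc using x(1) by (simp add: m_assoc)
  also have "\<dots> = b \<otimes> a" using x by simp
  finally show False using noncomm[of a b] abc_neq by simp
qed


section \<open>The nonabelian bound, by the orders of the elements of \<open>S\<close>\<close>

lemma bound_cube:
  assumes "a \<otimes> (b \<otimes> c) = \<one>" "a \<otimes> (a \<otimes> a) = \<one>"
  shows "finite H \<and> card H \<le> 24"
  using bound_by_certificate[OF certificate_cube] assms
  by (simp add: relators_hold_def letter_def)

lemma bound_no_cubes:
  assumes "a \<otimes> (b \<otimes> c) = \<one>" "\<And>s. s \<in> S \<Longrightarrow> s \<otimes> (s \<otimes> s) \<noteq> \<one>"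
    "a \<otimes> (a \<otimes> (a \<otimes> (a \<otimes> a))) \<noteq> \<one>"
  shows "finite H \<and> card H \<le> 24"
  using bound_by_certificate[OF certificate_no_cubes] assms
  by (simp add: relators_hold_def letter_def)

lemma bound_fifth_powers:
  assumes "a \<otimes> (b \<otimes> c) = \<one>"
    "\<And>s. s \<in> S \<Longrightarrow> s \<otimes> (s \<otimes> (s \<otimes> (s \<otimes> s))) = \<one>"
  shows "finite H \<and> card H \<le> 24"
  using bound_by_certificate[OF certificate_fifth_powers] assms
  by (simp add: relators_hold_def letter_def)

text \<open>The relation \<open>a b c = 1\<close> survives cyclic rotation, so an element singled
  out by its third or fifth power may be assumed to be \<open>a\<close>.\<close>

lemma bound_product_one:
  assumes abc: "a \<otimes> (b \<otimes> c) = \<one>"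
  shows "finite H \<and> card H \<le> 24"
proof -
  interpret bca: nonabelian_triple G S b c a by (rule rotate)
  interpret cab: nonabelian_triple G S c a b by (rule bca.rotate)
  have bca: "b \<otimes> (c \<otimes> a) = \<one>"
  proof -
    have "inv (b \<otimes> c) = a" using abc by (simp add: inv_equality)
    then show ?thesis using r_inv[of "b \<otimes> c"] by (simp add: m_assoc)
  qed
  have cab: "c \<otimes> (a \<otimes> b) = \<one>"
  proof -
    have "inv (c \<otimes> a) = b" using bca by (simp add: inv_equality)
    then show ?thesis using r_inv[of "c \<otimes> a"] by (simp add: m_assoc)
  qed
  consider s where "s \<in> S" "s \<otimes> (s \<otimes> s) = \<one>"
    | s where "s \<in> S" "\<And>s. s \<in> S \<Longrightarrow> s \<otimes> (s \<otimes> s) \<noteq> \<one>" "s \<otimes> (s \<otimes> (s \<otimes> (s \<otimes> s))) \<noteq> \<one>"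
    | "\<And>s. s \<in> S \<Longrightarrow> s \<otimes> (s \<otimes> (s \<otimes> (s \<otimes> s))) = \<one>"
    by metis
  then show ?thesis
  proof cases
    case (1 s)
    then show ?thesis
      using bound_cube[OF abc] bca.bound_cube[OF bca] cab.bound_cube[OF cab] by (auto simp: S_eq)
  next
    case (2 s)
    then show ?thesis
      using bound_no_cubes[OF abc] bca.bound_no_cubes[OF bca] cab.bound_no_cubes[OF cab] S_eq by blast
  next
    case 3
    then show ?thesis using bound_fifth_powers[OF abc] by blast
  qed
qed

text \<open>Conjugating \<open>a\<close> and \<open>b\<close> by each other gives \<open>c\<close>
  both times, which supplies the two relators beyond the squares.\<close>

lemma bound_involutions:
  assumes "\<And>s. s \<in> S \<Longrightarrow> s \<otimes> s = \<one>"
  shows "finite H \<and> card H \<le> 24"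
proof -
  interpret bca: nonabelian_triple G S b c a by (rule rotate)
  interpret bac: nonabelian_triple G S b a c by (rule bca.swap)
  have "a \<otimes> (b \<otimes> (a \<otimes> inv c)) = c \<otimes> inv c" "b \<otimes> (a \<otimes> (b \<otimes> inv c)) = c \<otimes> inv c"
    using involutions_conjugate[OF assms] bac.involutions_conjugate[OF assms]
    by (metis abc_closed inv_closed m_assoc m_closed)+
  then show ?thesis
    using bound_by_certificate[OF certificate_involutions] assms
    by (simp add: relators_hold_def letter_def)
qed

lemma bound_two_involutions:
  assumes "a \<otimes> a = \<one>" "b \<otimes> b = \<one>" "c \<otimes> (c \<otimes> c) = \<one>"
  shows "finite H \<and> card H \<le> 24"
  using bound_by_certificate[OF certificate_two_involutions] assms
  by (simp add: relators_hold_def letter_def)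

lemma bound_one_involution:
  assumes "a \<otimes> a = \<one>" "b \<otimes> (b \<otimes> b) = \<one>" "c \<otimes> (c \<otimes> c) = \<one>"
  shows "finite H \<and> card H \<le> 24"
  using bound_by_certificate[OF certificate_one_involution] assms
  by (simp add: relators_hold_def letter_def)

lemma bound_order_three:
  assumes "\<And>s. s \<in> S \<Longrightarrow> s \<otimes> (s \<otimes> s) = \<one>" "a \<otimes> (b \<otimes> c) \<noteq> \<one>" "a \<otimes> (c \<otimes> b) \<noteq> \<one>"
  shows "finite H \<and> card H \<le> 24"
  using bound_by_certificate[OF certificate_order_three] assms
  by (simp add: relators_hold_def letter_def)

lemma bound_nonabelian: "finite (carrier G) \<and> card (carrier G) \<le> 24"
proof -
  interpret bca: nonabelian_triple G S b c a by (rule rotate)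
  interpret cab: nonabelian_triple G S c a b by (rule bca.rotate)
  interpret acb: nonabelian_triple G S a c b by (rule swap)
  show ?thesis
  proof (cases "a \<otimes> (b \<otimes> c) = \<one> \<or> a \<otimes> (c \<otimes> b) = \<one>")
    case True
    then show ?thesis
      using bound_product_one acb.bound_product_one product_one_imp_eq_H acb.product_one_imp_eq_H by auto
  next
    case False
    have cyc: "x \<otimes> (y \<otimes> z) = \<one> \<Longrightarrow> y \<otimes> (z \<otimes> x) = \<one>" if "x \<in> S" "y \<in> S" "z \<in> S" for x y z
    proof -
      assume "x \<otimes> (y \<otimes> z) = \<one>"
      then have "inv (y \<otimes> z) = x" using that by (simp add: inv_equality)
      then show ?thesis using r_inv[of "y \<otimes> z"] that by (simp add: m_assoc)
    qed
    have prod: "s \<otimes> (t \<otimes> u) \<noteq> \<one>" if "S = {s, t, u}" "s \<noteq> t" "s \<noteq> u" "t \<noteq> u" for s t u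
    proof -
      have "s \<in> S" "t \<in> S" "u \<in> S" using that by auto
      \<comment> \<open>The six orders of the factors form two classes under cyclic rotation, and
        rotation preserves whether the product is 1.\<close>
      then have "(s, t, u) \<in> {(a, b, c), (b, c, a), (c, a, b), (a, c, b), (c, b, a), (b, a, c)}"
        using that(2-4) by (auto simp: S_eq)
      then show ?thesis using False cyc[of s t u] cyc[of t u s] by auto
    qed
    have orders: "s \<otimes> s = \<one> \<or> s \<otimes> (s \<otimes> s) = \<one>" if "s \<in> S" for s
      using square_one_or_cube_one[OF that prod] .
    have H: "finite H \<and> card H \<le> 24"
    proof (cases "\<forall>s\<in>S. s \<otimes> s = \<one>")
      case True
      then show ?thesis using bound_involutions by blast
    next
      case not_all: False
      show ?thesis
      proof (cases "\<forall>s\<in>S. s \<otimes> (s \<otimes> s) = \<one>")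
        case True
        then show ?thesis using bound_order_three False by blast
      next
        case not_all': False
        \<comment> \<open>With mixed orders exactly one element differs in order from the other two,
          and a cyclic rotation brings it to the position expected by the certificate.\<close>
        show ?thesis
          using not_all not_all' orders[of a] orders[of b] orders[of c]
            bound_two_involutions bca.bound_two_involutions cab.bound_two_involutions
            bound_one_involution bca.bound_one_involution cab.bound_one_involution
          by (simp add: S_eq) argo
      qed
    qed
    have "carrier G = H"
    proof (cases "\<forall>s\<in>S. s \<otimes> s = \<one>")
      case True
      have "x \<in> H" if x: "x \<in> carrier G" for x
      proof (rule ccontr)
        assume "x \<notin> H"
        then have "x \<otimes> x \<in> S" using outside_square x by blast
        then show False using \<open>x \<notin> H\<close> True x involutions_imp_eq_H bca.involutions_imp_eq_H cab.involutions_imp_eq_H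
          unfolding S_eq by blast
      qed
      then show ?thesis by auto
    next
      case False
      then show ?thesis using order_three_imp_eq_H orders by blast
    qed
    then show ?thesis using H by simp
  qed
qed

end

section \<open>The abelian bound and the conclusion\<close>

context abelian_triple begin

lemma permute:
  assumes "S = {x, y, z}" "distinct [x, y, z]"
  shows "abelian_triple G S x y z"
proof unfold_locales
  show "x \<in> carrier G" "y \<in> carrier G" "z \<in> carrier G" using assms(1) in_carrier by auto
qed (fact assms comm)+

lemma obtain_third:
  assumes "x \<in> S" "y \<in> S" "x \<noteq> y"
  obtains z where "S = {x, y, z}" "distinct [x, y, z]"
  using assms abc_neq that[of a] that[of b] that[of c] by (auto simp: S_eq)

text \<open>Two commuting involutions generate at most four elements, which leaves only 1 and
  \<open>x y\<close> for the third element of \<open>S\<close>.\<close>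

lemma single_involution:
  assumes "x \<in> S" "y \<in> S" "x \<otimes> x = \<one>" "y \<otimes> y = \<one>"
  shows "x = y"
proof (rule ccontr)
  assume "x \<noteq> y"
  then obtain z where S: "S = {x, y, z}" "distinct [x, y, z]" using obtain_third assms by blast
  have [simp]: "x \<in> carrier G" "y \<in> carrier G" using assms by simp_all
  have yx: "y \<otimes> x = x \<otimes> y" using S_comm assms by blast
  have "generate G {x, y} \<subseteq> {\<one>, x, y, x \<otimes> y}"
  proof (rule generate_subset_of_right_closed)
    have "x \<otimes> y \<otimes> x = x \<otimes> x \<otimes> y" "x \<otimes> y \<otimes> y = x \<otimes> (y \<otimes> y)"
      by (simp_all add: m_assoc yx)
    then have "x \<otimes> y \<otimes> x = y" "x \<otimes> y \<otimes> y = x" using assms by simp_all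
    then show "e \<otimes> g \<in> {\<one>, x, y, x \<otimes> y}" if "e \<in> {\<one>, x, y, x \<otimes> y}" "g \<in> {x, y}" for e g
      using that yx assms by auto
  qed auto
  moreover have z: "z \<in> S" "z \<noteq> x" "z \<noteq> y" using S by auto
  moreover have "z \<in> generate G {x, y}" using pair_generates[OF assms(1,2) \<open>x \<noteq> y\<close>] z by simp
  ultimately have "z = \<one> \<or> z = x \<otimes> y" by blast
  then show False using z(1) one_notin_S product_free[OF assms(1,2)] by blast
qed

lemma bound_abelian: "finite (carrier G) \<and> card (carrier G) \<le> 24"
proof (cases "\<exists>s\<in>S. inv s \<in> S")
  case False
  then show ?thesis using abelian_no_inverses by blast
next
  case True
  then obtain s where s: "s \<in> S" "inv s \<in> S" by blast
  show ?thesis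
  proof (cases "\<exists>s\<in>S. inv s \<in> S \<and> inv s \<noteq> s")
    case True
    then obtain x where x: "x \<in> S" "inv x \<in> S" "x \<noteq> inv x" by auto
    then obtain z where "S = {x, inv x, z}" "distinct [x, inv x, z]" by (rule obtain_third)
    then interpret p: abelian_triple G S x "inv x" z by (rule permute)
    show ?thesis using p.abelian_inverse_pair by simp
  next
    case self_inv: False
    have invol: "t \<otimes> t = \<one>" if "t \<in> S" "inv t \<in> S" for t
    proof -
      have "inv t = t" using self_inv that by blast
      then show ?thesis using r_inv[of t] that by simp
    qed
    obtain y where y: "y \<in> S" "s \<noteq> y" using s abc_neq by (metis abc_in)
    then obtain z where S: "S = {s, y, z}" "distinct [s, y, z]" using obtain_third s by blast
    then interpret p: abelian_triple G S s y z by (rule permute)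
    interpret q: abelian_triple G S s z y by (rule permute) (use S in auto)
    \<comment> \<open>Every element of \<open>S\<close> with inverse in \<open>S\<close> is an
      involution here, and \<open>s\<close> is the only one.\<close>
    have others: "inv y \<notin> S" "inv z \<notin> S"
    proof -
      have yz: "y \<in> S" "z \<in> S" "s \<noteq> y" "s \<noteq> z" using S by auto
      show "inv y \<notin> S" using single_involution[of s y] invol s yz by blast
      show "inv z \<notin> S" using single_involution[of s z] invol s yz by blast
    qed
    show ?thesis
      using p.abelian_involution p.abelian_involution_cyclic q.abelian_involution_cyclic others invol[OF s] by blast
  qed
qed

end

text \<open>Finiteness is stated separately because \<open>card\<close> is 0 on infinite
  sets.\<close>

theorem theorem1p1:
  fixes G (structure) and S :: "'a set"
  assumes "group G"
    and "locally_maximal_product_free G S"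
    and "card S = 3"
    and "\<And>T. T \<subseteq> S \<Longrightarrow> card T = 2 \<Longrightarrow> generate G T = generate G S"
  shows "finite (carrier G) \<and> card (carrier G) \<le> 24"
proof -
  interpret group G by fact
  interpret product_free_cover G S
    by (rule product_free_cover_of_locally_maximal[OF assms(2)]) (use assms(4) in simp)
  obtain a b c where abc: "S = {a, b, c}" "distinct [a, b, c]"
    using assms(3) by (auto simp: card_3_iff)
  interpret product_free_triple G S a b c
    by unfold_locales (use abc in_carrier in auto)
  show ?thesis
  proof (cases "\<exists>s\<in>S. \<exists>t\<in>S. s \<noteq> t \<and> s \<otimes> t = t \<otimes> s")
    case True
    then interpret abelian_triple G S a b c
      by unfold_locales (use H_comm in blast)
    show ?thesis by (rule bound_abelian)
  next
    case False
    then interpret nonabelian_triple G S a b c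
      by unfold_locales blast
    show ?thesis by (rule bound_nonabelian)
  qed
qed

end
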